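(* Let $G$ be a connected graph, let $(X,H)$ be a cover of $G$ for which there is an integer $r\ge 1$ with $|X_v|=r$ for all $v\in V(G)$, and let $f:V(H)\to\mathbb{N}_0$ be a function. Then $(G,X,H,f)$ is an uncolorable degree-feasible configuration if and only if $(G,X,H,f)$ is constructible.
   Context: $\mathbb{N}=\{1,2,\dots\}$, $\mathbb{N}_0=\mathbb{N}\cup\{0\}$. Graphs are finite, undirected, may have multiple edges, no loops; connected graphs are non-empty. $\mu_G(u,v)$ is the number of edges joining $u,v$; $d_G(v)$ is the number of edges incident with $v$. $tG$ has vertex set $V(G)$ and $\mu_{tG}=t\mu_G$. $K_n$, $C_n$ ($n\ge3$), $K_{s,s}$ are the simple complete graph, cycle, complete bipartite graph. A graph is a block if it is connected, non-empty and has no vertex whose deletion leaves at least two components. Covers. A cover of $G$ is a pair $(X,H)$, $H$ a graph, $X$ assigning to each $v\in V(G)$ a set $X_v\subseteq V(H)$, such that the $X_v$ are pairwise disjoint with union $V(H)$, each $X_v$ is independent in $H$, and for distinct $u,v\in V(G)$ the set of edges of $H$ between $X_u$ and $X_v$ is the union of $\mu_G(u,v)$ (possibly empty) matchings. A transversal is a set $T\subseteq V(H)$ with $|T\cap X_v|=1$ for all $v$. For $U\subseteq V(H)$ put $X_v(U)=X_v\cap U$; $(X,H)/U$ is the cover $(X',H[U])$ of $G[\{v: X_v(U)\ne\varnothing\}]$ with $X'_v=X_v(U)$. Configurations. A configuration is a tuple $(G,X,H,f)$ with $(X,H)$ a cover of the graph $G$ and $f:V(H)\to\mathbb{N}_0$.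 It is uniform if for some $r\ge1$ all $|X_v|=r$. It is degree-feasible if $\sum_{x\in X_v}f(x)\ge d_G(v)$ for all $v\in V(G)$. A subgraph $\tilde H$ of $H$ is strictly $f$-degenerate if each non-empty subgraph $H'$ of $\tilde H$ has a vertex $x$ with $d_{H'}(x)<f(x)$. The configuration is colorable if $(X,H)$ has a transversal $T$ with $H[T]$ strictly $f$-degenerate, otherwise uncolorable. Special covers (all up to renaming vertices of the cover graph). A $G$-cover is a cover with $X_v=\{x_v\}$ for all $v$ and $\mu_H(x_u,x_v)=\mu_G(u,v)$ for all distinct $u,v$. For $G=tC_n$ with $C_n=(v_1,\dots,v_n,v_1)$, a double $G$-cover is a cover with $X_{v_i}=\{x_i,x_{n+i}\}$ ($1\le i\le n$), $\mu_H(x_i,x_j)=t$ if $i-j\equiv\pm1 \pmod{2n}$ and $\mu_H(x_i,x_j)=0$ otherwise. If $s\in\mathbb{N}$ divides all multiplicities $\mu_H(x,y)$, the $s$-inflation of $(X,H)$ is the cover $(\tilde X,\tilde H)$ of $G$ obtained by replacing every $x\in V(H)$ by a set $U_x$ of $s$ new vertices, with $\tilde X_v=\bigcup_{x\in X_v}U_x$, and for distinct $x,y\in V(H)$ placing a copy of $mK_{s,s}$ with parts $U_x,U_y$, where $m=\mu_H(x,y)/s$. An inflation is an $s$-inflation for some $s\in\mathbb{N}$. Constructible configurations. The family of constructible configurations is defined recursively: a uniform configuration $(G,X,H,f)$ is constructible if one of the following holds. (K1) M-configuration: $G$ is a block and there is $U\subseteq V(H)$ such that $(X,H)/U$ is an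 inflation of a $G$-cover, and for $v\in V(G)$, $x\in X_v$: $f(x)=d_G(v)/|X_v(U)|$ if $x\in U$, else $f(x)=0$. (K2) K-configuration: $G=tK_n$ with $t,n\in\mathbb{N}$ and there are $p\ge1$, $n_1,\dots,n_p\in\mathbb{N}$ with $n_1+\dots+n_p=n-1$ and pairwise disjoint $U_1,\dots,U_p\subseteq V(H)$ such that each $(X,H)/U_i$ is an inflation of a $G$-cover, and for $v\in V(G)$, $x\in X_v$: $f(x)=tn_i/|X_v(U_i)|$ if $x\in U_i$ for some $i$, else $f(x)=0$. (K3) Odd C-configuration: $G=tC_n$ with $t\in\mathbb{N}$, $n\ge3$ odd, and there are disjoint $U_1,U_2\subseteq V(H)$ such that each $(X,H)/U_i$ is an inflation of a $G$-cover, and for $v\in V(G)$, $x\in X_v$: $f(x)=t/|X_v(U_i)|$ if $x\in U_i$ for $i\in\{1,2\}$, else $f(x)=0$. (K4) Even C-configuration: $G=tC_n$ with $t\in\mathbb{N}$, $n\ge4$ even, and there is $U\subseteq V(H)$ such that $(X,H)/U$ is an inflation of a double $G$-cover, and for $v\in V(G)$, $x\in X_v$: $f(x)=2t/|X_v(U)|$ if $x\in U$, else $f(x)=0$. (K5) There are two disjoint constructible configurations $(G^1,X^1,H^1,f^1)$, $(G^2,X^2,H^2,f^2)$ such that $G$ is obtained from the disjoint graphs $G^1,G^2$ by identifying a vertex $v^1\in V(G^1)$ and a vertex $v^2\in V(G^2)$ to a new vertex $v^*$; $H$ is obtained from the disjoint graphs $H^1,H^2$ by choosing a bijection $\pi:X^1_{v^1}\to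 X^2_{v^2}$ and identifying each $x\in X^1_{v^1}$ with $\pi(x)$ to a vertex $x^*$ (so $X_{v^*}$ is the set of these $x^*$, and $X_v=X^i_v$ for other $v\in V(G^i)$); and $f(y)=f^i(y)$ for $y\in V(H^i)\setminus X^i_{v^i}$, $f(x^* )=f^1(x)+f^2(\pi(x))$ for $x\in X^1_{v^1}$. *)

theory Defs
  imports Complex_Main "HOL-Library.Disjoint_Sets" "HOL-Number_Theory.Cong"
begin

text \<open>
  Finite loopless undirected multigraphs are represented by their vertex set and the
  multiplicity function, i.e. up to the names of parallel edges.
\<close>

record 'a mgraph =
  verts :: "'a set"
  mult :: "'a \<Rightarrow> 'a \<Rightarrow> nat"

definition multigraph :: "'a mgraph \<Rightarrow> bool" where
  "multigraph G \<longleftrightarrow> finite (verts G) \<and>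
     (\<forall>u v. mult G u v = mult G v u) \<and>
     (\<forall>v. mult G v v = 0) \<and>
     (\<forall>u v. mult G u v > 0 \<longrightarrow> u \<in> verts G \<and> v \<in> verts G)"

definition deg :: "'a mgraph \<Rightarrow> 'a \<Rightarrow> nat" where
  "deg G v = (\<Sum>u\<in>verts G. mult G v u)"

definition induced :: "'a mgraph \<Rightarrow> 'a set \<Rightarrow> 'a mgraph" where
  "induced G W = \<lparr>verts = verts G \<inter> W,
     mult = (\<lambda>u v. if u \<in> W \<and> v \<in> W then mult G u v else 0)\<rparr>"

definition subgraph :: "'a mgraph \<Rightarrow> 'a mgraph \<Rightarrow> bool" where
  "subgraph G' G \<longleftrightarrow> multigraph G' \<and> verts G' \<subseteq> verts G \<and>
     (\<forall>u v. mult G' u v \<le> mult G u v)"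

definition adj_rel :: "'a mgraph \<Rightarrow> ('a \<times> 'a) set" where
  "adj_rel G = {(u, v). u \<in> verts G \<and> v \<in> verts G \<and> mult G u v > 0}"

definition components :: "'a mgraph \<Rightarrow> 'a set set" where
  "components G = verts G // {(u, v). u \<in> verts G \<and> v \<in> verts G \<and> (u, v) \<in> (adj_rel G)\<^sup>*}"

definition connected_graph :: "'a mgraph \<Rightarrow> bool" where
  "connected_graph G \<longleftrightarrow> verts G \<noteq> {} \<and>
     (\<forall>u\<in>verts G. \<forall>v\<in>verts G. (u, v) \<in> (adj_rel G)\<^sup>*)"

definition block :: "'a mgraph \<Rightarrow> bool" where
  "block G \<longleftrightarrow> connected_graph G \<and>
     \<not> (\<exists>v\<in>verts G. card (components (induced G (verts G - {v}))) \<ge> 2)"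

definition graph_iso :: "('a \<Rightarrow> 'c) \<Rightarrow> 'a mgraph \<Rightarrow> 'c mgraph \<Rightarrow> bool" where
  "graph_iso \<phi> G G' \<longleftrightarrow> bij_betw \<phi> (verts G) (verts G') \<and>
     (\<forall>u\<in>verts G. \<forall>v\<in>verts G. mult G' (\<phi> u) (\<phi> v) = mult G u v)"

definition times_graph :: "nat \<Rightarrow> 'a mgraph \<Rightarrow> 'a mgraph" where
  "times_graph t G = \<lparr>verts = verts G, mult = (\<lambda>u v. t * mult G u v)\<rparr>"

definition complete_graph :: "nat \<Rightarrow> nat mgraph" where
  "complete_graph n = \<lparr>verts = {1..n},
     mult = (\<lambda>i j. if i \<in> {1..n} \<and> j \<in> {1..n} \<and> i \<noteq> j then 1 else 0)\<rparr>"

definition cycle_graph :: "nat \<Rightarrow> nat mgraph" where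
  "cycle_graph n = \<lparr>verts = {1..n},
     mult = (\<lambda>i j. if i \<in> {1..n} \<and> j \<in> {1..n} \<and> ([i = j + 1] (mod n) \<or> [j = i + 1] (mod n))
                   then 1 else 0)\<rparr>"


definition bip_matching :: "'b set \<Rightarrow> 'b set \<Rightarrow> ('b \<times> 'b) set \<Rightarrow> bool" where
  "bip_matching A B M \<longleftrightarrow> M \<subseteq> A \<times> B \<and> inj_on fst M \<and> inj_on snd M"

text \<open>
  In terms of multiplicities, the edges between \<open>X u\<close> and \<open>X v\<close> form the union of the
  matchings \<open>M i\<close> iff the multiplicity of each pair counts the \<open>M i\<close> that contain it
  (parallel edges never lie in a common matching, and the matchings may be taken edge-disjoint).
\<close>

definition cover :: "'a mgraph \<Rightarrow> ('a \<Rightarrow> 'b set) \<Rightarrow> 'b mgraph \<Rightarrow> bool" where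
  "cover G X H \<longleftrightarrow> multigraph H \<and>
     disjoint_family_on X (verts G) \<and>
     (\<Union>v\<in>verts G. X v) = verts H \<and>
     (\<forall>v\<in>verts G. \<forall>x\<in>X v. \<forall>y\<in>X v. mult H x y = 0) \<and>
     (\<forall>u\<in>verts G. \<forall>v\<in>verts G. u \<noteq> v \<longrightarrow>
        (\<exists>M :: nat \<Rightarrow> ('b \<times> 'b) set.
           (\<forall>i<mult G u v. bip_matching (X u) (X v) (M i)) \<and>
           (\<forall>x\<in>X u. \<forall>y\<in>X v. mult H x y = card {i. i < mult G u v \<and> (x, y) \<in> M i})))"

definition transversal :: "'a mgraph \<Rightarrow> ('a \<Rightarrow> 'b set) \<Rightarrow> 'b mgraph \<Rightarrow> 'b set \<Rightarrow> bool" where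
  "transversal G X H T \<longleftrightarrow> T \<subseteq> verts H \<and> (\<forall>v\<in>verts G. card (T \<inter> X v) = 1)"

definition is_G_cover :: "'a mgraph \<Rightarrow> ('a \<Rightarrow> 'b set) \<Rightarrow> 'b mgraph \<Rightarrow> bool" where
  "is_G_cover G X H \<longleftrightarrow> cover G X H \<and>
     (\<exists>x. (\<forall>v\<in>verts G. X v = {x v}) \<and>
          (\<forall>u\<in>verts G. \<forall>v\<in>verts G. u \<noteq> v \<longrightarrow> mult H (x u) (x v) = mult G u v))"

definition is_double_cover ::
  "nat \<Rightarrow> nat \<Rightarrow> 'a mgraph \<Rightarrow> ('a \<Rightarrow> 'b set) \<Rightarrow> 'b mgraph \<Rightarrow> bool" where
  "is_double_cover t n G X H \<longleftrightarrow> cover G X H \<and>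
     (\<exists>v x. graph_iso v (times_graph t (cycle_graph n)) G \<and>
        inj_on x {1..2 * n} \<and>
        (\<forall>i\<in>{1..n}. X (v i) = {x i, x (n + i)}) \<and>
        (\<forall>i\<in>{1..2 * n}. \<forall>j\<in>{1..2 * n}. mult H (x i) (x j) =
           (if [i = j + 1] (mod (2 * n)) \<or> [j = i + 1] (mod (2 * n)) then t else 0)))"

text \<open>\<open>(X', H')\<close> is, up to renaming vertices, the \<open>s\<close>-inflation of the cover \<open>(X, H)\<close> of \<open>G\<close>.\<close>

definition is_inflation_by ::
  "nat \<Rightarrow> 'a mgraph \<Rightarrow> ('a \<Rightarrow> 'b set) \<Rightarrow> 'b mgraph \<Rightarrow> ('a \<Rightarrow> 'b set) \<Rightarrow> 'b mgraph \<Rightarrow> bool" where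
  "is_inflation_by s G X H X' H' \<longleftrightarrow> s \<ge> 1 \<and>
     (\<forall>x\<in>verts H. \<forall>y\<in>verts H. s dvd mult H x y) \<and>
     (\<exists>W :: 'b \<Rightarrow> 'b set.
        disjoint_family_on W (verts H) \<and>
        (\<forall>x\<in>verts H. card (W x) = s) \<and>
        verts H' = (\<Union>x\<in>verts H. W x) \<and>
        (\<forall>v\<in>verts G. X' v = (\<Union>x\<in>X v. W x)) \<and>
        (\<forall>x\<in>verts H. \<forall>y\<in>verts H. \<forall>a\<in>W x. \<forall>b\<in>W y.
           mult H' a b = (if x = y then 0 else mult H x y div s)))"

definition is_inflation ::
  "'a mgraph \<Rightarrow> ('a \<Rightarrow> 'b set) \<Rightarrow> 'b mgraph \<Rightarrow> ('a \<Rightarrow> 'b set) \<Rightarrow> 'b mgraph \<Rightarrow> bool" where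
  "is_inflation G X H X' H' \<longleftrightarrow> (\<exists>s. is_inflation_by s G X H X' H')"

text \<open>
  The next two predicates speak about \<open>(X, H)/U\<close>, the cover \<open>(\<lambda>v. X v \<inter> U, induced H U)\<close>
  of the subgraph of \<open>G\<close> induced by the vertices \<open>v\<close> with \<open>X v \<inter> U \<noteq> {}\<close>.
  Being an inflation of a cover of \<open>G\<close> with nonempty parts forces this subgraph to be \<open>G\<close>.
  The inflated cover \<open>(X0, H0)\<close> can be sought in the same vertex type, as it has at most
  as many vertices as its inflation.
\<close>

definition restr_inflates_G_cover ::
  "'a mgraph \<Rightarrow> ('a \<Rightarrow> 'b set) \<Rightarrow> 'b mgraph \<Rightarrow> 'b set \<Rightarrow> bool" where
  "restr_inflates_G_cover G X H U \<longleftrightarrow>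
     (\<exists>(X0 :: 'a \<Rightarrow> 'b set) H0. is_G_cover G X0 H0 \<and>
        is_inflation G X0 H0 (\<lambda>v. X v \<inter> U) (induced H U))"

definition restr_inflates_double_cover ::
  "nat \<Rightarrow> nat \<Rightarrow> 'a mgraph \<Rightarrow> ('a \<Rightarrow> 'b set) \<Rightarrow> 'b mgraph \<Rightarrow> 'b set \<Rightarrow> bool" where
  "restr_inflates_double_cover t n G X H U \<longleftrightarrow>
     (\<exists>(X0 :: 'a \<Rightarrow> 'b set) H0. is_double_cover t n G X0 H0 \<and>
        is_inflation G X0 H0 (\<lambda>v. X v \<inter> U) (induced H U))"


definition configuration ::
  "'a mgraph \<Rightarrow> ('a \<Rightarrow> 'b set) \<Rightarrow> 'b mgraph \<Rightarrow> ('b \<Rightarrow> nat) \<Rightarrow> bool" where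
  "configuration G X H f \<longleftrightarrow> multigraph G \<and> cover G X H"

definition uniform_configuration ::
  "'a mgraph \<Rightarrow> ('a \<Rightarrow> 'b set) \<Rightarrow> 'b mgraph \<Rightarrow> ('b \<Rightarrow> nat) \<Rightarrow> bool" where
  "uniform_configuration G X H f \<longleftrightarrow> configuration G X H f \<and>
     (\<exists>r\<ge>1. \<forall>v\<in>verts G. card (X v) = r)"

definition degree_feasible ::
  "'a mgraph \<Rightarrow> ('a \<Rightarrow> 'b set) \<Rightarrow> 'b mgraph \<Rightarrow> ('b \<Rightarrow> nat) \<Rightarrow> bool" where
  "degree_feasible G X H f \<longleftrightarrow> (\<forall>v\<in>verts G. (\<Sum>x\<in>X v. f x) \<ge> deg G v)"

definition strictly_degenerate :: "'b mgraph \<Rightarrow> ('b \<Rightarrow> nat) \<Rightarrow> bool" where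
  "strictly_degenerate H f \<longleftrightarrow>
     (\<forall>H'. subgraph H' H \<and> verts H' \<noteq> {} \<longrightarrow> (\<exists>x\<in>verts H'. deg H' x < f x))"

definition colorable ::
  "'a mgraph \<Rightarrow> ('a \<Rightarrow> 'b set) \<Rightarrow> 'b mgraph \<Rightarrow> ('b \<Rightarrow> nat) \<Rightarrow> bool" where
  "colorable G X H f \<longleftrightarrow> (\<exists>T. transversal G X H T \<and> strictly_degenerate (induced H T) f)"


definition M_configuration ::
  "'a mgraph \<Rightarrow> ('a \<Rightarrow> 'b set) \<Rightarrow> 'b mgraph \<Rightarrow> ('b \<Rightarrow> nat) \<Rightarrow> bool" where
  "M_configuration G X H f \<longleftrightarrow> block G \<and>
     (\<exists>U\<subseteq>verts H. restr_inflates_G_cover G X H U \<and>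
        (\<forall>v\<in>verts G. \<forall>x\<in>X v.
           (x \<in> U \<longrightarrow> real (f x) = real (deg G v) / real (card (X v \<inter> U))) \<and>
           (x \<notin> U \<longrightarrow> f x = 0)))"

definition K_configuration ::
  "'a mgraph \<Rightarrow> ('a \<Rightarrow> 'b set) \<Rightarrow> 'b mgraph \<Rightarrow> ('b \<Rightarrow> nat) \<Rightarrow> bool" where
  "K_configuration G X H f \<longleftrightarrow>
     (\<exists>t n. t \<ge> 1 \<and> n \<ge> 1 \<and>
        (\<exists>\<phi>. graph_iso \<phi> (times_graph t (complete_graph n)) G) \<and>
        (\<exists>(p :: nat) (ns :: nat \<Rightarrow> nat) (U :: nat \<Rightarrow> 'b set).
           p \<ge> 1 \<and> (\<forall>i\<in>{1..p}. ns i \<ge> 1) \<and> (\<Sum>i=1..p. ns i) = n - 1 \<and>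
           (\<forall>i\<in>{1..p}. U i \<subseteq> verts H) \<and> disjoint_family_on U {1..p} \<and>
           (\<forall>i\<in>{1..p}. restr_inflates_G_cover G X H (U i)) \<and>
           (\<forall>v\<in>verts G. \<forall>x\<in>X v.
              (\<forall>i\<in>{1..p}. x \<in> U i \<longrightarrow>
                 real (f x) = real t * real (ns i) / real (card (X v \<inter> U i))) \<and>
              (x \<notin> (\<Union>i\<in>{1..p}. U i) \<longrightarrow> f x = 0))))"

definition odd_C_configuration ::
  "'a mgraph \<Rightarrow> ('a \<Rightarrow> 'b set) \<Rightarrow> 'b mgraph \<Rightarrow> ('b \<Rightarrow> nat) \<Rightarrow> bool" where
  "odd_C_configuration G X H f \<longleftrightarrow>
     (\<exists>t n. t \<ge> 1 \<and> n \<ge> 3 \<and> odd n \<and>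
        (\<exists>\<phi>. graph_iso \<phi> (times_graph t (cycle_graph n)) G) \<and>
        (\<exists>U1 U2. U1 \<subseteq> verts H \<and> U2 \<subseteq> verts H \<and> U1 \<inter> U2 = {} \<and>
           restr_inflates_G_cover G X H U1 \<and> restr_inflates_G_cover G X H U2 \<and>
           (\<forall>v\<in>verts G. \<forall>x\<in>X v.
              (x \<in> U1 \<longrightarrow> real (f x) = real t / real (card (X v \<inter> U1))) \<and>
              (x \<in> U2 \<longrightarrow> real (f x) = real t / real (card (X v \<inter> U2))) \<and>
              (x \<notin> U1 \<union> U2 \<longrightarrow> f x = 0))))"

definition even_C_configuration ::
  "'a mgraph \<Rightarrow> ('a \<Rightarrow> 'b set) \<Rightarrow> 'b mgraph \<Rightarrow> ('b \<Rightarrow> nat) \<Rightarrow> bool" where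
  "even_C_configuration G X H f \<longleftrightarrow>
     (\<exists>t n. t \<ge> 1 \<and> n \<ge> 4 \<and> even n \<and>
        (\<exists>\<phi>. graph_iso \<phi> (times_graph t (cycle_graph n)) G) \<and>
        (\<exists>U\<subseteq>verts H. restr_inflates_double_cover t n G X H U \<and>
           (\<forall>v\<in>verts G. \<forall>x\<in>X v.
              (x \<in> U \<longrightarrow> real (f x) = 2 * real t / real (card (X v \<inter> U))) \<and>
              (x \<notin> U \<longrightarrow> f x = 0))))"

text \<open>
  \<open>G\<close> arises from disjoint copies of \<open>G1\<close> and \<open>G2\<close> by identifying each \<open>x \<in> A \<subseteq> verts G1\<close>
  with \<open>\<pi> x \<in> verts G2\<close>. The maps \<open>\<phi>1\<close> and \<open>\<phi>2\<close> are the restrictions of the quotient map to the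
  two copies, so \<open>G1\<close> and \<open>G2\<close> themselves need not be disjoint as sets; this keeps all graphs in
  one vertex type, even a finite one. Each edge of \<open>G1\<close> and of \<open>G2\<close> yields one edge of \<open>G\<close>.
\<close>

definition obtained_by_identifying ::
  "'a mgraph \<Rightarrow> 'a mgraph \<Rightarrow> 'a set \<Rightarrow> ('a \<Rightarrow> 'a) \<Rightarrow> ('a \<Rightarrow> 'a) \<Rightarrow> ('a \<Rightarrow> 'a) \<Rightarrow> 'a mgraph \<Rightarrow> bool"
  where
  "obtained_by_identifying G1 G2 A \<pi> \<phi>1 \<phi>2 G \<longleftrightarrow>
     A \<subseteq> verts G1 \<and> \<pi> ` A \<subseteq> verts G2 \<and> inj_on \<pi> A \<and>
     inj_on \<phi>1 (verts G1) \<and> inj_on \<phi>2 (verts G2) \<and>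
     (\<forall>x\<in>verts G1. \<forall>y\<in>verts G2. \<phi>1 x = \<phi>2 y \<longleftrightarrow> x \<in> A \<and> y = \<pi> x) \<and>
     verts G = \<phi>1 ` verts G1 \<union> \<phi>2 ` verts G2 \<and>
     (\<forall>x\<in>verts G. \<forall>y\<in>verts G. mult G x y =
        (\<Sum>u | u \<in> verts G1 \<and> \<phi>1 u = x. \<Sum>v | v \<in> verts G1 \<and> \<phi>1 v = y. mult G1 u v) +
        (\<Sum>u | u \<in> verts G2 \<and> \<phi>2 u = x. \<Sum>v | v \<in> verts G2 \<and> \<phi>2 v = y. mult G2 u v))"

definition merged_configuration ::
  "'a mgraph \<Rightarrow> ('a \<Rightarrow> 'b set) \<Rightarrow> 'b mgraph \<Rightarrow> ('b \<Rightarrow> nat) \<Rightarrow>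
   'a mgraph \<Rightarrow> ('a \<Rightarrow> 'b set) \<Rightarrow> 'b mgraph \<Rightarrow> ('b \<Rightarrow> nat) \<Rightarrow>
   'a mgraph \<Rightarrow> ('a \<Rightarrow> 'b set) \<Rightarrow> 'b mgraph \<Rightarrow> ('b \<Rightarrow> nat) \<Rightarrow> bool" where
  "merged_configuration G1 X1 H1 f1 G2 X2 H2 f2 G X H f \<longleftrightarrow>
     (\<exists>v1\<in>verts G1. \<exists>v2\<in>verts G2. \<exists>\<pi> \<phi>1 \<phi>2 \<psi>1 \<psi>2.
        bij_betw \<pi> (X1 v1) (X2 v2) \<and>
        obtained_by_identifying G1 G2 {v1} (\<lambda>_. v2) \<phi>1 \<phi>2 G \<and>
        obtained_by_identifying H1 H2 (X1 v1) \<pi> \<psi>1 \<psi>2 H \<and>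
        (\<forall>v\<in>verts G1. X (\<phi>1 v) = \<psi>1 ` X1 v) \<and>
        (\<forall>v\<in>verts G2. X (\<phi>2 v) = \<psi>2 ` X2 v) \<and>
        (\<forall>y\<in>verts H1 - X1 v1. f (\<psi>1 y) = f1 y) \<and>
        (\<forall>y\<in>verts H2 - X2 v2. f (\<psi>2 y) = f2 y) \<and>
        (\<forall>x\<in>X1 v1. f (\<psi>1 x) = f1 x + f2 (\<pi> x)))"

inductive constructible ::
  "'a mgraph \<Rightarrow> ('a \<Rightarrow> 'b set) \<Rightarrow> 'b mgraph \<Rightarrow> ('b \<Rightarrow> nat) \<Rightarrow> bool" where
  K1: "uniform_configuration G X H f \<Longrightarrow> M_configuration G X H f \<Longrightarrow> constructible G X H f"
| K2: "uniform_configuration G X H f \<Longrightarrow> K_configuration G X H f \<Longrightarrow> constructible G X H f"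
| K3: "uniform_configuration G X H f \<Longrightarrow> odd_C_configuration G X H f \<Longrightarrow> constructible G X H f"
| K4: "uniform_configuration G X H f \<Longrightarrow> even_C_configuration G X H f \<Longrightarrow> constructible G X H f"
| K5: "uniform_configuration G X H f \<Longrightarrow>
       constructible G1 X1 H1 f1 \<Longrightarrow> constructible G2 X2 H2 f2 \<Longrightarrow>
       merged_configuration G1 X1 H1 f1 G2 X2 H2 f2 G X H f \<Longrightarrow>
       constructible G X H f"

end

theory Submission
  imports Defs
begin

text \<open>
  In an uncolorable degree-feasible configuration every good colouring of \<open>G - u\<close> is tight at \<open>u\<close>:
  each \<open>y \<in> X u\<close> sees exactly \<open>f y\<close> coloured edges. Hence giving \<open>u\<close> a colour \<open>y\<close> and
  uncolouring a neighbour \<open>w\<close> whose colour is adjacent to \<open>y\<close> yields a good colouring of \<open>G - w\<close>: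
  the hole moves along the edges of \<open>G\<close>, and tightness at the new hole gives linear equations.

  At a cut vertex, \<open>f\<close> splits into the largest values for which the two parts stay uncolorable, and
  the degree sum forces equality, which is (K5). In a block, moving the hole around a cycle that is
  chordless at \<open>u\<close> shows that the colours in \<open>X u\<close> with \<open>f > 0\<close> fall into twin classes, that the
  classes of adjacent vertices are matched, and that matched classes have equal size; this is the
  inflation structure. Contracting the classes leaves a cover by perfect matchings on which the
  hole moves deterministically. With a single class the configuration is (K1). With at least two,
  \<open>G\<close> has no induced diamond, an induced cycle of length at least four is all of \<open>G\<close>, and triangles
  have trivial holonomy, so \<open>G\<close> is complete (K2) or a cycle, where the holonomy is trivial exactly
  for odd length (K3, K4).

  Conversely, a transversal of a constructible configuration contains a set of vertices each having
  at least \<open>f\<close> neighbours in it; for (K5) one takes the union of two such sets.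
\<close>

section \<open>Connectivity and greedy colourings\<close>

text \<open>Strict degeneracy quantifies over all subgraphs, but apart from the gluing at cut
  vertices colourings are built by adding a last vertex that sees fewer than \<open>f\<close>
  coloured edges. Tightness is the equality case of this: the numbers of coloured edges at the
  colours of \<open>u\<close> sum to at most the degree, which is at most the sum of
  \<open>f\<close>. Structure is then obtained by comparing tightness at one vertex in two states
  that differ in few places. This is why the cycles are chordless at the hole: just two summands can
  change. The obstacle is that a colour may be adjacent to several colours of the next fibre, so
  that a move involves a choice; passing to twin classes removes it. Tightness together with two
  classes per fibre also ensures that some neighbour of the hole shows a class other than a given
  one. A hole that leaves through this neighbour and comes back along a shortest walk excludes
  diamonds and vertices outside an induced cycle. The numbers \<open>n_i\<close> of (K2) are class
  sums of \<open>f\<close> divided by the common multiplicity, and the parity in (K3) and (K4) comes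
  from the pattern of a state along the cycle, which alternates relative to a transported
  class.\<close>

definition conn :: "('a \<Rightarrow> 'a \<Rightarrow> bool) \<Rightarrow> 'a set \<Rightarrow> bool" where
  "conn E D \<longleftrightarrow> D \<noteq> {} \<and> (\<forall>A. A \<subseteq> D \<and> A \<noteq> {} \<and> A \<noteq> D \<longrightarrow> (\<exists>x\<in>A. \<exists>y\<in>D - A. E x y))"

lemma connD:
  assumes "conn E D" "A \<subseteq> D" "A \<noteq> {}" "A \<noteq> D"
  obtains x y where "x \<in> A" "y \<in> D" "y \<notin> A" "E x y"
  using assms unfolding conn_def by blast

text \<open>Phrasing \<open>conn\<close> by cuts makes this an immediate consequence. It lets
  connectivity be used on any vertex set, such as \<open>V - {v}\<close>, without forming an induced
  graph or choosing paths.\<close>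

lemma conn_closed_subset:
  assumes "conn E D" "s \<in> A" "A \<subseteq> D" "\<And>x y. x \<in> A \<Longrightarrow> y \<in> D \<Longrightarrow> E x y \<Longrightarrow> y \<in> A"
  shows "A = D"
  using assms unfolding conn_def by blast

definition walk :: "('a \<Rightarrow> 'a \<Rightarrow> bool) \<Rightarrow> 'a set \<Rightarrow> 'a set \<Rightarrow> 'a set \<Rightarrow> 'a list \<Rightarrow> bool" where
  "walk E D K Z ps \<longleftrightarrow> ps \<noteq> [] \<and> set ps \<subseteq> D \<and> hd ps \<in> K \<and> last ps \<in> Z \<and> successively E ps"

lemma conn_walk_exists:
  assumes c: "conn E D" and K: "K \<inter> D \<noteq> {}" and Z: "Z \<inter> D \<noteq> {}"
  shows "\<exists>ps. walk E D K Z ps"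
proof -
  define A where "A = {t \<in> D. \<exists>ps. walk E D K {t} ps}"
  obtain k where k: "k \<in> K" "k \<in> D" using K by blast
  have "walk E D K {k} [k]" using k by (simp add: walk_def)
  then have kA: "k \<in> A" using k unfolding A_def by blast
  have "A = D"
  proof (rule conn_closed_subset[OF c kA])
    fix x y assume x: "x \<in> A" and y: "y \<in> D" and xy: "E x y"
    then obtain ps where ps: "walk E D K {x} ps" unfolding A_def by blast
    then have "walk E D K {y} (ps @ [y])" using y xy
      by (auto simp: walk_def successively_append_iff)
    then show "y \<in> A" using y unfolding A_def by blast
  qed (auto simp: A_def)
  then obtain t ps where "t \<in> Z" "walk E D K {t} ps" using Z unfolding A_def by blast
  then show ?thesis unfolding walk_def by auto
qed

text \<open>All properties come from one choice, a walk of least length: cutting out the piece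
  spanned by a chord, the part before a later visit to \<open>K\<close>, or the part after an
  earlier visit to \<open>Z\<close> would shorten it. The absence of chords later yields induced
  cycles, and the last two properties yield walks that meet a prescribed set only at their
  ends.\<close>

lemma shortest_walk:
  assumes "conn E D" "K \<inter> D \<noteq> {}" "Z \<inter> D \<noteq> {}"
  obtains ps where "walk E D K Z ps" "distinct ps"
    "\<And>i j. i < j \<Longrightarrow> j < length ps \<Longrightarrow> E (ps ! i) (ps ! j) \<Longrightarrow> j = Suc i"
    "\<And>i. 0 < i \<Longrightarrow> i < length ps \<Longrightarrow> ps ! i \<notin> K"
    "\<And>i. Suc i < length ps \<Longrightarrow> ps ! i \<notin> Z"
proof -
  obtain ps where w: "walk E D K Z ps" and min: "\<And>qs. walk E D K Z qs \<Longrightarrow> length ps \<le> length qs"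
    using conn_walk_exists[OF assms] ex_has_least_nat[of "walk E D K Z" _ length] by blast
  note wd = w[unfolded walk_def]
  have sn: "E (ps ! i) (ps ! Suc i)" if "Suc i < length ps" for i
    using wd that by (auto simp: successively_conv_nth)
  have nK: "ps ! i \<notin> K" if "0 < i" "i < length ps" for i
  proof
    assume "ps ! i \<in> K"
    then have "walk E D K Z (drop i ps)"
      using wd that set_drop_subset[of i ps] by (auto simp: walk_def successively_conv_nth hd_drop_conv_nth)
    from min[OF this] that show False by simp
  qed
  have nZ: "ps ! i \<notin> Z" if "Suc i < length ps" for i
  proof
    assume "ps ! i \<in> Z"
    moreover have "hd (take (Suc i) ps) = hd ps" using wd by (simp add: hd_take)
    moreover have "last (take (Suc i) ps) = ps ! i" using that by (simp add: take_Suc_conv_app_nth)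
    ultimately have "walk E D K Z (take (Suc i) ps)"
      using wd that set_take_subset[of "Suc i" ps] by (auto simp: walk_def successively_conv_nth)
    from min[OF this] that show False by simp
  qed
  have chord: "j = Suc i" if ij: "i < j" "j < length ps" "E (ps ! i) (ps ! j)" for i j
  proof (rule ccontr)
    assume "j \<noteq> Suc i"
    then have lt: "Suc i < j" using ij by simp
    let ?q = "take (Suc i) ps @ drop j ps"
    have "hd ?q = hd ps" using wd by (cases ps) auto
    moreover have "last ?q = last ps" using ij by simp
    moreover have "last (take (Suc i) ps) = ps ! i" using ij by (simp add: take_Suc_conv_app_nth)
    moreover have "hd (drop j ps) = ps ! j" using ij by (simp add: hd_drop_conv_nth)
    moreover have "set ?q \<subseteq> D" using wd set_take_subset[of "Suc i" ps] set_drop_subset[of j ps] by auto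
    moreover have "successively E (take (Suc i) ps)" "successively E (drop j ps)"
      using wd by (auto simp: successively_conv_nth)
    ultimately have "walk E D K Z ?q" using wd ij
      by (auto simp: walk_def successively_append_iff)
    from min[OF this] lt ij show False by simp
  qed
  have "distinct ps"
  proof (rule ccontr)
    assume "\<not> distinct ps"
    then obtain i j where ij: "i < j" "j < length ps" "ps ! i = ps ! j"
      by (metis distinct_conv_nth nat_neq_iff)
    \<comment> \<open>A repetition at \<open>j\<close> makes the successor of \<open>j\<close> a
      chord neighbour of \<open>ps ! i\<close>; if \<open>j\<close> is the last position, then
      \<open>ps ! i\<close> lies in \<open>Z\<close> too early.\<close>
    show False
    proof (cases "Suc j < length ps")
      case True
      then have "E (ps ! i) (ps ! Suc j)" using sn[OF True] ij by simp
      from chord[OF _ True this] ij show False by simp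
    next
      case False
      then have "ps ! j = last ps" using ij by (metis Suc_lessI diff_Suc_1 last_conv_nth length_0_conv not_less_zero)
      then show False using nZ[of i] ij wd by simp
    qed
  qed
  then show ?thesis using that w chord nK nZ by blast
qed

text \<open>Read backwards this is a colouring order: if the vertices other than \<open>u\<close>
  are coloured in the reverse order of their insertion, each of them still has an uncoloured
  neighbour at its turn, and \<open>u\<close> is the one that remains.\<close>

inductive grow :: "('a \<Rightarrow> 'a \<Rightarrow> bool) \<Rightarrow> 'a \<Rightarrow> 'a set \<Rightarrow> bool" for E u where
  grow_base: "grow E u {u}"
| grow_step: "grow E u B \<Longrightarrow> v \<notin> B \<Longrightarrow> w \<in> B \<Longrightarrow> E w v \<Longrightarrow> grow E u (insert v B)"

lemma conn_grow:
  assumes c: "conn E D" and "finite D" "u \<in> D"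
  shows "grow E u D"
proof -
  define P where "P B \<longleftrightarrow> grow E u B \<and> B \<subseteq> D" for B
  have "P {u}" using assms by (auto simp: P_def intro: grow.intros)
  have fin: "finite {B. P B}"
    by (rule finite_subset[of _ "Pow D"]) (use assms(2) in \<open>auto simp: P_def\<close>)
  obtain B where B: "P B" and max: "\<And>B'. P B' \<Longrightarrow> B \<subseteq> B' \<Longrightarrow> B = B'"
    using finite_has_maximal[OF fin] \<open>P {u}\<close> by auto
  have "B \<noteq> {}" using B unfolding P_def by (auto elim: grow.cases)
  have "B = D"
  proof (rule ccontr)
    assume "B \<noteq> D"
    then obtain x y where "x \<in> B" "y \<in> D" "y \<notin> B" "E x y"
      using connD[OF c, of B] B \<open>B \<noteq> {}\<close> unfolding P_def by blast
    then have "P (insert y B)" using B unfolding P_def by (auto intro: grow.intros)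
    then show False using max \<open>y \<notin> B\<close> by blast
  qed
  then show ?thesis using B P_def by simp
qed

lemma grow_root: "grow E u B \<Longrightarrow> u \<in> B"
  by (induction rule: grow.induct) auto

section \<open>Cuts versus paths, and blocks\<close>

lemma connected_graph_conn:
  assumes "connected_graph G"
  shows "conn (\<lambda>u v. 0 < mult G u v) (verts G)"
  unfolding conn_def
proof (intro conjI allI impI)
  show "verts G \<noteq> {}" using assms by (simp add: connected_graph_def)
  fix A assume A: "A \<subseteq> verts G \<and> A \<noteq> {} \<and> A \<noteq> verts G"
  then obtain s t where st: "s \<in> A" "t \<in> verts G" "t \<notin> A" by blast
  then have "(s, t) \<in> (adj_rel G)\<^sup>*" using assms A unfolding connected_graph_def by blast
  then have "t \<in> A \<or> (\<exists>x\<in>A. \<exists>y\<in>verts G - A. 0 < mult G x y)"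
  proof (induction rule: rtrancl_induct)
    case (step y z)
    then show ?case unfolding adj_rel_def by blast
  qed (use st in auto)
  then show "\<exists>x\<in>A. \<exists>y\<in>verts G - A. 0 < mult G x y" using st by blast
qed

lemma conn_connected_graph:
  assumes "conn (\<lambda>u v. 0 < mult G u v) (verts G)"
  shows "connected_graph G"
  unfolding connected_graph_def
proof (intro conjI ballI)
  show "verts G \<noteq> {}" using assms by (simp add: conn_def)
  fix u v assume u: "u \<in> verts G" and v: "v \<in> verts G"
  have "{w \<in> verts G. (u, w) \<in> (adj_rel G)\<^sup>*} = verts G"
    by (rule conn_closed_subset[OF assms, of u])
      (use u in \<open>auto simp: adj_rel_def intro: rtrancl_into_rtrancl\<close>)
  then show "(u, v) \<in> (adj_rel G)\<^sup>*" using v by blast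
qed

lemma conn_induced:
  "conn (\<lambda>u v. 0 < mult G u v) W \<Longrightarrow> W \<subseteq> verts G \<Longrightarrow> connected_graph (induced G W)"
proof (rule conn_connected_graph)
  assume c: "conn (\<lambda>u v. 0 < mult G u v) W" and W: "W \<subseteq> verts G"
  have "verts (induced G W) = W" using W by (auto simp: induced_def)
  moreover have "conn (\<lambda>u v. 0 < mult (induced G W) u v) W"
    unfolding conn_def
  proof (intro conjI allI impI)
    show "W \<noteq> {}" using c by (simp add: conn_def)
    fix A assume A: "A \<subseteq> W \<and> A \<noteq> {} \<and> A \<noteq> W"
    then obtain x y where "x \<in> A" "y \<in> W" "y \<notin> A" "0 < mult G x y"
      using connD[OF c, of A] by blast
    then show "\<exists>x\<in>A. \<exists>y\<in>W - A. 0 < mult (induced G W) x y"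
      using A by (intro bexI[of _ x] bexI[of _ y]) (auto simp: induced_def)
  qed
  ultimately show "conn (\<lambda>u v. 0 < mult (induced G W) u v) (verts (induced G W))" by simp
qed

lemma blockI_conn:
  assumes "connected_graph G"
    and "\<And>v. v \<in> verts G \<Longrightarrow> verts G - {v} \<noteq> {} \<Longrightarrow> conn (\<lambda>u v. 0 < mult G u v) (verts G - {v})"
  shows "block G"
  unfolding block_def
proof (intro conjI notI)
  show "connected_graph G" by fact
  assume "\<exists>v\<in>verts G. card (components (induced G (verts G - {v}))) \<ge> 2"
  then obtain v where v: "v \<in> verts G" and c: "card (components (induced G (verts G - {v}))) \<ge> 2" by blast
  let ?G = "induced G (verts G - {v})"
  have vs: "verts ?G = verts G - {v}" by (auto simp: induced_def)
  have "components ?G \<subseteq> {verts ?G}"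
  \<comment> \<open>The empty graph has no components at all; it is treated apart because
    \<open>conn\<close> excludes the empty set.\<close>
  proof (cases "verts G - {v} = {}")
    case True
    then have "verts ?G = {}" using vs by simp
    then show ?thesis by (simp add: components_def quotient_def)
  next
    case False
    then have "connected_graph ?G" using assms(2) v by (intro conn_induced) auto
    then show ?thesis unfolding components_def quotient_def connected_graph_def by auto
  qed
  then have "card (components ?G) \<le> 1" using card_mono[of "{verts ?G}" "components ?G"] by simp
  then show False using c by simp
qed

text \<open>A transversal is encoded as a function \<open>c\<close> on the vertices of the base graph, and strict
  degeneracy is tested on sets \<open>W\<close> of base vertices only.\<close>

definition good :: "('a \<Rightarrow> 'b set) \<Rightarrow> ('b \<Rightarrow> 'b \<Rightarrow> nat) \<Rightarrow> ('b \<Rightarrow> nat) \<Rightarrow> 'a set \<Rightarrow> ('a \<Rightarrow> 'b) \<Rightarrow> bool" where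
  "good X a f D c \<longleftrightarrow> (\<forall>v\<in>D. c v \<in> X v) \<and>
     (\<forall>W\<subseteq>D. W \<noteq> {} \<longrightarrow> (\<exists>v\<in>W. (\<Sum>w\<in>W. a (c v) (c w)) < f (c v)))"

lemma good_empty: "good X a f {} c"
  by (simp add: good_def)

lemma good_mono: "good X a f D c \<Longrightarrow> D' \<subseteq> D \<Longrightarrow> good X a f D' c"
  unfolding good_def by (meson order_trans subsetD)

lemma good_cong:
  assumes "\<And>v. v \<in> D \<Longrightarrow> c v = c' v" "\<And>v. v \<in> D \<Longrightarrow> f (c v) = g (c v)"
  shows "good X a f D c \<longleftrightarrow> good X a g D c'"
proof -
  have "(\<Sum>w\<in>W. a (c v) (c w)) = (\<Sum>w\<in>W. a (c' v) (c' w))" if "W \<subseteq> D" "v \<in> W" for v W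
    using that assms(1) by (intro sum.cong) (metis subsetD)+
  moreover have "f (c v) = g (c' v)" if "v \<in> D" for v using that assms by metis
  ultimately have "(\<exists>v\<in>W. (\<Sum>w\<in>W. a (c v) (c w)) < f (c v)) \<longleftrightarrow> (\<exists>v\<in>W. (\<Sum>w\<in>W. a (c' v) (c' w)) < g (c' v))"
    if "W \<subseteq> D" for W
    using that by (intro bex_cong) auto
  moreover have "(\<forall>v\<in>D. c v \<in> X v) \<longleftrightarrow> (\<forall>v\<in>D. c' v \<in> X v)" using assms(1) by auto
  ultimately show ?thesis unfolding good_def by auto
qed

text \<open>The vertex \<open>u\<close> is the witness for every \<open>W\<close> that contains it,
  since its degree inside \<open>W\<close> is at most the number of coloured edges at
  \<open>y\<close>. Every other \<open>W\<close> lies in \<open>D\<close> and has its witness from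
  \<open>g\<close>.\<close>

lemma good_extend:
  assumes g: "good X a f D c" and "finite D" "u \<notin> D" "y \<in> X u" "a y y = 0"
    and lt: "(\<Sum>w\<in>D. a y (c w)) < f y"
  shows "good X a f (insert u D) (c(u := y))"
  unfolding good_def
proof (intro conjI allI impI ballI)
  fix v assume "v \<in> insert u D"
  then show "(c(u := y)) v \<in> X v" using assms by (auto simp: good_def)
next
  fix W assume W: "W \<subseteq> insert u D" "W \<noteq> {}"
  show "\<exists>v\<in>W. (\<Sum>w\<in>W. a ((c(u := y)) v) ((c(u := y)) w)) < f ((c(u := y)) v)"
  proof (cases "u \<in> W")
    case True
    have "(\<Sum>w\<in>W. a y ((c(u := y)) w)) = (\<Sum>w\<in>W - {u}. a y ((c(u := y)) w))"
      using True W assms(2,5) by (subst sum.remove[of W u]) (auto intro: finite_subset)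
    also have "\<dots> = (\<Sum>w\<in>W - {u}. a y (c w))" by (intro sum.cong) auto
    also have "\<dots> \<le> (\<Sum>w\<in>D. a y (c w))" using W assms(2) by (intro sum_mono2) auto
    finally show ?thesis using True lt by (intro bexI[of _ u]) auto
  next
    case False
    then have WD: "W \<subseteq> D" using W by auto
    then obtain v where v: "v \<in> W" "(\<Sum>w\<in>W. a (c v) (c w)) < f (c v)" using g W unfolding good_def by meson
    have "v \<noteq> u" using v False by auto
    have "(\<Sum>w\<in>W. a ((c(u := y)) v) ((c(u := y)) w)) = (\<Sum>w\<in>W. a (c v) (c w))"
      using v False by (intro sum.cong) auto
    then show ?thesis using v \<open>v \<noteq> u\<close> by (intro bexI[of _ v]) auto
  qed
qed

text \<open>Of the cover only the following is used for colourings: the matchings bound the number of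
  edges from a vertex to another fibre.\<close>

locale fibred =
  fixes V :: "'a set" and \<mu> :: "'a \<Rightarrow> 'a \<Rightarrow> nat" and X :: "'a \<Rightarrow> 'b set" and a :: "'b \<Rightarrow> 'b \<Rightarrow> nat"
  assumes finV: "finite V" and \<mu>_sym: "\<mu> u v = \<mu> v u" and \<mu>_irrefl: "\<mu> v v = 0"
    and finX: "v \<in> V \<Longrightarrow> finite (X v)"
    and disjX: "disjoint_family_on X V"
    and a_sym: "a x y = a y x" and a_irrefl: "a x x = 0"
    and row_le: "u \<in> V \<Longrightarrow> v \<in> V \<Longrightarrow> u \<noteq> v \<Longrightarrow> x \<in> X u \<Longrightarrow> (\<Sum>y\<in>X v. a x y) \<le> \<mu> u v"
begin

abbreviation adj :: "'a \<Rightarrow> 'a \<Rightarrow> bool" where "adj u v \<equiv> 0 < \<mu> u v"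

lemma fibred_subset: "W \<subseteq> V \<Longrightarrow> fibred W \<mu> X a"
proof unfold_locales
  assume W: "W \<subseteq> V"
  show "finite W" using W finV finite_subset by blast
  show "disjoint_family_on X W" using W disjX disjoint_family_on_mono by blast
  show "finite (X v)" if "v \<in> W" for v using that W finX by blast
  show "(\<Sum>y\<in>X v. a x y) \<le> \<mu> u v" if "u \<in> W" "v \<in> W" "u \<noteq> v" "x \<in> X u" for u v x
    using that W by (intro row_le) auto
qed (use \<mu>_sym \<mu>_irrefl a_sym a_irrefl in auto)

text \<open>Exchanging the sums turns this into \<open>row_le\<close> for each coloured vertex
  \<open>w\<close>: its colour sends at most \<open>\<mu> u w\<close> edges into
  \<open>X u\<close>.\<close>

lemma color_sum_le:
  assumes "u \<in> V" "D \<subseteq> V" "u \<notin> D" "\<forall>v\<in>D. c v \<in> X v"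
  shows "(\<Sum>y\<in>X u. \<Sum>w\<in>D. a y (c w)) \<le> (\<Sum>w\<in>D. \<mu> u w)"
proof -
  have "(\<Sum>y\<in>X u. \<Sum>w\<in>D. a y (c w)) = (\<Sum>w\<in>D. \<Sum>y\<in>X u. a (c w) y)"
    by (subst sum.swap) (simp add: a_sym)
  also have "\<dots> \<le> (\<Sum>w\<in>D. \<mu> w u)"
    using assms by (intro sum_mono row_le) auto
  finally show ?thesis by (simp add: \<mu>_sym)
qed

lemma greedy_step:
  assumes g: "good X a f D c" and D: "D \<subseteq> V" "u \<in> V" "u \<notin> D"
    and lt: "(\<Sum>w\<in>D. \<mu> u w) < (\<Sum>y\<in>X u. f y)"
  shows "\<exists>y\<in>X u. good X a f (insert u D) (c(u := y))"
proof -
  have "\<exists>y\<in>X u. (\<Sum>w\<in>D. a y (c w)) < f y"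
  proof (rule ccontr)
    assume "\<not> ?thesis"
    then have "(\<Sum>y\<in>X u. f y) \<le> (\<Sum>y\<in>X u. \<Sum>w\<in>D. a y (c w))" by (intro sum_mono) force
    also have "\<dots> \<le> (\<Sum>w\<in>D. \<mu> u w)" using color_sum_le D g by (simp add: good_def)
    finally show False using lt by simp
  qed
  then obtain y where "y \<in> X u" "(\<Sum>w\<in>D. a y (c w)) < f y" by blast
  then show ?thesis using good_extend[OF g finite_subset[OF D(1) finV] D(3) _ a_irrefl] by blast
qed

text \<open>When \<open>v\<close> is coloured, its neighbour \<open>w\<close> in \<open>B\<close> is
  still free, so fewer edges than the degree of \<open>v\<close> lead to coloured vertices and
  \<open>greedy_step\<close> applies. The root \<open>u\<close> stays uncoloured, so feasibility is
  asked of the other vertices only; \<open>part_weight\<close> relies on this for the cut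
  vertex.\<close>

lemma greedy_all:
  assumes "grow adj u B" "B \<subseteq> V" "good X a f (V - B) c"
    and feas: "\<And>v. v \<in> V \<Longrightarrow> v \<noteq> u \<Longrightarrow> (\<Sum>w\<in>V. \<mu> v w) \<le> (\<Sum>y\<in>X v. f y)"
  shows "\<exists>c'. good X a f (V - {u}) c' \<and> (\<forall>v\<in>V - B. c' v = c v)"
  using assms(1-3)
proof (induction arbitrary: c rule: grow.induct)
  case (grow_step B v w)
  have vV: "v \<in> V" and wV: "w \<in> V" and vu: "v \<noteq> u" using grow_step
    grow_root[OF grow_step.hyps(1)] by auto
  have "(\<Sum>w\<in>V - insert v B. \<mu> v w) < (\<Sum>w\<in>V. \<mu> v w)"
    using finV grow_step.hyps wV \<mu>_sym[of v w] by (intro sum_strict_mono2[of _ _ w]) auto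
  then have "(\<Sum>w\<in>V - insert v B. \<mu> v w) < (\<Sum>y\<in>X v. f y)" using feas[OF vV vu] by simp
  from greedy_step[OF grow_step.prems(2) _ vV _ this]
  obtain y where y: "good X a f (insert v (V - insert v B)) (c(v := y))" by auto
  have eq: "insert v (V - insert v B) = V - B" using vV grow_step.hyps by auto
  from grow_step.IH[OF _ y[unfolded eq]] grow_step.prems(1)
  obtain c' where c': "good X a f (V - {u}) c'" "\<forall>x\<in>V - B. c' x = (c(v := y)) x" by blast
  then show ?case by (intro exI[of _ c']) auto
qed auto

lemma greedy_extend:
  assumes "D \<subseteq> V" "conn adj (V - D)" "u \<in> V - D" "good X a f D c"
    and feas: "\<And>v. v \<in> V \<Longrightarrow> v \<noteq> u \<Longrightarrow> (\<Sum>w\<in>V. \<mu> v w) \<le> (\<Sum>y\<in>X v. f y)"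
  shows "\<exists>c'. good X a f (V - {u}) c' \<and> (\<forall>v\<in>D. c' v = c v)"
proof -
  have eq: "V - (V - D) = D" using assms(1) by auto
  have gr: "grow adj u (V - D)" using conn_grow[OF assms(2)] finV assms(3) by simp
  show ?thesis using greedy_all[OF gr _ _ feas, of c] assms(4) unfolding eq by auto
qed

end

section \<open>Holes in uncolorable feasible configurations\<close>

locale uncolorable = fibred +
  fixes f :: "'b \<Rightarrow> nat"
  assumes conn: "conn adj V"
    and feas: "v \<in> V \<Longrightarrow> (\<Sum>w\<in>V. \<mu> v w) \<le> (\<Sum>y\<in>X v. f y)"
    and uncol: "\<not> good X a f V c"
begin

lemma hole_exists: "u \<in> V \<Longrightarrow> \<exists>c. good X a f (V - {u}) c"
proof -
  assume u: "u \<in> V"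
  have "\<exists>c'. good X a f (V - {u}) c' \<and> (\<forall>v\<in>{}. c' v = undefined v)"
    by (rule greedy_extend) (use u conn feas good_empty in auto)
  then show ?thesis by blast
qed

text \<open>Since no colour extends \<open>c\<close> to \<open>u\<close>, each \<open>f y\<close> is
  at most the number of coloured edges at \<open>y\<close>. Summed over \<open>X u\<close>, these
  numbers are at most the degree of \<open>u\<close>, which by feasibility is at most the sum of
  \<open>f\<close>. The chain closes up, so all its inequalities are equalities: for every colour,
  for the total, and for the row of every coloured vertex.\<close>

lemma hole_tight:
  assumes u: "u \<in> V" and g: "good X a f (V - {u}) c"
  shows "y \<in> X u \<Longrightarrow> f y = (\<Sum>w\<in>V - {u}. a (c w) y)"
    and "(\<Sum>y\<in>X u. f y) = (\<Sum>w\<in>V. \<mu> u w)"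
    and "w \<in> V - {u} \<Longrightarrow> (\<Sum>y\<in>X u. a (c w) y) = \<mu> u w"
proof -
  have ins: "insert u (V - {u}) = V" using u by auto
  have ge: "f y \<le> (\<Sum>w\<in>V - {u}. a y (c w))" if "y \<in> X u" for y
  proof (rule ccontr)
    assume "\<not> ?thesis"
    then have "good X a f (insert u (V - {u})) (c(u := y))"
      using finV by (intro good_extend[OF g _ _ that a_irrefl]) auto
    then show False using uncol ins by simp
  qed
  have s1: "(\<Sum>y\<in>X u. f y) \<le> (\<Sum>y\<in>X u. \<Sum>w\<in>V - {u}. a y (c w))" using ge by (intro sum_mono)
  have s2: "(\<Sum>y\<in>X u. \<Sum>w\<in>V - {u}. a y (c w)) \<le> (\<Sum>w\<in>V - {u}. \<mu> u w)"
    using color_sum_le[OF u, of "V - {u}" c] g by (simp add: good_def)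
  have s3: "(\<Sum>w\<in>V - {u}. \<mu> u w) = (\<Sum>w\<in>V. \<mu> u w)"
    using u finV by (simp add: sum.remove[of V u] \<mu>_irrefl)
  show eq: "(\<Sum>y\<in>X u. f y) = (\<Sum>w\<in>V. \<mu> u w)" using s1 s2 s3 feas[OF u] by simp
  show "f y = (\<Sum>w\<in>V - {u}. a (c w) y)" if "y \<in> X u"
  proof (rule ccontr)
    assume "\<not> ?thesis"
    then have "f y < (\<Sum>w\<in>V - {u}. a y (c w))" using ge[OF that] by (simp add: a_sym)
    then have "(\<Sum>y\<in>X u. f y) < (\<Sum>y\<in>X u. \<Sum>w\<in>V - {u}. a y (c w))"
      using that ge finX[OF u] by (intro sum_strict_mono_ex1) auto
    then show False using s2 s3 eq by simp
  qed
  show "(\<Sum>y\<in>X u. a (c w) y) = \<mu> u w" if w: "w \<in> V - {u}"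
  proof (rule ccontr)
    assume ne: "\<not> ?thesis"
    have le: "(\<Sum>y\<in>X u. a (c w) y) \<le> \<mu> u w" if "w \<in> V - {u}" for w
      using row_le[of w u "c w"] that u g by (auto simp: good_def \<mu>_sym)
    have "(\<Sum>w\<in>V - {u}. \<Sum>y\<in>X u. a (c w) y) < (\<Sum>w\<in>V - {u}. \<mu> u w)"
      using ne le finV w by (intro sum_strict_mono_ex1) force+
    moreover have "(\<Sum>w\<in>V - {u}. \<Sum>y\<in>X u. a (c w) y) = (\<Sum>y\<in>X u. \<Sum>w\<in>V - {u}. a y (c w))"
      by (subst sum.swap) (simp add: a_sym)
    ultimately show False using s1 s3 eq by simp
  qed
qed

text \<open>By tightness \<open>y\<close> sees exactly \<open>f y\<close> coloured edges.
  Uncolouring \<open>w\<close> removes at least one of them, so \<open>good_extend\<close> may give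
  \<open>y\<close> to \<open>u\<close>.\<close>

lemma hole_shift:
  assumes u: "u \<in> V" and g: "good X a f (V - {u}) c" and w: "w \<in> V - {u}" and y: "y \<in> X u"
    and pos: "0 < a (c w) y"
  shows "good X a f (V - {w}) (c(u := y))"
proof -
  have eq: "insert u (V - {u} - {w}) = V - {w}" using u w by auto
  have "f y = a (c w) y + (\<Sum>v\<in>V - {u} - {w}. a (c v) y)"
    using hole_tight(1)[OF u g y] w finV by (simp add: sum.remove[of "V - {u}" w])
  then have "(\<Sum>v\<in>V - {u} - {w}. a y (c v)) < f y" using pos by (simp add: a_sym)
  from good_extend[OF good_mono[OF g] _ _ y a_irrefl this] show ?thesis
    unfolding eq using finV by auto
qed

lemma hole_sum: "u \<in> V \<Longrightarrow> (\<Sum>y\<in>X u. f y) = (\<Sum>w\<in>V. \<mu> u w)"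
proof -
  assume u: "u \<in> V"
  then obtain c where "good X a f (V - {u}) c" using hole_exists by blast
  from hole_tight(2)[OF u this] show ?thesis .
qed

end

section \<open>Moving a hole\<close>

text \<open>A state \<open>St u c\<close> is a colouring of all vertices but the hole \<open>u\<close>; \<open>\<tau> u v\<close> is the bijection
  between the colours at \<open>u\<close> and at \<open>v\<close> given by the cover.\<close>

locale hole_system =
  fixes V :: "'a set" and \<mu> :: "'a \<Rightarrow> 'a \<Rightarrow> nat" and S :: "'a \<Rightarrow> 'c set"
    and \<tau> :: "'a \<Rightarrow> 'a \<Rightarrow> 'c \<Rightarrow> 'c" and F :: "'a \<Rightarrow> 'c \<Rightarrow> nat" and St :: "'a \<Rightarrow> ('a \<Rightarrow> 'c) \<Rightarrow> bool"
  assumes finV: "finite V" and \<mu>_sym: "\<mu> u v = \<mu> v u" and \<mu>_irrefl: "\<mu> v v = 0"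
    and \<mu>_V: "0 < \<mu> u v \<Longrightarrow> u \<in> V"
    and conn: "conn (\<lambda>u v. 0 < \<mu> u v) V"
    and conn_minus: "v \<in> V \<Longrightarrow> conn (\<lambda>u v. 0 < \<mu> u v) (V - {v})"
    and finS: "u \<in> V \<Longrightarrow> finite (S u)"
    and \<tau>_in: "0 < \<mu> u v \<Longrightarrow> x \<in> S u \<Longrightarrow> \<tau> u v x \<in> S v"
    and \<tau>_inv: "0 < \<mu> u v \<Longrightarrow> x \<in> S u \<Longrightarrow> \<tau> v u (\<tau> u v x) = x"
    and St_hole: "St u c \<Longrightarrow> u \<in> V"
    and St_in: "St u c \<Longrightarrow> w \<in> V \<Longrightarrow> w \<noteq> u \<Longrightarrow> c w \<in> S w"
    and St_sum: "St u c \<Longrightarrow> y \<in> S u \<Longrightarrow>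
      F u y = (\<Sum>w\<in>V. if 0 < \<mu> u w \<and> \<tau> w u (c w) = y then \<mu> u w else 0)"
    and F_pos: "u \<in> V \<Longrightarrow> y \<in> S u \<Longrightarrow> 0 < F u y"
    and St_shift: "St u c \<Longrightarrow> 0 < \<mu> u w \<Longrightarrow> St w (c(u := \<tau> w u (c w)))"
    and St_ex: "u \<in> V \<Longrightarrow> w \<in> V \<Longrightarrow> u \<noteq> w \<Longrightarrow> x \<in> S w \<Longrightarrow> \<exists>c. St u c \<and> c w = x"
    and two: "u \<in> V \<Longrightarrow> \<exists>x\<in>S u. \<exists>y\<in>S u. x \<noteq> y"
begin

abbreviation adj :: "'a \<Rightarrow> 'a \<Rightarrow> bool" where "adj u v \<equiv> 0 < \<mu> u v"

lemma adj_sym: "adj u v \<Longrightarrow> adj v u"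
  by (simp add: \<mu>_sym)

lemma adj_neq: "adj u v \<Longrightarrow> u \<noteq> v"
  using \<mu>_irrefl by auto

lemma adj_V: "adj u v \<Longrightarrow> u \<in> V" "adj u v \<Longrightarrow> v \<in> V"
  using \<mu>_V adj_sym by blast+

lemma St_nbr: "St u c \<Longrightarrow> adj u w \<Longrightarrow> c w \<in> S w"
  using St_in adj_V adj_neq by blast

lemma St_seen: "St u c \<Longrightarrow> adj u w \<Longrightarrow> \<tau> w u (c w) \<in> S u"
  using St_nbr \<tau>_in adj_sym by blast

lemma \<tau>_eq_iff: "adj u v \<Longrightarrow> x \<in> S u \<Longrightarrow> y \<in> S u \<Longrightarrow> \<tau> u v x = \<tau> u v y \<longleftrightarrow> x = y"
  using \<tau>_inv by metis

lemma all_seen: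
  assumes "St u c" "y \<in> S u"
  obtains w where "adj u w" "\<tau> w u (c w) = y"
proof -
  have "(\<Sum>w\<in>V. if adj u w \<and> \<tau> w u (c w) = y then \<mu> u w else 0) \<noteq> 0"
    using F_pos[of u y] St_sum[OF assms] St_hole assms by simp
  then obtain w where "(if adj u w \<and> \<tau> w u (c w) = y then \<mu> u w else 0) \<noteq> 0"
    by (rule sum.not_neutral_contains_not_neutral)
  then show ?thesis using that by (auto split: if_splits)
qed

text \<open>By \<open>two\<close> there is a second colour at \<open>u\<close>, and every colour is
  shown by some neighbour. This supplies the neighbour through which the hole escapes in the later
  contradictions.\<close>

lemma mixed:
  assumes "St u c"
  obtains w where "adj u w" "\<tau> w u (c w) \<noteq> y"
proof -
  obtain y' where "y' \<in> S u" "y' \<noteq> y" using two St_hole[OF assms] by metis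
  then show ?thesis using that all_seen[OF assms] by metis
qed

text \<open>Each move fills the vertex being left with the transported colour of the next one.
  Distinctness of the walk guarantees that this next colour is still the one given by
  \<open>c\<close>.\<close>

lemma hole_walk:
  assumes "St u c" "distinct (u # ps)" "successively adj (u # ps)"
  shows "\<exists>c'. St (last (u # ps)) c' \<and> (\<forall>w. w \<notin> set (u # ps) \<longrightarrow> c' w = c w) \<and>
    (\<forall>i<length ps. c' ((u # ps) ! i) = \<tau> (ps ! i) ((u # ps) ! i) (c (ps ! i)))"
  using assms
proof (induction ps arbitrary: u c)
  case (Cons p ps)
  let ?c = "c(u := \<tau> p u (c p))"
  have "St p ?c" using St_shift Cons.prems by auto
  from Cons.IH[OF this] Cons.prems obtain c' where c': "St (last (p # ps)) c'"
    "\<And>w. w \<notin> set (p # ps) \<Longrightarrow> c' w = ?c w"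
    "\<And>i. i < length ps \<Longrightarrow> c' ((p # ps) ! i) = \<tau> (ps ! i) ((p # ps) ! i) (?c (ps ! i))"
    by auto
  show ?case
  proof (intro exI[of _ c'] conjI allI impI)
    show "St (last (u # p # ps)) c'" using c'(1) by simp
    show "c' w = c w" if "w \<notin> set (u # p # ps)" for w using that c'(2)[of w] by auto
    show "c' ((u # p # ps) ! i) = \<tau> ((p # ps) ! i) ((u # p # ps) ! i) (c ((p # ps) ! i))"
      if "i < length (p # ps)" for i
    proof (cases i)
      case 0
      then show ?thesis using c'(2)[of u] Cons.prems(2) by auto
    next
      case (Suc j)
      then have j: "j < length ps" using that by simp
      then have "ps ! j \<noteq> u" using Cons.prems(2) by (metis distinct.simps(2) list.set_intros(2) nth_mem)
      then show ?thesis using c'(3)[OF j] Suc by simp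
    qed
  qed
qed auto

text \<open>The hole moves once around a cycle that is chordless at \<open>u\<close>. From \<open>u\<close>, only the colours at
  the two ends of \<open>ps\<close> are seen to change, so they stay put or are swapped.\<close>

lemma rotate:
  assumes st: "St u c" and dist: "distinct (u # ps)" and succ: "successively adj ps"
    and len: "2 \<le> length ps" and hd: "adj u (hd ps)" and la: "adj u (last ps)"
    and chord: "\<And>w. w \<in> set ps \<Longrightarrow> adj u w \<Longrightarrow> w = hd ps \<or> w = last ps"
  defines "A \<equiv> \<tau> (hd ps) u (c (hd ps))" and "B \<equiv> \<tau> (last ps) u (c (last ps))"
  shows "\<tau> (hd ps) u (\<tau> (ps ! 1) (hd ps) (c (ps ! 1))) = B"
    and "A \<noteq> B \<Longrightarrow> \<mu> u (hd ps) = \<mu> u (last ps)"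
    and "\<exists>c'. St u c' \<and> (\<forall>w. w \<notin> set (u # ps) \<longrightarrow> c' w = c w) \<and>
      \<tau> (hd ps) u (c' (hd ps)) = B \<and> \<tau> (last ps) u (c' (last ps)) = A"
proof -
  define p q where "p = hd ps" and "q = last ps"
  have ps: "ps \<noteq> []" using len by auto
  have p0: "p = ps ! 0" using ps by (simp add: p_def hd_conv_nth)
  have pq: "p \<noteq> q"
  proof -
    have "q = ps ! (length ps - 1)" using ps by (simp add: q_def last_conv_nth)
    then show ?thesis using dist len p0 ps nth_eq_iff_index_eq[of ps 0 "length ps - 1"]
      by (metis One_nat_def diff_is_0_eq distinct.simps(2) length_greater_0_conv less_irrefl_nat not_less_eq_eq numeral_2_eq_2 diff_Suc_less)
  qed
  have sc: "successively adj (u # ps)" using succ hd ps by (cases ps) auto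
  from hole_walk[OF st dist sc] obtain c1 where c1: "St (last (u # ps)) c1"
    "\<And>w. w \<notin> set (u # ps) \<Longrightarrow> c1 w = c w"
    "\<And>i. i < length ps \<Longrightarrow> c1 ((u # ps) ! i) = \<tau> (ps ! i) ((u # ps) ! i) (c (ps ! i))" by blast
  have c1u: "c1 u = A" using c1(3)[of 0] ps p0 unfolding A_def p_def by simp
  have c1p: "c1 p = \<tau> (ps ! 1) p (c (ps ! 1))" using c1(3)[of 1] len p0 by simp
  define c2 where "c2 = c1(q := \<tau> u q A)"
  have lq: "last (u # ps) = q" using ps by (simp add: q_def)
  have st2: "St u c2" using St_shift[OF c1(1), of u] adj_sym[OF la] c1u lq unfolding c2_def q_def by simp
  have AS: "A \<in> S u" and BS: "B \<in> S u" unfolding A_def B_def using St_seen[OF st] hd la by auto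
  have B': "\<tau> q u (c2 q) = A" using \<tau>_inv[OF la AS] unfolding c2_def q_def by simp
  have c2p: "c2 p = c1 p" using pq by (simp add: c2_def)
  \<comment> \<open>\<open>A'\<close> is what \<open>hd ps\<close> shows after the round. What
    \<open>last ps\<close> shows is \<open>A\<close>: the first move wrote \<open>A\<close> on
    \<open>u\<close>, and the closing move carried it from \<open>u\<close> to
    \<open>last ps\<close>.\<close>
  define A' where "A' = \<tau> p u (c1 p)"
  have A'S: "A' \<in> S u" using St_seen[OF st2, of p] hd c2p unfolding A'_def p_def by simp
  define g where "g c y w = (if adj u w \<and> \<tau> w u (c w) = y then \<mu> u w else 0)" for c y w
  have gsum: "F u y = g d y p + (g d y q + (\<Sum>w\<in>V - {p} - {q}. g d y w))" if "St u d" "y \<in> S u" for d y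
  proof -
    have "F u y = (\<Sum>w\<in>V. g d y w)" unfolding g_def using St_sum[OF that] .
    also have "\<dots> = g d y p + (\<Sum>w\<in>V - {p}. g d y w)"
      using finV hd adj_V by (intro sum.remove) (auto simp: p_def)
    also have "(\<Sum>w\<in>V - {p}. g d y w) = g d y q + (\<Sum>w\<in>V - {p} - {q}. g d y w)"
      using finV la adj_V pq by (intro sum.remove) (auto simp: q_def)
    finally show ?thesis .
  qed
  have rest: "(\<Sum>w\<in>V - {p} - {q}. g c y w) = (\<Sum>w\<in>V - {p} - {q}. g c2 y w)" for y
  proof (intro sum.cong refl)
    fix w assume w: "w \<in> V - {p} - {q}"
    show "g c y w = g c2 y w"
    proof (cases "adj u w")
      case True
      then have "w \<notin> set (u # ps)" using chord[of w] w adj_neq unfolding p_def q_def by auto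
      then have "c2 w = c w" using c1(2) w unfolding c2_def by simp
      then show ?thesis by (simp add: g_def)
    qed (simp add: g_def)
  qed
  have key: "g c y p + g c y q = g c2 y p + g c2 y q" if "y \<in> S u" for y
    using gsum[OF st that] gsum[OF st2 that] rest[of y] by simp
  have gv: "g c y p = (if A = y then \<mu> u p else 0)" "g c y q = (if B = y then \<mu> u q else 0)"
    "g c2 y p = (if A' = y then \<mu> u p else 0)" "g c2 y q = (if A = y then \<mu> u q else 0)" for y
    using hd la B' c2p unfolding g_def A_def B_def A'_def p_def q_def by auto
  have pos: "0 < \<mu> u p" "0 < \<mu> u q" using hd la unfolding p_def q_def by auto
  \<comment> \<open>The weights \<open>\<mu> u p\<close> at \<open>A\<close> and
    \<open>\<mu> u q\<close> at \<open>B\<close> give the same total at every colour as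
    \<open>\<mu> u p\<close> at \<open>A'\<close> and \<open>\<mu> u q\<close> at \<open>A\<close>.
    Comparing at \<open>B\<close> if \<open>A' = A\<close>, and at \<open>A'\<close> otherwise,
    leaves only \<open>A' = B\<close>, with equal multiplicities if
    \<open>A \<noteq> B\<close>.\<close>
  have res: "A' = B \<and> (A \<noteq> B \<longrightarrow> \<mu> u p = \<mu> u q)"
  proof (cases "A' = A")
    case True
    then show ?thesis using key[OF BS] pos unfolding gv by (auto split: if_splits)
  next
    case False
    then show ?thesis using key[OF A'S] pos unfolding gv by (auto split: if_splits)
  qed
  show "\<tau> (hd ps) u (\<tau> (ps ! 1) (hd ps) (c (ps ! 1))) = B" using res c1p unfolding A'_def p_def by simp
  show "A \<noteq> B \<Longrightarrow> \<mu> u (hd ps) = \<mu> u (last ps)" using res unfolding p_def q_def by simp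
  have "c2 w = c w" if "w \<notin> set (u # ps)" for w
  proof -
    have "w \<noteq> q" using that ps unfolding q_def by auto
    then show ?thesis using c1(2)[OF that] unfolding c2_def by simp
  qed
  then show "\<exists>c'. St u c' \<and> (\<forall>w. w \<notin> set (u # ps) \<longrightarrow> c' w = c w) \<and>
      \<tau> (hd ps) u (c' (hd ps)) = B \<and> \<tau> (last ps) u (c' (last ps)) = A"
    using st2 res B' c2p unfolding A'_def p_def q_def by (intro exI[of _ c2]) auto
qed

section \<open>Triangles and diamonds\<close>

text \<open>For \<open>ps = [v, w]\<close> the vertex \<open>ps ! 1\<close> is also the last one, so
  the first conclusion of \<open>rotate\<close> compares two transports of the same colour;
  \<open>St_ex\<close> makes this colour arbitrary.\<close>

lemma triangle_flat:
  assumes "adj u v" "adj v w" "adj u w" "x \<in> S w"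
  shows "\<tau> v u (\<tau> w v x) = \<tau> w u x"
proof -
  obtain c where c: "St u c" "c w = x" using St_ex[of u w x] assms adj_V adj_neq by metis
  have "distinct [u, v, w]" using assms adj_neq by auto
  then show ?thesis using rotate(1)[OF c(1), of "[v, w]"] assms c(2) by auto
qed

lemma triangle_\<mu>:
  assumes "adj u v" "adj v w" "adj u w" "St u c" "\<tau> v u (c v) \<noteq> \<tau> w u (c w)"
  shows "\<mu> u v = \<mu> u w"
proof -
  have "distinct [u, v, w]" using assms adj_neq by auto
  then show ?thesis using rotate(2)[OF assms(4), of "[v, w]"] assms by auto
qed

text \<open>With the hole at \<open>w\<close> or \<open>w'\<close>, the 4-cycle through both of them
  and the flat triangles force the other three vertices of the diamond to agree in colour
  (\<open>key\<close>). After a shift of the hole to \<open>u\<close>, some neighbour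
  \<open>z\<close> shows another colour. A hole that leaves through \<open>z\<close> and returns to
  the diamond writes this colour on \<open>u\<close>, against \<open>key\<close>.\<close>

lemma no_diamond:
  assumes uv: "adj u v" and uw: "adj u w" and uw': "adj u w'" and vw: "adj v w" and vw': "adj v w'"
    and ww': "\<not> adj w w'" "w \<noteq> w'"
  shows False
proof -
  note s = uv uw uw' vw vw' adj_sym[OF uv] adj_sym[OF uw] adj_sym[OF uw'] adj_sym[OF vw] adj_sym[OF vw']
  have key: "c u = \<tau> v u (c v) \<and> \<tau> y u (c y) = c u"
    if xy: "(x = w \<and> y = w') \<or> (x = w' \<and> y = w)" and st: "St x c" for x y c
  proof -
    have ad: "adj x u" "adj x v" "adj u y" "adj y v" "adj u x" "adj v x" "adj y u" "adj v y" and nx: "\<not> adj x y" "x \<noteq> y"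
      using s xy ww' adj_sym[of w' w] by auto
    have d: "distinct (x # [u, y, v])" "distinct (x # [v, y, u])" using ad nx uv adj_neq by auto
    have cS: "c u \<in> S u" "c v \<in> S v" "c y \<in> S y"
      using St_nbr[OF st] ad St_in[OF st, of y] nx adj_V by auto
    have ch: "w = u \<or> w = v" if "w \<in> {u, y, v}" "adj x w" for w using that nx by auto
    \<comment> \<open>The 4-cycle is run in both directions; it is chordless at \<open>x\<close>,
      which is not adjacent to \<open>y\<close>. The triangles on the edge between \<open>u\<close>
      and \<open>v\<close> then identify the two transports from \<open>y\<close> to
      \<open>x\<close>.\<close>
    have r1: "\<tau> u x (\<tau> y u (c y)) = \<tau> v x (c v)"
      using rotate(1)[OF st d(1)] ad ch by auto
    have r2: "\<tau> v x (\<tau> y v (c y)) = \<tau> u x (c u)"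
      using rotate(1)[OF st d(2)] ad ch by auto
    have "\<tau> u x (\<tau> y u (c y)) = \<tau> u x (\<tau> v u (\<tau> y v (c y)))"
      using triangle_flat[of u v y "c y"] uv ad cS by simp
    also have "\<dots> = \<tau> v x (\<tau> y v (c y))"
      using triangle_flat[of x u v "\<tau> y v (c y)"] uv ad cS \<tau>_in[of y v "c y"] by simp
    finally have e: "\<tau> u x (\<tau> y u (c y)) = \<tau> u x (c u)" using r2 by simp
    then have yu: "\<tau> y u (c y) = c u" using \<tau>_eq_iff[of u x] ad cS \<tau>_in[of y u "c y"] by simp
    have "\<tau> u x (c u) = \<tau> u x (\<tau> v u (c v))"
      using r1 e triangle_flat[of x u v "c v"] uv ad cS by simp
    then have "c u = \<tau> v u (c v)" using \<tau>_eq_iff[of u x] ad cS \<tau>_in[of v u "c v"] s by simp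
    then show ?thesis using yu by simp
  qed
  have V: "u \<in> V" "v \<in> V" "w \<in> V" "w' \<in> V" using s adj_V by blast+
  obtain c where st: "St w c" using St_ex[of w u] V two[of u] adj_neq[OF uw] by metis
  have k: "c u = \<tau> v u (c v)" "\<tau> w' u (c w') = c u" using key[of w w' c] st by auto
  have cS: "c u \<in> S u" "c v \<in> S v" using St_nbr[OF st] s by auto
  define c1 where "c1 = c(w := \<tau> u w (c u))"
  have st1: "St u c1" unfolding c1_def using St_shift[OF st] s by simp
  have ne: "v \<noteq> w" "u \<noteq> w" "u \<noteq> v" "v \<noteq> w'" "u \<noteq> w'" using s adj_neq by blast+
  \<comment> \<open>In the state \<open>c1\<close> all of \<open>v\<close>, \<open>w\<close> and
    \<open>w'\<close> show \<open>c u\<close>, so \<open>z\<close> lies outside the diamond.\<close>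
  obtain z where z: "adj u z" "\<tau> z u (c1 z) \<noteq> c u" using mixed[OF st1] by metis
  have zv: "z \<noteq> v" using z(2) k(1) ne by (auto simp: c1_def)
  have zw: "z \<noteq> w" using z(2) \<tau>_inv[OF uw cS(1)] by (auto simp: c1_def)
  have zw': "z \<noteq> w'" using z(2) k(2) ww' by (auto simp: c1_def)
  define D where "D = \<tau> z u (c1 z)"
  obtain ps where ps: "walk adj (V - {u}) {z} {v, w, w'} ps" "distinct ps"
    "\<And>i. Suc i < length ps \<Longrightarrow> ps ! i \<notin> {v, w, w'}"
    using shortest_walk[OF conn_minus[OF V(1)], of "{z}" "{v, w, w'}"] z V ne adj_V(2)[OF z(1)] adj_neq[OF z(1)]
    by (metis (no_types, lifting) Diff_iff Int_iff emptyE insertI1 singletonD)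
  have ps0: "ps \<noteq> []" and hz: "hd ps = z" and lz: "last ps \<in> {v, w, w'}" and up: "u \<notin> set ps" and sp: "successively adj ps"
    using ps(1) unfolding walk_def by auto
  have off: "x \<notin> set (u # ps)" if "x \<in> {v, w, w'}" "x \<noteq> last ps" for x
  proof
    assume "x \<in> set (u # ps)"
    then have "x \<in> set ps" using that ne by auto
    then obtain i where i: "i < length ps" "ps ! i = x" by (auto simp: in_set_conv_nth)
    then have "Suc i \<noteq> length ps" using that ps0 by (metis diff_Suc_1 last_conv_nth)
    then show False using ps(3)[of i] i that by auto
  qed
  have "successively adj (u # ps)" using ps0 hz z(1) sp by (cases ps) auto
  from hole_walk[OF st1 _ this] ps(2) up
  obtain c3 where c3: "St (last (u # ps)) c3" "\<And>x. x \<notin> set (u # ps) \<Longrightarrow> c3 x = c1 x"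
    "\<And>i. i < length ps \<Longrightarrow> c3 ((u # ps) ! i) = \<tau> (ps ! i) ((u # ps) ! i) (c1 (ps ! i))" by auto
  have c3u: "c3 u = D" using c3(3)[of 0] ps0 hz by (auto simp: D_def hd_conv_nth)
  have st3: "St (last ps) c3" using c3(1) ps0 by simp
  \<comment> \<open>The walk stops at its first vertex among \<open>v\<close>, \<open>w\<close> and
    \<open>w'\<close>, so the other two keep their colours, while \<open>u\<close> now carries
    \<open>D\<close>. An end at \<open>w\<close> or \<open>w'\<close> contradicts \<open>key\<close>
    directly; from an end at \<open>v\<close> the hole is first moved on to
    \<open>w\<close>.\<close>
  show False
  proof (cases "last ps = v")
    case False
    then have "c3 v = c v" using c3(2)[OF off[of v]] ne by (simp add: c1_def)
    moreover have "c3 u = \<tau> v u (c3 v)" using key[of "last ps" _ c3] st3 lz False by blast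
    ultimately show False using k c3u z(2) by (simp add: D_def)
  next
    case True
    then have c3w: "c3 w = \<tau> u w (c u)" using c3(2)[OF off[of w]] ne by (auto simp: c1_def)
    have st4: "St w (c3(v := \<tau> w v (c3 w)))" using St_shift[of v c3 w] st3 True s by simp
    have "\<tau> w v (c3 w) = \<tau> u v (c u)" using triangle_flat[of v w u "c u"] s cS c3w by simp
    then have "D = \<tau> v u (\<tau> u v (c u))" using key[of w w' "c3(v := \<tau> w v (c3 w))"] st4 c3u ne by auto
    then show False using \<tau>_inv[OF uv cS(1)] z(2) by (simp add: D_def)
  qed
qed

section \<open>Induced cycles of length at least four\<close>

text \<open>The vertices are indexed by all integers modulo \<open>k\<close>, so that rotating and
  reversing the cycle are the substitutions \<open>i + m\<close> and \<open>- i\<close>, and facts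
  about a hole at \<open>q 0\<close> carry over to every position and both directions. Triangles are
  covered by \<open>triangle_flat\<close> instead.\<close>

definition icyc :: "nat \<Rightarrow> (int \<Rightarrow> 'a) \<Rightarrow> bool" where
  "icyc k q \<longleftrightarrow> 4 \<le> k \<and> (\<forall>i. q i \<in> V) \<and> (\<forall>i j. q i = q j \<longleftrightarrow> int k dvd i - j) \<and>
     (\<forall>i j. adj (q i) (q j) \<longleftrightarrow> int k dvd j - i - 1 \<or> int k dvd i - j - 1)"

lemma dvd_small: "int k dvd d \<Longrightarrow> \<bar>d\<bar> < int k \<Longrightarrow> d = 0"
  using dvd_imp_le_int[of d "int k"] by auto

lemma icyc_shift: "icyc k q \<Longrightarrow> icyc k (\<lambda>i. q (i + m))"
  unfolding icyc_def by (simp add: algebra_simps)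

lemma icyc_reflect: "icyc k q \<Longrightarrow> icyc k (\<lambda>i. q (- i))"
  unfolding icyc_def
proof (elim conjE, intro conjI allI)
  fix i j
  assume "\<forall>i j. q i = q j \<longleftrightarrow> int k dvd i - j"
  then have "q (- i) = q (- j) \<longleftrightarrow> int k dvd j - i" by (simp add: algebra_simps)
  then show "q (- i) = q (- j) \<longleftrightarrow> int k dvd i - j" by (metis dvd_minus_iff minus_diff_eq)
next
  fix i j
  assume "\<forall>i j. adj (q i) (q j) \<longleftrightarrow> int k dvd j - i - 1 \<or> int k dvd i - j - 1"
  from this[rule_format, of "- i" "- j"]
  show "adj (q (- i)) (q (- j)) \<longleftrightarrow> int k dvd j - i - 1 \<or> int k dvd i - j - 1"
    by (simp add: algebra_simps disj_commute)
qed auto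

lemma icyc_adj: "icyc k q \<Longrightarrow> adj (q i) (q (i + 1))" "icyc k q \<Longrightarrow> adj (q (i + 1)) (q i)"
  unfolding icyc_def by simp_all

lemma icyc_eq: "icyc k q \<Longrightarrow> int k dvd i - j \<Longrightarrow> q i = q j"
  unfolding icyc_def by simp

lemma icyc_neq: "icyc k q \<Longrightarrow> i \<noteq> j \<Longrightarrow> \<bar>i - j\<bar> < int k \<Longrightarrow> q i \<noteq> q j"
  unfolding icyc_def using dvd_small[of k "i - j"] by auto

lemma icyc_path:
  assumes q: "icyc k q" and m: "0 \<le> m" "m < int k"
  defines "ps \<equiv> map q [1..m]"
  shows "distinct (q 0 # ps)" "successively adj (q 0 # ps)" "length ps = nat m"
    "\<And>i. i < length ps \<Longrightarrow> ps ! i = q (1 + int i)" "\<And>i. i \<le> length ps \<Longrightarrow> (q 0 # ps) ! i = q (int i)"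
    "set ps = q ` {1..m}"
proof -
  show len: "length ps = nat m" by (simp add: ps_def)
  show nth: "ps ! i = q (1 + int i)" if "i < length ps" for i
    using that m len unfolding ps_def by (simp add: nth_upto)
  show nth': "(q 0 # ps) ! i = q (int i)" if "i \<le> length ps" for i
    using that nth[of "i - 1"] by (cases i) (auto simp: add.commute)
  show "set ps = q ` {1..m}" by (simp add: ps_def)
  show "successively adj (q 0 # ps)"
    unfolding successively_conv_nth
  proof (intro allI impI)
    fix i assume "Suc i < length (q 0 # ps)"
    then show "adj ((q 0 # ps) ! i) ((q 0 # ps) ! Suc i)"
      using nth'[of i] nth'[of "Suc i"] icyc_adj(1)[OF q, of "int i"] by (simp add: add.commute)
  qed
  show "distinct (q 0 # ps)"
    unfolding distinct_conv_nth
  proof (intro allI impI)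
    fix i j assume ij: "i < length (q 0 # ps)" "j < length (q 0 # ps)" "i \<noteq> j"
    then have "q (int i) \<noteq> q (int j)" using len m by (intro icyc_neq[OF q]) auto
    then show "(q 0 # ps) ! i \<noteq> (q 0 # ps) ! j" using nth'[of i] nth'[of j] ij by simp
  qed
qed

text \<open>An instance of \<open>rotate\<close>: an induced cycle is chordless everywhere. The last
  vertex \<open>q (int k - 1)\<close> of the round is written as \<open>q (- 1)\<close>.\<close>

lemma icyc_rotate0:
  assumes q: "icyc k q" and st: "St (q 0) c"
  shows "\<tau> (q 1) (q 0) (\<tau> (q 2) (q 1) (c (q 2))) = \<tau> (q (- 1)) (q 0) (c (q (- 1)))" (is ?A)
    and "\<tau> (q 1) (q 0) (c (q 1)) \<noteq> \<tau> (q (- 1)) (q 0) (c (q (- 1))) \<Longrightarrow> \<mu> (q 0) (q 1) = \<mu> (q 0) (q (- 1))"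
    and "\<exists>c'. St (q 0) c' \<and> (\<forall>w. w \<notin> range q \<longrightarrow> c' w = c w) \<and>
      \<tau> (q 1) (q 0) (c' (q 1)) = \<tau> (q (- 1)) (q 0) (c (q (- 1))) \<and>
      \<tau> (q (- 1)) (q 0) (c' (q (- 1))) = \<tau> (q 1) (q 0) (c (q 1))"
proof -
  have k: "4 \<le> k" using q unfolding icyc_def by simp
  let ?ps = "map q [1..int k - 1]"
  have m: "0 \<le> int k - 1" "int k - 1 < int k" using k by auto
  note p = icyc_path[OF q m]
  have km: "q (int k - 1) = q (- 1)" by (rule icyc_eq[OF q]) simp
  have hd: "hd ?ps = q 1" using p(3) p(4)[of 0] k by (subst hd_conv_nth) auto
  have la: "last ?ps = q (- 1)"
    using p(3) p(4)[of "length ?ps - 1"] k km by (subst last_conv_nth) (auto simp: of_nat_diff)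
  have n1: "?ps ! 1 = q 2" using p(3) p(4)[of 1] k by auto
  have len: "2 \<le> length ?ps" using p(3) k by simp
  have a1: "adj (q 0) (hd ?ps)" using icyc_adj(1)[OF q, of 0] hd by simp
  have a2: "adj (q 0) (last ?ps)" using icyc_adj(2)[OF q, of "-1"] la by simp
  have sc: "successively adj ?ps" using p(2) len by (cases ?ps) auto
  have chord: "w = hd ?ps \<or> w = last ?ps" if w: "w \<in> set ?ps" "adj (q 0) w" for w
  proof -
    obtain i where i: "w = q i" using w(1) by auto
    then have "int k dvd i - 1 \<or> int k dvd - i - 1" using w(2) q unfolding icyc_def by auto
    moreover have "- i - 1 = - 1 - i" by simp
    ultimately have "int k dvd i - 1 \<or> int k dvd - 1 - i" by metis
    then have "q i = q 1 \<or> q i = q (- 1)"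
      using icyc_eq[OF q, of i 1] icyc_eq[OF q, of "-1" i] by metis
    then show ?thesis using i hd la by simp
  qed
  note rot = rotate[OF st p(1) sc len a1 a2 chord, unfolded hd la n1]
  show ?A using rot(1) by simp
  show "\<tau> (q 1) (q 0) (c (q 1)) \<noteq> \<tau> (q (- 1)) (q 0) (c (q (- 1))) \<Longrightarrow> \<mu> (q 0) (q 1) = \<mu> (q 0) (q (- 1))"
    using rot(2) by simp
  have "set (q 0 # ?ps) \<subseteq> range q" by auto
  with rot(3) show "\<exists>c'. St (q 0) c' \<and> (\<forall>w. w \<notin> range q \<longrightarrow> c' w = c w) \<and>
      \<tau> (q 1) (q 0) (c' (q 1)) = \<tau> (q (- 1)) (q 0) (c (q (- 1))) \<and>
      \<tau> (q (- 1)) (q 0) (c' (q (- 1))) = \<tau> (q 1) (q 0) (c (q 1))"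
    by blast
qed

lemma icyc_rotate:
  assumes q: "icyc k q" and st: "St (q m) c"
  shows "\<tau> (q (m + 1)) (q m) (\<tau> (q (m + 2)) (q (m + 1)) (c (q (m + 2)))) = \<tau> (q (m - 1)) (q m) (c (q (m - 1)))"
    and "\<tau> (q (m - 1)) (q m) (\<tau> (q (m - 2)) (q (m - 1)) (c (q (m - 2)))) = \<tau> (q (m + 1)) (q m) (c (q (m + 1)))"
proof -
  show "\<tau> (q (m + 1)) (q m) (\<tau> (q (m + 2)) (q (m + 1)) (c (q (m + 2)))) = \<tau> (q (m - 1)) (q m) (c (q (m - 1)))"
    using icyc_rotate0(1)[OF icyc_shift[OF q, of m], of c] st by (simp add: add.commute)
  show "\<tau> (q (m - 1)) (q m) (\<tau> (q (m - 2)) (q (m - 1)) (c (q (m - 2)))) = \<tau> (q (m + 1)) (q m) (c (q (m + 1)))"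
    using icyc_rotate0(1)[OF icyc_reflect[OF icyc_shift[OF q, of m]], of c] st by (simp add: add.commute)
qed

text \<open>Walking the hole from \<open>q 0\<close> to \<open>q i\<close> copies the colour of
  \<open>q i\<close> back to \<open>q (i - 1)\<close> and leaves \<open>q (i + 2)\<close> alone; a
  rotation around the cycle at \<open>q i\<close> compares these two. The bound
  \<open>i + 3 \<le> int k\<close> keeps \<open>q (i + 2)\<close> off the walked arc.\<close>

lemma icyc_alt0:
  assumes q: "icyc k q" and st: "St (q 0) c" and i: "1 \<le> i" "i + 3 \<le> int k"
  shows "c (q i) = \<tau> (q (i + 1)) (q i) (\<tau> (q (i + 2)) (q (i + 1)) (c (q (i + 2))))"
proof -
  have m: "0 \<le> i" "i < int k" using i by auto
  let ?ps = "map q [1..i]"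
  note p = icyc_path[OF q m]
  from hole_walk[OF st p(1,2)] obtain c' where c': "St (last (q 0 # ?ps)) c'"
    "\<And>w. w \<notin> set (q 0 # ?ps) \<Longrightarrow> c' w = c w"
    "\<And>i. i < length ?ps \<Longrightarrow> c' ((q 0 # ?ps) ! i) = \<tau> (?ps ! i) ((q 0 # ?ps) ! i) (c (?ps ! i))" by blast
  have la: "last (q 0 # ?ps) = q i"
    using p(3) p(4)[of "length ?ps - 1"] i by (auto simp: last_conv_nth of_nat_diff)
  have "nat i - 1 < length ?ps" using p(3) i by simp
  then have c1: "c' (q (i - 1)) = \<tau> (q i) (q (i - 1)) (c (q i))"
    using c'(3)[of "nat i - 1"] p(4)[of "nat i - 1"] p(5)[of "nat i - 1"] i by (auto simp: of_nat_diff)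
  have "q (i + 2) \<notin> set (q 0 # ?ps)"
  proof
    assume "q (i + 2) \<in> set (q 0 # ?ps)"
    then have "q (i + 2) = q 0 \<or> q (i + 2) \<in> q ` {1..i}" using p(6) by simp
    then have "\<exists>j. 0 \<le> j \<and> j \<le> i \<and> q (i + 2) = q j"
    proof
      assume "q (i + 2) = q 0"
      then show ?thesis using i by (intro exI[of _ 0]) auto
    next
      assume "q (i + 2) \<in> q ` {1..i}"
      then obtain j where "j \<in> {1..i}" "q (i + 2) = q j" by blast
      then show ?thesis by (intro exI[of _ j]) auto
    qed
    then obtain j where "0 \<le> j" "j \<le> i" "q (i + 2) = q j" by blast
    then show False using icyc_neq[OF q, of "i + 2" j] i by auto
  qed
  then have c2: "c' (q (i + 2)) = c (q (i + 2))" using c'(2) by blast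
  have ad: "adj (q (i - 1)) (q i)" using icyc_adj(1)[OF q, of "i - 1"] by simp
  have "q i \<noteq> q 0" using icyc_neq[OF q, of i 0] i by auto
  then have "c (q i) \<in> S (q i)" using St_in[OF st] adj_V(2)[OF ad] by auto
  then show ?thesis using icyc_rotate(1)[OF q, of i c'] c'(1) la c1 c2 \<tau>_inv[of "q i" "q (i - 1)"] ad
    by (simp add: adj_sym)
qed

lemma icyc_alt:
  assumes q: "icyc k q" and st: "St (q m) c" and i: "m + 1 \<le> i" "i + 3 \<le> m + int k"
  shows "c (q i) = \<tau> (q (i + 1)) (q i) (\<tau> (q (i + 2)) (q (i + 1)) (c (q (i + 2))))"
  using icyc_alt0[OF icyc_shift[OF q, of m], of c "i - m"] st i by (simp add: algebra_simps)

text \<open>A hole at \<open>q 0\<close> leaves the cycle through an outside neighbour \<open>z\<close> and re-enters it at \<open>q j\<close>.\<close>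

lemma icyc_detour:
  assumes q: "icyc k q" and z: "adj (q 0) z" "z \<notin> range q"
  obtains j where "1 \<le> j" "j < int k"
    "\<And>c. St (q 0) c \<Longrightarrow> \<exists>c'. St (q j) c' \<and> c' (q 0) = \<tau> z (q 0) (c z) \<and>
      (\<forall>i. q i \<noteq> q 0 \<and> q i \<noteq> q j \<longrightarrow> c' (q i) = c (q i))"
proof -
  have k: "4 \<le> k" and qV: "\<And>i. q i \<in> V" using q unfolding icyc_def by auto
  let ?Z = "range q - {q 0}"
  have "q 1 \<noteq> q 0" using icyc_neq[OF q, of 1 0] k by auto
  then have "q 1 \<in> ?Z \<inter> (V - {q 0})" using qV by auto
  then have ne: "{z} \<inter> (V - {q 0}) \<noteq> {}" "?Z \<inter> (V - {q 0}) \<noteq> {}" using z adj_V[OF z(1)] by auto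
  obtain ps where ps: "walk adj (V - {q 0}) {z} ?Z ps" "distinct ps"
    "\<And>i. Suc i < length ps \<Longrightarrow> ps ! i \<notin> ?Z"
    using shortest_walk[OF conn_minus[OF qV] ne] by metis
  have ps0: "ps \<noteq> []" and hz: "hd ps = z" and lz: "last ps \<in> ?Z" and up: "q 0 \<notin> set ps" and sp: "successively adj ps"
    using ps(1) unfolding walk_def by auto
  obtain j0 where j0: "last ps = q j0" "q j0 \<noteq> q 0" using lz by auto
  define j where "j = j0 mod int k"
  have qj: "q j = last ps" using icyc_eq[OF q, of j j0] j0 unfolding j_def by (simp add: mod_eq_dvd_iff[symmetric])
  have "j \<noteq> 0" using qj j0 by auto
  then have j: "1 \<le> j" "j < int k" using k pos_mod_sign[of "int k" j0] pos_mod_bound[of "int k" j0] unfolding j_def by linarith+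
  \<comment> \<open>Being shortest, the walk meets the cycle only at its end, so among the cycle
    vertices only \<open>q 0\<close> and \<open>q j\<close> are affected. The index \<open>j\<close>
    is fixed before the state is chosen, which \<open>icyc_spanning\<close> exploits.\<close>
  have off: "q i \<notin> set (q 0 # ps)" if qi: "q i \<noteq> q 0" "q i \<noteq> q j" for i
  proof
    assume "q i \<in> set (q 0 # ps)"
    then obtain n where n: "n < length ps" "ps ! n = q i" using qi by (auto simp: in_set_conv_nth)
    then have "Suc n \<noteq> length ps" using that ps0 qj by (metis diff_Suc_1 last_conv_nth)
    then show False using ps(3)[of n] n that by auto
  qed
  have sc: "successively adj (q 0 # ps)" using ps0 hz z(1) sp by (cases ps) auto
  have "\<exists>c'. St (q j) c' \<and> c' (q 0) = \<tau> z (q 0) (c z) \<and>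
      (\<forall>i. q i \<noteq> q 0 \<and> q i \<noteq> q j \<longrightarrow> c' (q i) = c (q i))" if st: "St (q 0) c" for c
  proof -
    from hole_walk[OF st _ sc] ps(2) up
    obtain c3 where c3: "St (last (q 0 # ps)) c3" "\<And>x. x \<notin> set (q 0 # ps) \<Longrightarrow> c3 x = c x"
      "\<And>i. i < length ps \<Longrightarrow> c3 ((q 0 # ps) ! i) = \<tau> (ps ! i) ((q 0 # ps) ! i) (c (ps ! i))" by auto
    have "c3 (q 0) = \<tau> z (q 0) (c z)" using c3(3)[of 0] ps0 hz by (auto simp: hd_conv_nth)
    then show ?thesis using c3(1,2) off qj ps0 by (intro exI[of _ c3]) auto
  qed
  with j that show ?thesis by blast
qed

text \<open>The colour of \<open>q (- 2)\<close> is the same in both states. Alternation with the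
  hole at \<open>q 1\<close> links it to \<open>D\<close>, and rotation with the hole at
  \<open>q 0\<close> links it to the colour that \<open>q 1\<close> shows.\<close>

lemma detour_first:
  assumes q: "icyc k q" and st: "St (q 0) c" and st': "St (q 1) c'" and D: "c' (q 0) = D" "D \<in> S (q 0)"
    and eq: "\<And>i. q i \<noteq> q 0 \<Longrightarrow> q i \<noteq> q 1 \<Longrightarrow> c' (q i) = c (q i)"
  shows "D = \<tau> (q 1) (q 0) (c (q 1))"
proof -
  have k: "4 \<le> k" using q unfolding icyc_def by auto
  have e: "q (int k - 2) = q (- 2)" "q (int k - 1) = q (- 1)" "q (int k) = q 0"
    using icyc_eq[OF q, of "int k - 2" "-2"] icyc_eq[OF q, of "int k - 1" "-1"] icyc_eq[OF q, of "int k" "0"] by auto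
  have n: "q (-2) \<noteq> q 0" "q (-2) \<noteq> q 1"
    using icyc_neq[OF q, of "-2" 0] icyc_neq[OF q, of "-2" 1] k by auto
  have a: "adj (q (-2)) (q (-1))" "adj (q (-1)) (q 0)" using icyc_adj(1)[OF q, of "-2"] icyc_adj(1)[OF q, of "-1"] by auto
  \<comment> \<open>Alternation is stated for the indices following the hole, so the positions
    \<open>- 2\<close>, \<open>- 1\<close> and \<open>0\<close> enter as \<open>int k - 2\<close>,
    \<open>int k - 1\<close> and \<open>int k\<close>.\<close>
  have "c' (q (int k - 2)) = \<tau> (q (int k - 2 + 1)) (q (int k - 2)) (\<tau> (q (int k - 2 + 2)) (q (int k - 2 + 1)) (c' (q (int k - 2 + 2))))"
    using k by (intro icyc_alt[OF q st']) auto
  moreover have "int k - 2 + 1 = int k - 1" "int k - 2 + 2 = int k" by auto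
  ultimately have "c (q (-2)) = \<tau> (q (-1)) (q (-2)) (\<tau> (q 0) (q (-1)) D)" using e D eq[of "-2"] n by simp
  then have "\<tau> (q (-2)) (q (-1)) (c (q (-2))) = \<tau> (q 0) (q (-1)) D"
    using \<tau>_inv[of "q (-1)" "q (-2)"] \<tau>_in[of "q 0" "q (-1)"] a D adj_sym by simp
  then have "\<tau> (q (-1)) (q 0) (\<tau> (q (-2)) (q (-1)) (c (q (-2)))) = D"
    using \<tau>_inv[of "q 0" "q (-1)" D] a D adj_sym by simp
  then show ?thesis using icyc_rotate(2)[OF q, of 0 c] st by simp
qed

lemma detour_last:
  assumes q: "icyc k q" and st: "St (q 0) c" and st': "St (q (int k - 1)) c'" and D: "c' (q 0) = D" "D \<in> S (q 0)"
    and eq: "\<And>i. q i \<noteq> q 0 \<Longrightarrow> q i \<noteq> q (int k - 1) \<Longrightarrow> c' (q i) = c (q i)"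
  shows "D = \<tau> (q (-1)) (q 0) (c (q (-1)))"
proof -
  have e: "q (int k - 1) = q (- 1)" using icyc_eq[OF q, of "int k - 1" "-1"] by auto
  show ?thesis
    using detour_first[OF icyc_reflect[OF q], of c c' D] st st' D eq e by simp
qed

text \<open>With the hole at \<open>q j\<close>, alternation across position \<open>0\<close>
  compares \<open>q (- 1)\<close> with \<open>q 1\<close>, both unchanged. Alternation across
  position \<open>1\<close> compares \<open>D\<close> at \<open>q 0\<close> with the colour of
  \<open>q 2\<close>, which is unchanged when \<open>3 \<le> j\<close>, and a rotation in the old
  state evaluates the latter.\<close>

lemma detour_middle:
  assumes q: "icyc k q" and st: "St (q 0) c" and st': "St (q j) c'" and j: "2 \<le> j" "j \<le> int k - 2"
    and eq: "\<And>i. q i \<noteq> q 0 \<Longrightarrow> q i \<noteq> q j \<Longrightarrow> c' (q i) = c (q i)"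
    and D: "c' (q 0) = D" "D \<in> S (q 0)"
  shows "\<tau> (q 1) (q 0) (c (q 1)) = \<tau> (q (-1)) (q 0) (c (q (-1)))"
    and "3 \<le> j \<Longrightarrow> D = \<tau> (q (-1)) (q 0) (c (q (-1)))"
proof -
  have k: "4 \<le> k" using q unfolding icyc_def by auto
  have e: "q (int k - 1) = q (- 1)" "q (int k) = q 0" "q (int k + 1) = q 1" "q (int k + 2) = q 2"
    using icyc_eq[OF q, of "int k - 1" "-1"] icyc_eq[OF q, of "int k" 0] icyc_eq[OF q, of "int k + 1" "1"]
      icyc_eq[OF q, of "int k + 2" 2] by auto
  have n: "q (-1) \<noteq> q 0" "q (-1) \<noteq> q j" "q 1 \<noteq> q 0" "q 1 \<noteq> q j"
    using icyc_neq[OF q, of "-1" 0] icyc_neq[OF q, of "-1" j] icyc_neq[OF q, of "1" 0] icyc_neq[OF q, of "1" j] k j by auto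
  have a: "adj (q 0) (q 1)" "adj (q (-1)) (q 0)" using icyc_adj(1)[OF q, of "0"] icyc_adj(1)[OF q, of "-1"] by auto
  have "c' (q (int k - 1)) = \<tau> (q (int k - 1 + 1)) (q (int k - 1)) (\<tau> (q (int k - 1 + 2)) (q (int k - 1 + 1)) (c' (q (int k - 1 + 2))))"
    using k j by (intro icyc_alt[OF q st']) auto
  moreover have "int k - 1 + 1 = int k" "int k - 1 + 2 = int k + 1" by auto
  ultimately have "c (q (-1)) = \<tau> (q 0) (q (-1)) (\<tau> (q 1) (q 0) (c (q 1)))" using e eq[of "-1"] eq[of 1] n by simp
  then show "\<tau> (q 1) (q 0) (c (q 1)) = \<tau> (q (-1)) (q 0) (c (q (-1)))"
    using \<tau>_inv[of "q 0" "q (-1)"] a St_seen[OF st, of "q 1"] adj_sym by simp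
  assume j3: "3 \<le> j"
  have n2: "q 2 \<noteq> q 0" "q 2 \<noteq> q j"
    using icyc_neq[OF q, of 2 0] icyc_neq[OF q, of 2 j] k j j3 by auto
  have "c' (q (int k)) = \<tau> (q (int k + 1)) (q (int k)) (\<tau> (q (int k + 2)) (q (int k + 1)) (c' (q (int k + 2))))"
    using k j j3 by (intro icyc_alt[OF q st']) auto
  then have "D = \<tau> (q 1) (q 0) (\<tau> (q 2) (q 1) (c (q 2)))" using e D eq[of 2] n2 by simp
  then show "D = \<tau> (q (-1)) (q 0) (c (q (-1)))" using icyc_rotate(1)[OF q, of 0 c] st by simp
qed

text \<open>Here \<open>q 2\<close> is the hole, so \<open>D\<close> cannot be compared with it by
  alternation from either side. Instead, equal colours shown by \<open>q 1\<close> and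
  \<open>q (- 1)\<close> make the colours of \<open>q 1\<close>, \<open>q 2\<close> and
  \<open>q (- 1)\<close> transports of one another, and a rotation at \<open>q 1\<close> after one
  more shift draws \<open>D\<close> into this agreement.\<close>

lemma detour_middle4:
  assumes q: "icyc 4 q" and st: "St (q 0) c" and st': "St (q 2) c'"
    and AB: "\<tau> (q 1) (q 0) (c (q 1)) = \<tau> (q (-1)) (q 0) (c (q (-1)))"
    and eq: "\<And>i. q i \<noteq> q 0 \<Longrightarrow> q i \<noteq> q 2 \<Longrightarrow> c' (q i) = c (q i)"
    and D: "c' (q 0) = D" "D \<in> S (q 0)"
  shows "D = \<tau> (q 1) (q 0) (c (q 1))"
proof -
  have e: "q 3 = q (-1)" "q (-2) = q 2" using icyc_eq[OF q, of 3 "-1"] icyc_eq[OF q, of "-2" 2] by auto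
  have n: "q 1 \<noteq> q 0" "q 1 \<noteq> q 2" "q (-1) \<noteq> q 0" "q (-1) \<noteq> q 2" "q 0 \<noteq> q 2"
    using icyc_neq[OF q, of 1 0] icyc_neq[OF q, of 1 2] icyc_neq[OF q, of "-1" 0] icyc_neq[OF q, of "-1" 2]
      icyc_neq[OF q, of 0 2] by auto
  have a: "adj (q 0) (q 1)" "adj (q 1) (q 2)" "adj (q (-1)) (q 2)" "adj (q (-1)) (q 0)"
    using icyc_adj(1)[OF q, of 0] icyc_adj(1)[OF q, of 1] icyc_adj(2)[OF q, of 2] icyc_adj(1)[OF q, of "-1"] e by auto
  note a' = a a[THEN adj_sym]
  have cS: "c (q 1) \<in> S (q 1)" "c (q 2) \<in> S (q 2)" "c (q (-1)) \<in> S (q (-1))"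
    using St_in[OF st] n a' adj_V by metis+
  have "\<tau> (q 1) (q 0) (\<tau> (q 2) (q 1) (c (q 2))) = \<tau> (q 1) (q 0) (c (q 1))"
    using icyc_rotate(1)[OF q, of 0 c] st AB by simp
  then have 1: "\<tau> (q 2) (q 1) (c (q 2)) = c (q 1)" using \<tau>_eq_iff[of "q 1" "q 0"] a' cS \<tau>_in by simp
  have "\<tau> (q (-1)) (q 0) (\<tau> (q 2) (q (-1)) (c (q 2))) = \<tau> (q (-1)) (q 0) (c (q (-1)))"
    using icyc_rotate(2)[OF q, of 0 c] st AB e by simp
  then have 2: "\<tau> (q 2) (q (-1)) (c (q 2)) = c (q (-1))" using \<tau>_eq_iff[of "q (-1)" "q 0"] a' cS \<tau>_in by simp
  have c': "c' (q 1) = c (q 1)" "c' (q (-1)) = c (q (-1))" using eq n by auto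
  define c4 where "c4 = c'(q 2 := \<tau> (q 1) (q 2) (c' (q 1)))"
  have "St (q 1) c4" unfolding c4_def using St_shift[OF st'] a' by simp
  from icyc_rotate(1)[OF q, of 1 c4] this
  have "\<tau> (q 2) (q 1) (\<tau> (q (-1)) (q 2) (c (q (-1)))) = \<tau> (q 0) (q 1) D"
    using e n c' D by (simp add: c4_def)
  moreover have "\<tau> (q (-1)) (q 2) (c (q (-1))) = c (q 2)" using 2 \<tau>_inv[of "q 2" "q (-1)"] a' cS by metis
  ultimately have "c (q 1) = \<tau> (q 0) (q 1) D" using 1 by simp
  then show ?thesis using \<tau>_inv[of "q 0" "q 1"] a' D by simp
qed

text \<open>If both cycle neighbours showed the same colour, \<open>mixed\<close> would give a
  neighbour \<open>z\<close> off the cycle showing another one. A detour through \<open>z\<close>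
  writes that colour on \<open>q 0\<close>, and every possible re-entry point equates it with the
  common colour.\<close>

lemma icyc_seen_neq0:
  assumes q: "icyc k q" and st: "St (q 0) c"
  shows "\<tau> (q 1) (q 0) (c (q 1)) \<noteq> \<tau> (q (-1)) (q 0) (c (q (-1)))"
proof
  assume AB: "\<tau> (q 1) (q 0) (c (q 1)) = \<tau> (q (-1)) (q 0) (c (q (-1)))"
  have k: "4 \<le> k" using q unfolding icyc_def by auto
  obtain z where z: "adj (q 0) z" "\<tau> z (q 0) (c z) \<noteq> \<tau> (q 1) (q 0) (c (q 1))" using mixed[OF st] .
  have "z \<notin> range q"
  proof
    assume "z \<in> range q"
    then obtain i where i: "z = q i" by auto
    then have "int k dvd i - 1 \<or> int k dvd - i - 1" using z(1) q unfolding icyc_def by auto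
    moreover have "- i - 1 = - 1 - i" by simp
    ultimately have "int k dvd i - 1 \<or> int k dvd - 1 - i" by metis
    then have "q i = q 1 \<or> q i = q (- 1)"
      using icyc_eq[OF q, of i 1] icyc_eq[OF q, of "-1" i] by metis
    then show False using z(2) AB i by auto
  qed
  from icyc_detour[OF q z(1) this] st obtain j c' where j: "1 \<le> j" "j < int k" and c': "St (q j) c'"
    "c' (q 0) = \<tau> z (q 0) (c z)" "\<And>i. q i \<noteq> q 0 \<Longrightarrow> q i \<noteq> q j \<Longrightarrow> c' (q i) = c (q i)" by metis
  have DS: "\<tau> z (q 0) (c z) \<in> S (q 0)" using St_seen[OF st z(1)] .
  consider "j = 1" | "j = int k - 1" | "3 \<le> j" "j \<le> int k - 2" | "j = 2" "5 \<le> k" | "j = 2" "k = 4"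
    using j k by linarith
  then show False
  proof cases
    case 1
    then show False using detour_first[OF q st _ _ DS, of c'] c' z by simp
  next
    case 2
    then show False using detour_last[OF q st _ _ DS, of c'] c' z AB by simp
  next
    case 3
    then show False using detour_middle(2)[OF q st c'(1) _ _ _ _ DS] c'(2,3) z AB by simp
  next
    \<comment> \<open>Reversing the cycle turns position \<open>2\<close> into \<open>k - 2\<close>,
      which is at least \<open>3\<close> because \<open>5 \<le> k\<close>.\<close>
    case 4
    have e: "q (- (int k - 2)) = q 2" using icyc_eq[OF q, of "- (int k - 2)" 2] by (simp add: algebra_simps)
    have "\<tau> z (q 0) (c z) = \<tau> (q 1) (q 0) (c (q 1))"
      using detour_middle(2)[OF icyc_reflect[OF q], of c "int k - 2" c' "\<tau> z (q 0) (c z)"] st 4 c' DS e by simp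
    then show False using z by simp
  next
    case 5
    then show False using detour_middle4[of q c c'] q st c' AB DS z by simp
  qed
qed

lemma icyc_seen_neq:
  assumes q: "icyc k q" and st: "St (q m) c"
  shows "\<tau> (q (m + 1)) (q m) (c (q (m + 1))) \<noteq> \<tau> (q (m - 1)) (q m) (c (q (m - 1)))"
  using icyc_seen_neq0[OF icyc_shift[OF q, of m], of c] st by (simp add: add.commute)

lemma St_exists: "u \<in> V \<Longrightarrow> \<exists>c. St u c"
proof -
  assume u: "u \<in> V"
  then obtain w where "w \<in> V" "w \<noteq> u" using conn_minus[OF u] unfolding conn_def by blast
  then show ?thesis using St_ex[of u w] two[of w] u by metis
qed

text \<open>A neighbour \<open>z\<close> off the cycle has a fixed re-entry point, hence in every
  state it shows what one fixed side of the hole shows. A rotation around the cycle exchanges the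
  two sides, which differ by \<open>icyc_seen_neq0\<close>, and leaves \<open>z\<close>
  alone.\<close>

lemma icyc_spanning:
  assumes q: "icyc k q"
  shows "V = range q"
proof (rule ccontr)
  assume "V \<noteq> range q"
  moreover have "range q \<subseteq> V" using q unfolding icyc_def by auto
  ultimately obtain x z where "x \<in> range q" "z \<in> V" "z \<notin> range q" "adj x z"
    using connD[OF conn, of "range q"] by (metis UNIV_I empty_iff image_eqI)
  then obtain m where m: "adj (q m) z" "z \<notin> range q" by auto
  define r where "r i = q (i + m)" for i
  have r: "icyc k r" unfolding r_def by (rule icyc_shift[OF q])
  have k: "4 \<le> k" using q unfolding icyc_def by auto
  have z: "adj (r 0) z" "z \<notin> range r" using m unfolding r_def by auto
  from icyc_detour[OF r z] obtain j where j: "1 \<le> j" "j < int k"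
    "\<And>c. St (r 0) c \<Longrightarrow> \<exists>c'. St (r j) c' \<and> c' (r 0) = \<tau> z (r 0) (c z) \<and>
      (\<forall>i. r i \<noteq> r 0 \<and> r i \<noteq> r j \<longrightarrow> c' (r i) = c (r i))" by blast
  have alt: "(j = 1 \<longrightarrow> \<tau> z (r 0) (c z) = \<tau> (r 1) (r 0) (c (r 1))) \<and>
    (j \<noteq> 1 \<longrightarrow> \<tau> z (r 0) (c z) = \<tau> (r (-1)) (r 0) (c (r (-1))))" if st: "St (r 0) c" for c
  proof -
    obtain c' where c': "St (r j) c'" "c' (r 0) = \<tau> z (r 0) (c z)"
      "\<And>i. r i \<noteq> r 0 \<Longrightarrow> r i \<noteq> r j \<Longrightarrow> c' (r i) = c (r i)" using j(3)[OF st] by blast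
    have DS: "\<tau> z (r 0) (c z) \<in> S (r 0)" using St_seen[OF st z(1)] .
    consider "j = 1" | "j = int k - 1" "j \<noteq> 1" | "2 \<le> j" "j \<le> int k - 2" using j by linarith
    then show ?thesis
    proof cases
      case 1
      then show ?thesis using detour_first[OF r st _ _ DS, of c'] c' by simp
    next
      case 2
      then show ?thesis using detour_last[OF r st _ _ DS, of c'] c' by simp
    next
      case 3
      then show ?thesis using detour_middle(1)[OF r st c'(1) _ _ _ _ DS] c'(2,3) icyc_seen_neq0[OF r st] by simp
    qed
  qed
  obtain c where st: "St (r 0) c" using St_exists adj_V z by blast
  from icyc_rotate0(3)[OF r st] obtain c' where c': "St (r 0) c'" "\<And>w. w \<notin> range r \<Longrightarrow> c' w = c w"
    "\<tau> (r 1) (r 0) (c' (r 1)) = \<tau> (r (- 1)) (r 0) (c (r (- 1)))"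
    "\<tau> (r (- 1)) (r 0) (c' (r (- 1))) = \<tau> (r 1) (r 0) (c (r 1))" by blast
  have "\<tau> z (r 0) (c' z) = \<tau> z (r 0) (c z)" using c'(2) z by simp
  then show False using alt[OF st] alt[OF c'(1)] c'(3,4) icyc_seen_neq0[OF r st] by (cases "j = 1") auto
qed

end

context hole_system
begin

section \<open>The base graph is complete or a cycle; its multiplicities and class sums\<close>

lemma icyc_of_list:
  assumes len: "4 \<le> length L" and dist: "distinct L" and LV: "set L \<subseteq> V"
    and ad: "\<And>a b. a < b \<Longrightarrow> b < length L \<Longrightarrow> adj (L ! a) (L ! b) \<longleftrightarrow> b = Suc a \<or> a = 0 \<and> b = length L - 1"
  shows "icyc (length L) (\<lambda>i. L ! nat (i mod int (length L)))"
proof -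
  define k where "k = length L"
  define r where "r i = nat (i mod int k)" for i :: int
  have k0: "0 < int k" using len unfolding k_def by linarith
  have r: "r i < k" "int (r i) = i mod int k" for i
    using k0 pos_mod_sign[OF k0, of i] pos_mod_bound[OF k0, of i] unfolding r_def by (simp_all add: nat_less_iff)
  have small: "int k dvd d \<longleftrightarrow> d = 0 \<or> d = - int k" if "- int k \<le> d" "d < int k" for d
    using dvd_small[of k d] that k0 by (cases "d = - int k") auto
  have lt: "adj (L ! a) (L ! b) \<longleftrightarrow> int k dvd int b - int a - 1 \<or> int k dvd int a - int b - 1"
    if "a < b" "b < k" for a b
    using ad[of a b] that small[of "int b - int a - 1"] small[of "int a - int b - 1"] unfolding k_def by auto
  have any: "adj (L ! a) (L ! b) \<longleftrightarrow> int k dvd int b - int a - 1 \<or> int k dvd int a - int b - 1"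
    if "a < k" "b < k" for a b
  proof -
    consider "a < b" | "b < a" | "a = b" by linarith
    then show ?thesis
    proof cases
      case 1
      then show ?thesis using lt that by blast
    next
      case 2
      then show ?thesis using lt[of b a] that \<mu>_sym[of "L ! a" "L ! b"] by auto
    next
      case 3
      then show ?thesis using \<mu>_irrefl small[of "- 1"] len unfolding k_def by auto
    qed
  qed
  have dm: "int k dvd j - i - 1 \<longleftrightarrow> int k dvd int (r j) - int (r i) - 1" for i j
  proof -
    have "(j mod int k - i mod int k - 1) mod int k = (j - i - 1) mod int k"
      by (metis mod_diff_eq mod_diff_left_eq)
    then show ?thesis unfolding dvd_eq_mod_eq_0 r by simp
  qed
  show ?thesis unfolding icyc_def k_def[symmetric] r_def[symmetric]
  proof (intro conjI allI)
    show "4 \<le> k" using len k_def by simp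
    show "L ! r i \<in> V" for i using r(1)[of i] LV nth_mem unfolding k_def by blast
    show "L ! r i = L ! r j \<longleftrightarrow> int k dvd i - j" for i j
    proof -
      have "L ! r i = L ! r j \<longleftrightarrow> r i = r j" using dist r(1) unfolding k_def by (simp add: nth_eq_iff_index_eq)
      also have "\<dots> \<longleftrightarrow> i mod int k = j mod int k" using r(2)[of i] r(2)[of j] by (metis r_def)
      finally show ?thesis by (simp add: mod_eq_dvd_iff)
    qed
    show "adj (L ! r i) (L ! r j) \<longleftrightarrow> int k dvd j - i - 1 \<or> int k dvd i - j - 1" for i j
      using any[OF r(1) r(1), of i j] dm[of i j] dm[of j i] by simp
  qed
qed

text \<open>A shortest walk between non-adjacent vertices starts with an induced path
  \<open>w, u, w'\<close>. The neighbours of \<open>u\<close> cut a shortest walk from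
  \<open>w\<close> to \<open>w'\<close> avoiding \<open>u\<close> into segments. A segment of at
  least two edges closes up with \<open>u\<close> to an induced cycle of length at least four; two
  consecutive segments of one edge would form a diamond.\<close>

lemma complete_or_cycle:
  assumes "\<not> (\<forall>u\<in>V. \<forall>v\<in>V. u \<noteq> v \<longrightarrow> adj u v)"
  shows "\<exists>k q. icyc k q"
proof -
  obtain s t where st: "s \<in> V" "t \<in> V" "s \<noteq> t" "\<not> adj s t" using assms by blast
  obtain ps where ps: "walk adj V {s} {t} ps" "distinct ps"
    "\<And>i j. i < j \<Longrightarrow> j < length ps \<Longrightarrow> adj (ps ! i) (ps ! j) \<Longrightarrow> j = Suc i"
    using shortest_walk[OF conn, of "{s}" "{t}"] st by (metis Int_iff emptyE singletonI)
  have sp: "adj (ps ! i) (ps ! Suc i)" if "Suc i < length ps" for i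
    using ps(1) that unfolding walk_def by (auto simp: successively_conv_nth)
  have "3 \<le> length ps"
  proof (rule ccontr)
    assume "\<not> 3 \<le> length ps"
    then consider "ps = []" | x where "ps = [x]" | x y where "ps = [x, y]"
      by (cases ps; cases "tl ps"; cases "tl (tl ps)") auto
    then show False using ps(1) st unfolding walk_def by cases auto
  qed
  define w u w' where "w = ps ! 0" and "u = ps ! 1" and "w' = ps ! 2"
  have uw: "adj u w" and uw': "adj u w'" using sp[of 0] sp[of 1] \<open>3 \<le> length ps\<close> adj_sym
    unfolding w_def u_def w'_def by (auto simp: numeral_2_eq_2)
  have ww': "\<not> adj w w'" using ps(3)[of 0 2] \<open>3 \<le> length ps\<close> unfolding w_def w'_def by auto
  have wn: "w \<noteq> w'" using ps(2) \<open>3 \<le> length ps\<close> nth_eq_iff_index_eq[of ps 0 2] unfolding w_def w'_def by (cases ps) auto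
  have uV: "u \<in> V" and wV: "w \<in> V" "w' \<in> V" and uwn: "w \<noteq> u" "w' \<noteq> u" using uw uw' adj_V adj_neq by blast+
  obtain rs where rs: "walk adj (V - {u}) {w} {w'} rs" "distinct rs"
    "\<And>i j. i < j \<Longrightarrow> j < length rs \<Longrightarrow> adj (rs ! i) (rs ! j) \<Longrightarrow> j = Suc i"
    using shortest_walk[OF conn_minus[OF uV], of "{w}" "{w'}"] wV uwn
    by (metis Diff_iff Int_iff emptyE singletonD singletonI)
  have sr: "adj (rs ! i) (rs ! Suc i)" if "Suc i < length rs" for i
    using rs(1) that unfolding walk_def by (auto simp: successively_conv_nth)
  have n3: "3 \<le> length rs"
  proof (rule ccontr)
    assume "\<not> 3 \<le> length rs"
    then consider "rs = []" | x where "rs = [x]" | x y where "rs = [x, y]"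
      by (cases rs; cases "tl rs"; cases "tl (tl rs)") auto
    then show False using rs(1) ww' wn unfolding walk_def by cases auto
  qed
  define n where "n = length rs"
  have ne: "rs \<noteq> []" using n3 by auto
  have rs0: "rs ! 0 = w" and rsl: "rs ! (n - 1) = w'" and rsV: "set rs \<subseteq> V - {u}"
    using rs(1) ne unfolding walk_def n_def by (auto simp: hd_conv_nth last_conv_nth)
  have gap: "\<exists>k q. icyc k q" if ij: "i + 2 \<le> j" "j < n" and P: "adj u (rs ! i)" "adj u (rs ! j)"
    and no: "\<And>l. i < l \<Longrightarrow> l < j \<Longrightarrow> \<not> adj u (rs ! l)" for i j
  proof -
    define L where "L = u # take (Suc j - i) (drop i rs)"
    have len: "length L = j - i + 2" using ij unfolding L_def n_def by auto
    have L0: "L ! 0 = u" and LS: "\<And>m. m \<le> j - i \<Longrightarrow> L ! Suc m = rs ! (i + m)"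
      using ij unfolding L_def n_def by auto
    have sub: "set (take (Suc j - i) (drop i rs)) \<subseteq> set rs" by (meson order_trans set_drop_subset set_take_subset)
    have "icyc (length L) (\<lambda>i. L ! nat (i mod int (length L)))"
    proof (rule icyc_of_list)
      show "4 \<le> length L" using len ij by simp
      show "distinct L" using sub rsV rs(2) unfolding L_def by (auto simp: distinct_take distinct_drop)
      show "set L \<subseteq> V" using sub rsV uV unfolding L_def by auto
      fix a b assume ab: "a < b" "b < length L"
      then obtain b' where b': "b = Suc b'" "b' \<le> j - i" using len by (cases b) auto
      show "adj (L ! a) (L ! b) \<longleftrightarrow> b = Suc a \<or> a = 0 \<and> b = length L - 1"
      proof (cases a)
        case 0
        have "adj u (rs ! (i + b')) \<longleftrightarrow> b' = 0 \<or> b' = j - i"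
        proof
          assume ad: "adj u (rs ! (i + b'))"
          show "b' = 0 \<or> b' = j - i"
          proof (rule ccontr)
            assume "\<not> (b' = 0 \<or> b' = j - i)"
            then have "i < i + b'" "i + b' < j" using b'(2) ij(1) by linarith+
            then show False using no ad by blast
          qed
        next
          assume "b' = 0 \<or> b' = j - i"
          then show "adj u (rs ! (i + b'))" using P ij by auto
        qed
        then show ?thesis using 0 b' L0 LS[OF b'(2)] len by auto
      next
        case (Suc a')
        have a': "a' < b'" using Suc ab b' by simp
        have "adj (rs ! (i + a')) (rs ! (i + b')) \<longleftrightarrow> b' = Suc a'"
          using rs(3)[of "i + a'" "i + b'"] sr[of "i + a'"] a' b' ij unfolding n_def by auto
        then show ?thesis using Suc b' a' LS[of a'] LS[of b'] by auto
      qed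
    qed
    then show ?thesis by blast
  qed
  have first: "\<exists>j. i < j \<and> j < n \<and> adj u (rs ! j) \<and> (\<forall>l. i < l \<and> l < j \<longrightarrow> \<not> adj u (rs ! l))" if "i < n - 1" for i
  proof -
    define P where "P j \<longleftrightarrow> i < j \<and> j < n \<and> adj u (rs ! j)" for j
    have "P (n - 1)" using that uw' rsl by (auto simp: P_def)
    from exists_least_iff[THEN iffD1, OF exI[of P, OF this]]
    obtain j where "P j" "\<And>l. l < j \<Longrightarrow> \<not> P l" by blast
    then show ?thesis unfolding P_def by (intro exI[of _ j]) (meson less_trans)
  qed
  obtain j where j: "0 < j" "j < n" "adj u (rs ! j)" "\<And>l. 0 < l \<Longrightarrow> l < j \<Longrightarrow> \<not> adj u (rs ! l)"
    using first[of 0] n3 unfolding n_def by auto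
  show ?thesis
  proof (cases "j = 1")
    case False
    then show ?thesis using gap[of 0 j] j uw rs0 by auto
  next
    case True
    obtain l where l: "1 < l" "l < n" "adj u (rs ! l)" "\<And>m. 1 < m \<Longrightarrow> m < l \<Longrightarrow> \<not> adj u (rs ! m)"
    proof -
      have "1 < n - 1" using n3 unfolding n_def by linarith
      from first[OF this] show ?thesis using that by blast
    qed
    show ?thesis
    proof (cases "l = 2")
      case False
      then show ?thesis using gap[of 1 l] l j True by auto
    next
      case 2: True
      have "Suc 0 < length rs" "Suc 1 < length rs" "2 < length rs" using n3 by linarith+
      note lens = this
      have 01: "adj (rs ! 1) (rs ! 0)" using adj_sym[OF sr[OF lens(1)]] by simp
      have 12: "adj (rs ! 1) (rs ! 2)" using sr[OF lens(2)] by (simp add: numeral_2_eq_2)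
      have 02: "\<not> adj (rs ! 0) (rs ! 2)" using rs(3)[OF _ lens(3), of 0] by fastforce
      have n02: "rs ! 0 \<noteq> rs ! 2"
        using nth_eq_iff_index_eq[OF rs(2) _ lens(3), of 0] ne by simp
      have u: "adj u (rs ! 1)" "adj u (rs ! 0)" "adj u (rs ! 2)"
        using uw rs0 j(3) True l(3) 2 by simp_all
      from no_diamond[OF u 01 12 02 n02] show ?thesis ..
    qed
  qed
qed

lemma F_total:
  assumes u: "u \<in> V"
  shows "(\<Sum>y\<in>S u. F u y) = (\<Sum>w\<in>V. \<mu> u w)"
proof -
  obtain c where st: "St u c" using St_exists[OF u] by blast
  have "(\<Sum>y\<in>S u. F u y) = (\<Sum>y\<in>S u. \<Sum>w\<in>V. if adj u w \<and> \<tau> w u (c w) = y then \<mu> u w else 0)"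
    by (intro sum.cong refl St_sum[OF st])
  also have "\<dots> = (\<Sum>w\<in>V. \<Sum>y\<in>S u. if adj u w \<and> \<tau> w u (c w) = y then \<mu> u w else 0)"
    by (rule sum.swap)
  also have "\<dots> = (\<Sum>w\<in>V. \<mu> u w)"
  proof (intro sum.cong refl)
    fix w
    show "(\<Sum>y\<in>S u. if adj u w \<and> \<tau> w u (c w) = y then \<mu> u w else 0) = \<mu> u w"
    proof (cases "adj u w")
      case True
      then have "(\<Sum>y\<in>S u. if adj u w \<and> \<tau> w u (c w) = y then \<mu> u w else 0) = (\<Sum>y\<in>S u. if \<tau> w u (c w) = y then \<mu> u w else 0)"
        by simp
      then show ?thesis using St_seen[OF st True] finS[OF u] by simp
    qed simp
  qed
  finally show ?thesis .
qed

text \<open>Neighbours of the hole that show different colours have equal multiplicities by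
  \<open>triangle_\<mu>\<close>. Two neighbours that show the same colour are both compared with a
  third one that shows another.\<close>

lemma complete_const:
  assumes comp: "\<And>u v. u \<in> V \<Longrightarrow> v \<in> V \<Longrightarrow> u \<noteq> v \<Longrightarrow> adj u v"
  obtains t where "0 < t" "\<And>u v. u \<in> V \<Longrightarrow> v \<in> V \<Longrightarrow> u \<noteq> v \<Longrightarrow> \<mu> u v = t"
proof -
  have loc: "\<mu> u w = \<mu> u w'" if u: "u \<in> V" and w: "w \<in> V" "w \<noteq> u" and w': "w' \<in> V" "w' \<noteq> u" for u w w'
  proof -
    obtain c where st: "St u c" using St_exists[OF u] by blast
    have tri: "\<mu> u x = \<mu> u y" if "x \<in> V" "y \<in> V" "x \<noteq> u" "y \<noteq> u" "\<tau> x u (c x) \<noteq> \<tau> y u (c y)" for x y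
      using that by (intro triangle_\<mu>[OF _ _ _ st]) (auto intro!: comp u)
    show ?thesis
    proof (cases "\<tau> w u (c w) = \<tau> w' u (c w')")
      case True
      obtain z where z: "adj u z" "\<tau> z u (c z) \<noteq> \<tau> w u (c w)" using mixed[OF st] .
      then have "z \<in> V" "z \<noteq> u" using adj_V adj_neq by blast+
      then show ?thesis using tri[of z w] tri[of z w'] z True w w' by metis
    next
      case False
      then show ?thesis using tri[OF w(1) w'(1) w(2) w'(2)] by blast
    qed
  qed
  obtain u where u: "u \<in> V" using conn unfolding conn_def by blast
  obtain v where v: "v \<in> V" "v \<noteq> u" using conn_minus[OF u] unfolding conn_def by blast
  have "\<mu> x y = \<mu> u v" if xy: "x \<in> V" "y \<in> V" "x \<noteq> y" for x y
  proof (cases "x = u")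
    case True
    then show ?thesis using loc[of u y v] xy v u by auto
  next
    case False
    then have "\<mu> x y = \<mu> x u" using loc[of x y u] xy u by auto
    also have "\<dots> = \<mu> u v" using loc[of u x v] \<mu>_sym[of x u] xy u v False by auto
    finally show ?thesis .
  qed
  then show ?thesis using that comp[OF u v(1)] v by metis
qed

text \<open>Shifting the hole from \<open>u\<close> to \<open>w\<close> gives sums that agree term
  by term: flat triangles match the contributions of the vertices other than \<open>u\<close> and
  \<open>w\<close>, and the term of \<open>w\<close> at \<open>u\<close> becomes the term of
  \<open>u\<close> at \<open>w\<close>.\<close>

lemma complete_F:
  assumes t: "\<And>u v. u \<in> V \<Longrightarrow> v \<in> V \<Longrightarrow> u \<noteq> v \<Longrightarrow> \<mu> u v = t" and t0: "0 < t"
    and u: "u \<in> V" and w: "w \<in> V" "u \<noteq> w" and y: "y \<in> S u"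
  shows "F w (\<tau> u w y) = F u y"
proof -
  have comp: "adj u v" if "u \<in> V" "v \<in> V" "u \<noteq> v" for u v using t[OF that] t0 by simp
  obtain c where st: "St u c" using St_exists[OF u] by blast
  have uw: "adj u w" "adj w u" using comp u w by auto
  let ?c = "c(u := \<tau> w u (c w))"
  have st': "St w ?c" using St_shift[OF st uw(1)] .
  have cw: "c w \<in> S w" using St_nbr[OF st uw(1)] .
  have "F u y = (\<Sum>v\<in>V. if adj u v \<and> \<tau> v u (c v) = y then \<mu> u v else 0)" using St_sum[OF st y] .
  also have "\<dots> = (if \<tau> w u (c w) = y then t else 0) + (\<Sum>v\<in>V - {u} - {w}. if adj u v \<and> \<tau> v u (c v) = y then \<mu> u v else 0)"
    using finV u w uw(1) t[OF u w(1) w(2)] by (simp add: sum.remove[of V u] sum.remove[of "V - {u}" w] \<mu>_irrefl)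
  also have "(\<Sum>v\<in>V - {u} - {w}. if adj u v \<and> \<tau> v u (c v) = y then \<mu> u v else 0)
    = (\<Sum>v\<in>V - {w} - {u}. if adj w v \<and> \<tau> v w (?c v) = \<tau> u w y then \<mu> w v else 0)"
  proof (rule sum.cong)
    fix v assume v: "v \<in> V - {w} - {u}"
    then have "\<tau> v w (c v) = \<tau> u w (\<tau> v u (c v))"
      using triangle_flat[of w u v "c v"] comp u w St_in[OF st] by auto
    then have "\<tau> v w (c v) = \<tau> u w y \<longleftrightarrow> \<tau> v u (c v) = y"
      using \<tau>_eq_iff[OF uw(1) _ y] \<tau>_in[of v u "c v"] comp u v St_in[OF st] by auto
    then show "(if adj u v \<and> \<tau> v u (c v) = y then \<mu> u v else 0) = (if adj w v \<and> \<tau> v w (?c v) = \<tau> u w y then \<mu> w v else 0)"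
      using v t[of u v] t[of w v] u w by auto
  qed auto
  also have "(if \<tau> w u (c w) = y then t else 0) = (if adj w u \<and> \<tau> u w (?c u) = \<tau> u w y then \<mu> w u else 0)"
    using \<tau>_eq_iff[OF uw(1) _ y] \<tau>_in[OF uw(2) cw] uw t[of w u] u w by auto
  also have "\<dots> + (\<Sum>v\<in>V - {w} - {u}. if adj w v \<and> \<tau> v w (?c v) = \<tau> u w y then \<mu> w v else 0)
    = (\<Sum>v\<in>V. if adj w v \<and> \<tau> v w (?c v) = \<tau> u w y then \<mu> w v else 0)"
    using finV u w by (simp add: sum.remove[of V w] sum.remove[of "V - {w}" u] \<mu>_irrefl)
  also have "\<dots> = F w (\<tau> u w y)" using St_sum[OF st' \<tau>_in[OF uw(1) y]] by simp
  finally show ?thesis by simp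
qed

lemma complete_dvd_F:
  assumes t: "\<And>u v. u \<in> V \<Longrightarrow> v \<in> V \<Longrightarrow> u \<noteq> v \<Longrightarrow> \<mu> u v = t" and u: "u \<in> V" and y: "y \<in> S u"
  shows "t dvd F u y"
proof -
  obtain c where st: "St u c" using St_exists[OF u] by blast
  show ?thesis unfolding St_sum[OF st y]
    using t[OF u] adj_neq by (intro dvd_sum) auto
qed

lemma icyc_nbr:
  assumes q: "icyc k q" and "adj (q m) w"
  shows "w = q (m + 1) \<or> w = q (m - 1)"
proof -
  obtain i where i: "w = q i" using icyc_spanning[OF q] adj_V[OF assms(2)] by auto
  then have "int k dvd i - m - 1 \<or> int k dvd m - i - 1" using assms unfolding icyc_def by auto
  moreover have "i - m - 1 = i - (m + 1)" "m - i - 1 = m - 1 - i" by auto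
  ultimately show ?thesis
    using icyc_eq[OF q, of i "m + 1"] icyc_eq[OF q, of "m - 1" i] i by metis
qed

lemma icyc_seen:
  assumes q: "icyc k q" and st: "St (q m) c"
  shows "S (q m) = {\<tau> (q (m + 1)) (q m) (c (q (m + 1))), \<tau> (q (m - 1)) (q m) (c (q (m - 1)))}"
proof
  show "S (q m) \<subseteq> {\<tau> (q (m + 1)) (q m) (c (q (m + 1))), \<tau> (q (m - 1)) (q m) (c (q (m - 1)))}"
  proof
    fix y assume "y \<in> S (q m)"
    from all_seen[OF st this] obtain w where "adj (q m) w" "\<tau> w (q m) (c w) = y" .
    then show "y \<in> {\<tau> (q (m + 1)) (q m) (c (q (m + 1))), \<tau> (q (m - 1)) (q m) (c (q (m - 1)))}"
      using icyc_nbr[OF q] by blast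
  qed
  show "{\<tau> (q (m + 1)) (q m) (c (q (m + 1))), \<tau> (q (m - 1)) (q m) (c (q (m - 1)))} \<subseteq> S (q m)"
    using St_seen[OF st, of "q (m + 1)"] St_seen[OF st, of "q (m - 1)"] icyc_adj(1)[OF q, of m]
      icyc_adj(2)[OF q, of "m - 1"] by auto
qed

lemma icyc_card:
  assumes q: "icyc k q"
  shows "card (S (q m)) = 2"
proof -
  have "q m \<in> V" using q unfolding icyc_def by auto
  then obtain c where st: "St (q m) c" using St_exists by blast
  show ?thesis unfolding icyc_seen[OF q st] using icyc_seen_neq[OF q st] by simp
qed

text \<open>The two sides of a hole show different colours, so the second conclusion of
  \<open>rotate\<close> equates the multiplicities of consecutive edges.\<close>

lemma icyc_\<mu>:
  assumes q: "icyc k q"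
  shows "\<mu> (q m) (q (m + 1)) = \<mu> (q 0) (q 1)"
proof -
  have step: "\<mu> (q m) (q (m + 1)) = \<mu> (q (m - 1)) (q m)" for m
  proof -
    have "q m \<in> V" using q unfolding icyc_def by auto
    then obtain c where st: "St (q m) c" using St_exists by blast
    have "\<mu> (q m) (q (m + 1)) = \<mu> (q m) (q (m - 1))"
      using icyc_rotate0(2)[OF icyc_shift[OF q, of m], of c] st icyc_seen_neq[OF q st] by (simp add: add.commute)
    then show ?thesis by (simp add: \<mu>_sym)
  qed
  show ?thesis
  proof (induction m rule: int_induct[where k = 0])
    case (step1 i)
    then show ?case using step[of "i + 1"] by simp
  next
    case (step2 i)
    then show ?case using step[of i] by simp
  qed simp
qed

text \<open>Only the two cycle neighbours contribute, and they show different colours, so each value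
  is a single multiplicity.\<close>

lemma icyc_F:
  assumes q: "icyc k q" and y: "y \<in> S (q m)"
  shows "F (q m) y = \<mu> (q 0) (q 1)"
proof -
  have "q m \<in> V" using q unfolding icyc_def by auto
  then obtain c where st: "St (q m) c" using St_exists by blast
  have a: "adj (q m) (q (m + 1))" "adj (q m) (q (m - 1))"
    using icyc_adj(1)[OF q, of m] icyc_adj(2)[OF q, of "m - 1"] by auto
  have mu: "\<mu> (q m) (q (m + 1)) = \<mu> (q 0) (q 1)" "\<mu> (q m) (q (m - 1)) = \<mu> (q 0) (q 1)"
    using icyc_\<mu>[OF q, of m] icyc_\<mu>[OF q, of "m - 1"] \<mu>_sym[of "q m" "q (m - 1)"] by auto
  obtain w where w: "w = q (m + 1) \<or> w = q (m - 1)" "\<tau> w (q m) (c w) = y"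
    using y icyc_seen[OF q st] by auto
  have "(if adj (q m) v \<and> \<tau> v (q m) (c v) = y then \<mu> (q m) v else 0) = (if v = w then \<mu> (q 0) (q 1) else 0)" for v
  proof (cases "v = w")
    case True
    then show ?thesis using w a mu by auto
  next
    case False
    then have "\<not> (adj (q m) v \<and> \<tau> v (q m) (c v) = y)"
      using icyc_nbr[OF q, of m v] w icyc_seen_neq[OF q st] by metis
    then show ?thesis using False by auto
  qed
  then have "F (q m) y = (\<Sum>v\<in>V. if v = w then \<mu> (q 0) (q 1) else 0)"
    using St_sum[OF st y] by simp
  also have "\<dots> = \<mu> (q 0) (q 1)" using finV w a adj_V by auto
  finally show ?thesis .
qed

text \<open>A state with hole \<open>q 0\<close> and colour \<open>x 1\<close> at \<open>q 1\<close>
  agrees with the transported sequence \<open>x\<close> exactly at the odd positions: it disagrees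
  at \<open>q 2\<close> because the sides of the hole differ, and \<open>icyc_alt0\<close> advances
  by two. Read off at the other side \<open>q (- 1)\<close>, this decides whether \<open>x k\<close>
  is the colour shown there or the one shown by \<open>q 1\<close>.\<close>

lemma icyc_holonomy:
  assumes q: "icyc k q" and x: "\<And>i. x i \<in> S (q (int i))"
    and step: "\<And>i. x (Suc i) = \<tau> (q (int i)) (q (int i + 1)) (x i)"
  shows "x (Suc k) = x 1 \<longleftrightarrow> odd k"
proof -
  have k: "4 \<le> k" and qV: "\<And>i. q i \<in> V" using q unfolding icyc_def by auto
  have n10: "q 0 \<noteq> q 1" using icyc_neq[OF q, of 0 1] k by auto
  obtain c where st: "St (q 0) c" and c1: "c (q 1) = x 1"
    using St_ex[OF qV qV n10, of "x 1"] x[of 1] by auto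
  have bk: "\<tau> (q (int i + 1)) (q (int i)) (x (Suc i)) = x i" for i
    using step[of i] \<tau>_inv[OF icyc_adj(1)[OF q] x[of i]] by simp
  have cS: "c (q (int i)) \<in> S (q (int i))" if "0 < i" "i < k" for i
    using St_in[OF st qV] icyc_neq[OF q, of "int i" 0] that by auto
  define A B where "A = \<tau> (q 1) (q 0) (c (q 1))" and "B = \<tau> (q (-1)) (q 0) (c (q (-1)))"
  have AB: "A \<noteq> B" unfolding A_def B_def using icyc_seen_neq0[OF q st] .
  have P: "c (q (int i)) = x i \<longleftrightarrow> odd i" if "0 < i" "i < k" for i
    using that
  proof (induction i rule: less_induct)
    case (less i)
    consider "i = 1" | "i = 2" | j where "i = j + 2" "0 < j"
    proof -
      have "i = 1 \<or> i = 2 \<or> i = (i - 2) + 2 \<and> 0 < i - 2" using less.prems by linarith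
      then show ?thesis using that by blast
    qed
    then show ?case
    proof cases
      case 1
      then show ?thesis using c1 by simp
    next
      case 2
      have "\<tau> (q 1) (q 0) (\<tau> (q 2) (q 1) (c (q 2))) = B" unfolding B_def using icyc_rotate0(1)[OF q st] .
      then have "\<tau> (q 2) (q 1) (c (q 2)) \<noteq> x 1" using AB c1 unfolding A_def by auto
      then have "c (q 2) \<noteq> x 2" using bk[of 1] by (auto simp: numeral_2_eq_2)
      then show ?thesis using 2 by simp
    next
      case (3 j)
      have alt: "c (q (int j)) = \<tau> (q (int j + 1)) (q (int j)) (\<tau> (q (int j + 2)) (q (int j + 1)) (c (q (int j + 2))))"
        using 3 less.prems by (intro icyc_alt0[OF q st]) auto
      have a: "adj (q (int j + 1)) (q (int j))" "adj (q (int j + 2)) (q (int j + 1))"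
        using icyc_adj(2)[OF q, of "int j"] icyc_adj(2)[OF q, of "int j + 1"] by (auto simp: add.assoc)
      have xj: "x j = \<tau> (q (int j + 1)) (q (int j)) (\<tau> (q (int j + 2)) (q (int j + 1)) (x (j + 2)))"
        using bk[of j] bk[of "Suc j"] by (simp add: add.commute add.left_commute)
      have i2: "int i = int j + 2" using 3 by simp
      have S2: "c (q (int j + 2)) \<in> S (q (int j + 2))" "x (j + 2) \<in> S (q (int j + 2))"
        using cS[of i] x[of i] less.prems i2 3 by (auto simp: add.commute)
      have "c (q (int j)) = x j \<longleftrightarrow> c (q (int j + 2)) = x (j + 2)"
        unfolding alt xj using \<tau>_eq_iff[OF a(1)] \<tau>_eq_iff[OF a(2)] \<tau>_in[OF a(2)] S2 by simp
      then show ?thesis using less.IH[of j] 3 less.prems by (simp add: add.commute)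
    qed
  qed
  have e: "q (int k) = q 0" "q (int k - 1) = q (-1)" "q (int k + 1) = q 1"
    using icyc_eq[OF q, of "int k" 0] icyc_eq[OF q, of "int k - 1" "-1"] icyc_eq[OF q, of "int k + 1" 1] by auto
  have ik: "int (k - 1) = int k - 1" "Suc (k - 1) = k" using k by auto
  have a1: "adj (q (-1)) (q 0)" using icyc_adj(1)[OF q, of "-1"] by simp
  have a0: "adj (q 0) (q 1)" using icyc_adj(1)[OF q, of 0] by simp
  have xk: "x k = \<tau> (q (-1)) (q 0) (x (k - 1))" using step[of "k - 1"] ik e by simp
  have "B = x k \<longleftrightarrow> c (q (int (k - 1))) = x (k - 1)"
    unfolding B_def xk using \<tau>_eq_iff[OF a1] cS[of "k - 1"] x[of "k - 1"] ik e k by simp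
  also have "\<dots> \<longleftrightarrow> even k" using P[of "k - 1"] k by simp
  finally have Bk: "B = x k \<longleftrightarrow> even k" .
  have S0: "S (q 0) = {A, B}" using icyc_seen[OF q, of 0 c] st unfolding A_def B_def by simp
  then have "x k \<in> {A, B}" using x[of k] e by simp
  moreover have "x (Suc k) = x 1 \<longleftrightarrow> x k = A"
  proof -
    have "x (Suc k) = \<tau> (q 0) (q 1) (x k)" using step[of k] e by simp
    moreover have "x 1 = \<tau> (q 0) (q 1) A" unfolding A_def c1 using \<tau>_inv[of "q 1" "q 0" "x 1"] a0 adj_sym x[of 1] by simp
    ultimately show ?thesis using \<tau>_eq_iff[OF a0, of "x k" A] x[of k] e S0 by simp
  qed
  ultimately show ?thesis using Bk AB by auto
qed

end

section \<open>Twin classes\<close>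

text \<open>Here a colour may be adjacent to several colours of a neighbouring fibre, so a move of
  the hole is a choice of \<open>y\<close> and not a function. In the application \<open>S v\<close>
  consists of the colours in \<open>X v\<close> with positive \<open>f\<close>, and
  \<open>St u\<close> of the good colourings of \<open>V - {u}\<close>; \<open>row\<close> is an
  equation because of tightness.\<close>

locale hole_cover =
  fixes V :: "'a set" and \<mu> :: "'a \<Rightarrow> 'a \<Rightarrow> nat" and S :: "'a \<Rightarrow> 'b set"
    and a :: "'b \<Rightarrow> 'b \<Rightarrow> nat" and f :: "'b \<Rightarrow> nat" and St :: "'a \<Rightarrow> ('a \<Rightarrow> 'b) \<Rightarrow> bool"
  assumes finV: "finite V" and \<mu>_sym: "\<mu> u v = \<mu> v u" and \<mu>_irrefl: "\<mu> v v = 0"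
    and \<mu>_V: "0 < \<mu> u v \<Longrightarrow> u \<in> V"
    and conn: "conn (\<lambda>u v. 0 < \<mu> u v) V"
    and conn_minus: "v \<in> V \<Longrightarrow> conn (\<lambda>u v. 0 < \<mu> u v) (V - {v})"
    and finS: "u \<in> V \<Longrightarrow> finite (S u)"
    and disjS: "disjoint_family_on S V"
    and a_sym: "a x y = a y x"
    and row: "u \<in> V \<Longrightarrow> w \<in> V \<Longrightarrow> u \<noteq> w \<Longrightarrow> x \<in> S w \<Longrightarrow> (\<Sum>y\<in>S u. a x y) = \<mu> w u"
    and St_hole: "St u c \<Longrightarrow> u \<in> V"
    and St_in: "St u c \<Longrightarrow> w \<in> V \<Longrightarrow> w \<noteq> u \<Longrightarrow> c w \<in> S w"
    and St_sum: "St u c \<Longrightarrow> y \<in> S u \<Longrightarrow> f y = (\<Sum>w\<in>V - {u}. a (c w) y)"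
    and f_pos: "u \<in> V \<Longrightarrow> y \<in> S u \<Longrightarrow> 0 < f y"
    and St_shift: "St u c \<Longrightarrow> w \<in> V \<Longrightarrow> w \<noteq> u \<Longrightarrow> y \<in> S u \<Longrightarrow> 0 < a (c w) y \<Longrightarrow> St w (c(u := y))"
    and St_ex: "u \<in> V \<Longrightarrow> w \<in> V \<Longrightarrow> u \<noteq> w \<Longrightarrow> x \<in> S w \<Longrightarrow> \<exists>c. St u c \<and> c w = x"
begin

abbreviation adj :: "'a \<Rightarrow> 'a \<Rightarrow> bool" where "adj u v \<equiv> 0 < \<mu> u v"

lemma adj_sym: "adj u v \<Longrightarrow> adj v u"
  by (simp add: \<mu>_sym)

lemma adj_neq: "adj u v \<Longrightarrow> u \<noteq> v"
  using \<mu>_irrefl by auto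

lemma adj_V: "adj u v \<Longrightarrow> u \<in> V" "adj u v \<Longrightarrow> v \<in> V"
  using \<mu>_V adj_sym by blast+

lemma a_zero: "u \<in> V \<Longrightarrow> w \<in> V \<Longrightarrow> u \<noteq> w \<Longrightarrow> \<not> adj w u \<Longrightarrow> x \<in> S w \<Longrightarrow> y \<in> S u \<Longrightarrow> a x y = 0"
  using row[of u w x] finS by simp

lemma a_ex:
  assumes "adj w u" "x \<in> S w"
  obtains y where "y \<in> S u" "0 < a x y"
proof -
  have "(\<Sum>y\<in>S u. a x y) \<noteq> 0" using row[of u w x] assms adj_V adj_neq by (metis less_numeral_extra(3))
  then show ?thesis using that by (metis gr0I sum.neutral)
qed

text \<open>With the hole at \<open>u\<close> and colour \<open>x\<close> at \<open>w\<close>, the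
  hole can move to \<open>w\<close> with \<open>u\<close> taking either \<open>y\<close> or
  \<open>y'\<close>. The two resulting states differ only at \<open>u\<close>, so tightness at the
  colour \<open>z\<close> of \<open>w\<close> gives equal contributions of \<open>y\<close> and
  \<open>y'\<close>.\<close>

lemma shared_row:
  assumes V: "u \<in> V" "w \<in> V" "u \<noteq> w" and x: "x \<in> S w" and y: "y \<in> S u" "0 < a x y"
    and y': "y' \<in> S u" "0 < a x y'" and z: "z \<in> S w"
  shows "a z y = a z y'"
proof -
  obtain c where c: "St u c" "c w = x" using St_ex V x by blast
  have "f z = a y'' z + (\<Sum>v\<in>V - {w} - {u}. a (c v) z)" if "y'' \<in> S u" "0 < a x y''" for y''
  proof -
    have "St w (c(u := y''))" using St_shift[OF c(1)] V c(2) that by auto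
    from St_sum[OF this z] have "f z = (\<Sum>v\<in>V - {w}. a ((c(u := y'')) v) z)" .
    also have "\<dots> = a y'' z + (\<Sum>v\<in>V - {w} - {u}. a ((c(u := y'')) v) z)"
      using V finV by (subst sum.remove[of _ u]) auto
    also have "(\<Sum>v\<in>V - {w} - {u}. a ((c(u := y'')) v) z) = (\<Sum>v\<in>V - {w} - {u}. a (c v) z)"
      by (intro sum.cong) auto
    finally show ?thesis .
  qed
  from this[OF y] this[OF y'] show ?thesis using a_sym by (metis add_right_cancel)
qed

lemma hole_walk:
  assumes "St u c" "distinct (u # q # qs)" "successively adj (q # qs)" "q \<in> V" "y \<in> S u" "0 < a (c q) y"
  shows "\<exists>c'. St (last (q # qs)) c' \<and> c' u = y \<and> (\<forall>w. w \<notin> set (u # q # qs) \<longrightarrow> c' w = c w)"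
  using assms
proof (induction qs arbitrary: u c q y)
  case Nil
  define d where "d = c(u := y)"
  have "q \<noteq> u" using Nil.prems(2) by auto
  from St_shift[OF Nil.prems(1,4) this Nil.prems(5,6)] have "St q d" unfolding d_def .
  moreover have "d u = y" "\<And>w. w \<noteq> u \<Longrightarrow> d w = c w" unfolding d_def by auto
  ultimately show ?case by (intro exI[of _ d]) simp
next
  case (Cons p ps)
  define d where "d = c(u := y)"
  have d: "d u = y" "\<And>w. w \<noteq> u \<Longrightarrow> d w = c w" unfolding d_def by auto
  have "q \<noteq> u" using Cons.prems(2) by auto
  from St_shift[OF Cons.prems(1,4) this Cons.prems(5,6)] have st: "St q d" unfolding d_def .
  have pq: "adj q p" and pqu: "p \<noteq> q" "p \<noteq> u" using Cons.prems(2,3) by auto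
  have pV: "p \<in> V" using adj_V(2)[OF pq] .
  have "d p \<in> S p" using St_in[OF st pV pqu(1)] .
  then obtain y' where y': "y' \<in> S q" "0 < a (d p) y'" using a_ex[OF adj_sym[OF pq]] by blast
  have dist: "distinct (q # p # ps)" and succ: "successively adj (p # ps)" using Cons.prems(2,3) by auto
  from Cons.IH[OF st dist succ pV y'] obtain c' where c': "St (last (p # ps)) c'" "c' q = y'"
    "\<And>w. w \<notin> set (q # p # ps) \<Longrightarrow> c' w = d w" by blast
  show ?case
  proof (intro exI[of _ c'] conjI allI impI)
    show "St (last (q # p # ps)) c'" using c'(1) by simp
    show "c' u = y" using c'(3)[of u] Cons.prems(2) d by auto
    show "c' w = c w" if "w \<notin> set (u # q # p # ps)" for w using c'(3)[of w] that d by auto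
  qed
qed

text \<open>As in \<open>hole_system\<close>, only the summands of \<open>hd ps\<close> and
  \<open>last ps\<close> can change in the equation of a colour at \<open>u\<close>. The first move
  is steered to the colour \<open>y\<close>, and at the end \<open>last ps\<close> receives a colour
  adjacent to \<open>y\<close>.\<close>

lemma rotate:
  assumes st: "St u c" and dist: "distinct (u # ps)" and succ: "successively adj ps"
    and len: "2 \<le> length ps" and hd: "adj u (hd ps)" and la: "adj u (last ps)"
    and chord: "\<And>w. w \<in> set ps \<Longrightarrow> adj u w \<Longrightarrow> w = hd ps \<or> w = last ps"
    and psV: "set ps \<subseteq> V" and y: "y \<in> S u" "0 < a (c (hd ps)) y"
  shows "\<exists>c'. St u c' \<and> 0 < a (c' (last ps)) y \<and>
    (\<forall>z\<in>S u. a (c (hd ps)) z + a (c (last ps)) z = a (c' (hd ps)) z + a (c' (last ps)) z)"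
proof -
  obtain p qs where ps: "ps = p # qs" "qs \<noteq> []" using len by (cases ps; cases "tl ps") auto
  define q where "q = last ps"
  have hp: "hd ps = p" using ps by simp
  have pq: "p \<noteq> q" using dist ps last_in_set[of qs] unfolding q_def by auto
  obtain c1 where c1: "St q c1" "c1 u = y" "\<And>w. w \<notin> set (u # ps) \<Longrightarrow> c1 w = c w"
    using hole_walk[OF st, of p qs y] dist succ psV y ps unfolding q_def by auto
  have uV: "u \<in> V" using St_hole[OF st] .
  obtain z where z: "z \<in> S q" "0 < a y z" using a_ex[OF la y(1)] unfolding q_def by blast
  define c2 where "c2 = c1(q := z)"
  have uq: "u \<noteq> q" using la adj_neq unfolding q_def by blast
  have st2: "St u c2" unfolding c2_def using St_shift[OF c1(1) uV uq z(1)] c1(2) z(2) by simp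
  have pV: "p \<in> V" "q \<in> V" "p \<noteq> u" "q \<noteq> u" using psV ps uq dist unfolding q_def by auto
  have sum: "f x = a (d p) x + (a (d q) x + (\<Sum>w\<in>V - {u} - {p} - {q}. a (d w) x))" if "St u d" "x \<in> S u" for d x
  proof -
    have "f x = (\<Sum>w\<in>V - {u}. a (d w) x)" using St_sum[OF that] .
    also have "\<dots> = a (d p) x + (\<Sum>w\<in>V - {u} - {p}. a (d w) x)"
      using finV pV by (intro sum.remove) auto
    also have "(\<Sum>w\<in>V - {u} - {p}. a (d w) x) = a (d q) x + (\<Sum>w\<in>V - {u} - {p} - {q}. a (d w) x)"
      using finV pV pq by (intro sum.remove) auto
    finally show ?thesis .
  qed
  have rest: "(\<Sum>w\<in>V - {u} - {p} - {q}. a (c w) x) = (\<Sum>w\<in>V - {u} - {p} - {q}. a (c2 w) x)" if "x \<in> S u" for x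
  proof (intro sum.cong refl)
    fix w assume w: "w \<in> V - {u} - {p} - {q}"
    show "a (c w) x = a (c2 w) x"
    proof (cases "adj u w")
      case True
      then have "w \<notin> set (u # ps)" using chord[of w] w hp unfolding q_def by auto
      then show ?thesis using c1(3) w unfolding c2_def by simp
    next
      case False
      then have "\<not> adj w u" using \<mu>_sym[of u w] by simp
      then show ?thesis using a_zero[OF uV, of w _ x] w that St_in[OF st] St_in[OF st2] by auto
    qed
  qed
  have "0 < a (c2 q) y" using z(2) a_sym by (simp add: c2_def)
  moreover have "a (c p) x + a (c q) x = a (c2 p) x + a (c2 q) x" if "x \<in> S u" for x
    using sum[OF st that] sum[OF st2 that] rest[OF that] by simp
  ultimately show ?thesis using st2 hp unfolding q_def by (intro exI[of _ c2]) auto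
qed

definition common :: "'a \<Rightarrow> 'b \<Rightarrow> 'b \<Rightarrow> bool" where
  "common w y y' \<longleftrightarrow> (\<exists>x\<in>S w. 0 < a x y \<and> 0 < a x y')"

text \<open>Let \<open>x\<close> at \<open>p = hd ps\<close> be adjacent to \<open>y\<close> and
  \<open>y'\<close>, and suppose that no colour at \<open>q = last ps\<close> is. Rotating with the
  choice \<open>y\<close> puts at \<open>q\<close> a colour adjacent to \<open>y\<close> but not to
  \<open>y'\<close>. So the new colour of \<open>p\<close> is adjacent to \<open>y'\<close> and by
  \<open>shared_row\<close> has the same row as \<open>x\<close>, whence the old and the new colour
  of \<open>q\<close> have equal rows. The choice \<open>y'\<close> gives the opposite conclusion
  about the old colour of \<open>q\<close>.\<close>

lemma common_step:
  assumes uV: "u \<in> V" and dist: "distinct (u # ps)" and succ: "successively adj ps"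
    and len: "2 \<le> length ps" and hd: "adj u (hd ps)" and la: "adj u (last ps)"
    and chord: "\<And>w. w \<in> set ps \<Longrightarrow> adj u w \<Longrightarrow> w = hd ps \<or> w = last ps"
    and psV: "set ps \<subseteq> V" and y: "y \<in> S u" and y': "y' \<in> S u" and com: "common (hd ps) y y'"
  shows "common (last ps) y y'"
proof (rule ccontr)
  assume no: "\<not> common (last ps) y y'"
  define p q where "p = hd ps" and "q = last ps"
  obtain x where x: "x \<in> S p" "0 < a x y" "0 < a x y'" using com unfolding common_def p_def by blast
  have pV: "p \<in> V" "q \<in> V" "p \<noteq> u" "q \<noteq> u" using hd la adj_V adj_neq unfolding p_def q_def by blast+
  obtain c where c: "St u c" "c p = x" using St_ex[OF uV pV(1)] x pV by metis
  have same: "a r z = a r' z" if "v \<in> V" "v \<noteq> u" "r \<in> S v" "r' \<in> S v" "y0 \<in> S u" "0 < a r y0" "0 < a r' y0" "z \<in> S u" for v r r' y0 z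
    using shared_row[OF that(1) uV that(2) that(5) that(3) _ that(4) _ that(8)] that a_sym by metis
  have one: "a (c q) y1 > 0 \<and> a (c q) y2 = 0"
    if y12: "y1 \<in> S u" "y2 \<in> S u" "0 < a x y1" "0 < a x y2" "\<not> common q y1 y2" for y1 y2
  proof -
    from rotate[OF c(1) dist succ len hd la chord psV y12(1)] y12 c(2)
    obtain d where d: "St u d" "0 < a (d q) y1"
      "\<And>z. z \<in> S u \<Longrightarrow> a x z + a (c q) z = a (d p) z + a (d q) z" unfolding p_def q_def by auto
    have S: "d q \<in> S q" "d p \<in> S p" "c q \<in> S q" using St_in[OF d(1)] St_in[OF c(1)] pV by auto
    have "a (d q) y2 = 0" using y12(5) d(2) S(1) unfolding common_def by auto
    then have "0 < a (d p) y2" using d(3)[OF y12(2)] y12(4) by simp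
    then have "a x z = a (d p) z" if "z \<in> S u" for z
      using same[OF pV(1,3) x(1) S(2) y12(2) y12(4) _ that] by blast
    then have "a (c q) z = a (d q) z" if "z \<in> S u" for z using d(3)[OF that] that by simp
    then show ?thesis using d(2) \<open>a (d q) y2 = 0\<close> y12 by simp
  qed
  have "\<not> common q y y'" "\<not> common q y' y" using no unfolding q_def common_def by auto
  then show False using one[of y y'] one[of y' y] x y y' by auto
qed

text \<open>A shortest walk avoiding \<open>u\<close>, from the neighbours with a common colour to
  those without, has no neighbour of \<open>u\<close> in its interior. Together with
  \<open>u\<close> it forms a cycle to which \<open>common_step\<close> applies.\<close>

lemma common_all:
  assumes w: "adj u w" and w': "adj u w'" and y: "y \<in> S u" "y' \<in> S u" and com: "common w y y'"
  shows "common w' y y'"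
proof (rule ccontr)
  assume no: "\<not> common w' y y'"
  define K where "K = {v. adj u v \<and> common v y y'}"
  define Z where "Z = {v. adj u v \<and> \<not> common v y y'}"
  have uV: "u \<in> V" using adj_V[OF w] by simp
  have "w \<in> K \<inter> (V - {u})" "w' \<in> Z \<inter> (V - {u})"
    using w w' com no adj_V adj_neq[of u] unfolding K_def Z_def by blast+
  then have ne: "K \<inter> (V - {u}) \<noteq> {}" "Z \<inter> (V - {u}) \<noteq> {}" by auto
  obtain ps where ps: "walk adj (V - {u}) K Z ps" "distinct ps"
    "\<And>i. 0 < i \<Longrightarrow> i < length ps \<Longrightarrow> ps ! i \<notin> K" "\<And>i. Suc i < length ps \<Longrightarrow> ps ! i \<notin> Z"
    using shortest_walk[OF conn_minus[OF uV] ne] by metis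
  note pw = ps(1)[unfolded walk_def]
  have chord: "v = hd ps \<or> v = last ps" if v: "v \<in> set ps" "adj u v" for v
  proof -
    obtain i where i: "i < length ps" "ps ! i = v" using v by (auto simp: in_set_conv_nth)
    have "v \<in> K \<or> v \<in> Z" using v unfolding K_def Z_def by blast
    then have "i = 0 \<or> Suc i = length ps" using ps(3,4)[of i] i by (metis Suc_lessI gr0I)
    then show ?thesis using i pw by (metis diff_Suc_1 hd_conv_nth last_conv_nth)
  qed
  have len: "2 \<le> length ps"
  proof (rule ccontr)
    assume "\<not> 2 \<le> length ps"
    then have "hd ps = last ps" using pw by (cases ps; cases "tl ps") auto
    then show False using pw unfolding K_def Z_def by auto
  qed
  have "common (last ps) y y'"
    by (rule common_step[OF uV _ _ len _ _ chord])
      (use ps(2) pw y in \<open>auto simp: K_def Z_def\<close>)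
  then show False using pw unfolding Z_def by blast
qed

section \<open>Twin classes, their sizes and their transport\<close>

definition cls :: "'a \<Rightarrow> 'b \<Rightarrow> 'b set" where
  "cls u y = {y' \<in> S u. \<forall>w\<in>V - {u}. \<forall>z\<in>S w. a z y' = a z y}"

lemma cls_self: "y \<in> S u \<Longrightarrow> y \<in> cls u y"
  by (simp add: cls_def)

lemma cls_subset: "cls u y \<subseteq> S u"
  by (auto simp: cls_def)

lemma cls_eqI: "y' \<in> cls u y \<Longrightarrow> cls u y' = cls u y"
  by (auto simp: cls_def)

lemma cls_disjoint: "z \<in> cls u y \<Longrightarrow> z \<in> cls u y' \<Longrightarrow> cls u y = cls u y'"
  using cls_eqI by metis

text \<open>Two neighbours of \<open>x\<close> in \<open>S u\<close> have a common neighbour in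
  every adjacent fibre by \<open>common_all\<close>, hence equal multiplicities to that fibre by
  \<open>shared_row\<close>: they are twins. This makes the passage between adjacent fibres a map on
  classes.\<close>

lemma nbrs_cls:
  assumes ad: "adj w u" and x: "x \<in> S w" and y: "y \<in> S u" "0 < a x y"
  shows "{y' \<in> S u. 0 < a x y'} = cls u y"
proof
  have V: "u \<in> V" "w \<in> V" "w \<noteq> u" using ad adj_V adj_neq by blast+
  show "cls u y \<subseteq> {y' \<in> S u. 0 < a x y'}" using V x y unfolding cls_def by auto
  show "{y' \<in> S u. 0 < a x y'} \<subseteq> cls u y"
  proof
    fix y' assume y': "y' \<in> {y' \<in> S u. 0 < a x y'}"
    have "a z y' = a z y" if v: "v \<in> V - {u}" "z \<in> S v" for v z
    proof (cases "adj v u")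
      case True
      have "common w y y'" using x y y' unfolding common_def by blast
      then have "common v y y'" using common_all[OF adj_sym[OF ad] adj_sym[OF True] y(1)] y' by blast
      then obtain x' where "x' \<in> S v" "0 < a x' y" "0 < a x' y'" unfolding common_def by blast
      then show ?thesis using shared_row[OF V(1), of v x' y' y z] v y y' by auto
    next
      case False
      then show ?thesis using a_zero[OF V(1) _ _ False v(2)] v y y' by auto
    qed
    then show "y' \<in> cls u y" using y' unfolding cls_def by blast
  qed
qed

lemma a_cls:
  assumes "u \<in> V" "w \<in> V" "u \<noteq> w" "x \<in> S w" "y \<in> S u" "x' \<in> cls w x" "y' \<in> cls u y"
  shows "a x' y' = a x y"
proof -
  have "a x' y' = a x' y" using assms cls_subset[of w x] unfolding cls_def[of u] by auto
  also have "\<dots> = a y x'" by (rule a_sym)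
  also have "\<dots> = a y x" using assms unfolding cls_def[of w] by auto
  finally show ?thesis using a_sym by simp
qed

lemma a_card:
  assumes ad: "adj w u" and x: "x \<in> S w" and y: "y \<in> S u" "0 < a x y"
  shows "a x y * card (cls u y) = \<mu> w u"
proof -
  have V: "u \<in> V" "w \<in> V" "w \<noteq> u" using ad adj_V adj_neq by blast+
  have "\<mu> w u = (\<Sum>y'\<in>S u. a x y')" using row[of u w x] V x by auto
  also have "\<dots> = (\<Sum>y'\<in>{y' \<in> S u. 0 < a x y'}. a x y')"
    using finS[OF V(1)] by (intro sum.mono_neutral_right) auto
  also have "\<dots> = (\<Sum>y'\<in>cls u y. a x y)"
    unfolding nbrs_cls[OF assms] using a_cls[OF V(1,2) _ x y(1) cls_self[OF x]] V by (intro sum.cong) auto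
  finally show ?thesis by simp
qed

text \<open>By \<open>a_card\<close> from either end, both sizes give the same multiplicity
  \<open>\<mu> w u\<close> when multiplied by \<open>a x y\<close>.\<close>

lemma card_cls_eq:
  assumes ad: "adj w u" and x: "x \<in> S w" and y: "y \<in> S u" "0 < a x y"
  shows "card (cls u y) = card (cls w x)"
  using a_card[OF assms] a_card[OF adj_sym[OF ad] y(1) x] y \<mu>_sym[of u w] a_sym[of x y]
  by (metis mult_cancel1 not_gr_zero)

definition \<tau> :: "'a \<Rightarrow> 'a \<Rightarrow> 'b set \<Rightarrow> 'b set" where
  "\<tau> w u C = {y \<in> S u. \<exists>x\<in>C. 0 < a x y}"

lemma \<tau>_cls_nbrs:
  assumes ad: "adj w u" and x: "x \<in> S w"
  shows "\<tau> w u (cls w x) = {y \<in> S u. 0 < a x y}"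
proof -
  have V: "u \<in> V" "w \<in> V" "w \<noteq> u" using ad adj_V adj_neq by blast+
  have "0 < a x y" if "x' \<in> cls w x" "y \<in> S u" "0 < a x' y" for x' y
    using a_cls[OF V(1,2) _ x that(2) that(1) cls_self[OF that(2)]] V that(3) by auto
  then show ?thesis unfolding \<tau>_def using cls_self[OF x] by blast
qed

lemma \<tau>_cls:
  assumes ad: "adj w u" and x: "x \<in> S w" and y: "y \<in> S u" "0 < a x y"
  shows "\<tau> w u (cls w x) = cls u y"
  using \<tau>_cls_nbrs[OF ad x] nbrs_cls[OF assms] by simp

lemma \<tau>_cls_ex:
  assumes ad: "adj w u" and x: "x \<in> S w"
  obtains y where "y \<in> S u" "0 < a x y" "\<tau> w u (cls w x) = cls u y"
  using a_ex[OF assms] \<tau>_cls[OF assms] by metis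

text \<open>States are composed with \<open>cls\<close>. A colour at \<open>w\<close> sends all its
  \<open>\<mu> w u\<close> edges to a single class at \<open>u\<close>, so adding the tightness
  equations over a class yields \<open>St_sum\<close>; the choice of \<open>y\<close> in a shift
  does not affect the classes.\<close>

lemma quotient_hole_system:
  assumes two: "\<And>u. u \<in> V \<Longrightarrow> \<exists>x\<in>S u. \<exists>y\<in>S u. cls u x \<noteq> cls u y"
  shows "hole_system V \<mu> (\<lambda>u. cls u ` S u) \<tau> (\<lambda>u C. \<Sum>y\<in>C. f y)
    (\<lambda>u C. \<exists>c. St u c \<and> C = (\<lambda>w. cls w (c w)))"
proof
  show "\<tau> u v C \<in> cls v ` S v" if ad: "adj u v" and C: "C \<in> cls u ` S u" for u v C
  proof -
    obtain x where x: "x \<in> S u" "C = cls u x" using C by blast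
    from \<tau>_cls_ex[OF ad x(1)] show ?thesis using x(2) by (metis imageI)
  qed
  show "\<tau> v u (\<tau> u v C) = C" if ad: "adj u v" and C: "C \<in> cls u ` S u" for u v C
  proof -
    obtain x where x: "x \<in> S u" "C = cls u x" using C by blast
    obtain y where y: "y \<in> S v" "0 < a x y" "\<tau> u v C = cls v y" using \<tau>_cls_ex[OF ad x(1)] x(2) by metis
    then show ?thesis using \<tau>_cls[OF adj_sym[OF ad] y(1) x(1)] x a_sym by metis
  qed
  show "\<exists>c. St w c \<and> C(u := \<tau> w u (C w)) = (\<lambda>w. cls w (c w))"
    if C: "\<exists>c. St u c \<and> C = (\<lambda>w. cls w (c w))" and ad: "adj u w" for u C w
  proof -
    obtain c where c: "St u c" "C = (\<lambda>w. cls w (c w))" using C by blast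
    have V: "w \<in> V" "w \<noteq> u" using adj_V(2)[OF ad] adj_neq[OF ad] by auto
    have cw: "c w \<in> S w" using St_in[OF c(1) V] .
    obtain y where y: "y \<in> S u" "0 < a (c w) y" "\<tau> w u (cls w (c w)) = cls u y"
      using \<tau>_cls_ex[OF adj_sym[OF ad] cw] by metis
    have "St w (c(u := y))" using St_shift[OF c(1) V y(1,2)] .
    moreover have "C(u := \<tau> w u (C w)) = (\<lambda>w. cls w ((c(u := y)) w))"
      using c(2) y(3) by (intro ext) simp
    ultimately show ?thesis by blast
  qed
  show "(\<Sum>y\<in>C. f y) = (\<Sum>w\<in>V. if adj u w \<and> \<tau> w u (D w) = C then \<mu> u w else 0)"
    if st: "\<exists>c. St u c \<and> D = (\<lambda>w. cls w (c w))" and C: "C \<in> cls u ` S u" for u D C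
  proof -
    obtain c where c: "St u c" "D = (\<lambda>w. cls w (c w))" using st by blast
    obtain y0 where y0: "y0 \<in> S u" "C = cls u y0" using C by blast
    have uV: "u \<in> V" using St_hole[OF c(1)] .
    have "(\<Sum>y\<in>C. f y) = (\<Sum>y\<in>C. \<Sum>w\<in>V - {u}. a (c w) y)"
      using St_sum[OF c(1)] y0 cls_subset by (intro sum.cong) auto
    also have "\<dots> = (\<Sum>w\<in>V - {u}. \<Sum>y\<in>C. a (c w) y)" by (rule sum.swap)
    also have "\<dots> = (\<Sum>w\<in>V - {u}. if adj u w \<and> \<tau> w u (D w) = C then \<mu> u w else 0)"
    proof (intro sum.cong refl)
      fix w assume w: "w \<in> V - {u}"
      then have cw: "c w \<in> S w" using St_in[OF c(1)] by auto
      show "(\<Sum>y\<in>C. a (c w) y) = (if adj u w \<and> \<tau> w u (D w) = C then \<mu> u w else 0)"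
      proof (cases "adj u w")
        case True
        note ad = adj_sym[OF True]
        obtain y where y: "y \<in> S u" "0 < a (c w) y" "\<tau> w u (cls w (c w)) = cls u y"
          using \<tau>_cls_ex[OF ad cw] by metis
        show ?thesis
        proof (cases "cls u y = C")
          case True
          have "(\<Sum>y'\<in>C. a (c w) y') = (\<Sum>y'\<in>cls u y. a (c w) y)"
            unfolding True[symmetric]
            using a_cls[OF uV _ _ cw y(1) cls_self[OF cw]] w by (intro sum.cong) auto
          then show ?thesis using a_card[OF ad cw y(1,2)] True y(3) c(2) \<open>adj u w\<close> \<mu>_sym[of u w] by (simp add: mult.commute)
        next
          case False
          have "a (c w) y' = 0" if "y' \<in> C" for y'
          proof (rule ccontr)
            assume "a (c w) y' \<noteq> 0"
            then have "y' \<in> cls u y" using nbrs_cls[OF ad cw y(1,2)] that y0 cls_subset by auto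
            then show False using False that cls_disjoint y0 by metis
          qed
          then show ?thesis using False y(3) c(2) by simp
        qed
      next
        case False
        then have "\<not> adj w u" using \<mu>_sym[of u w] by simp
        then have "a (c w) y = 0" if "y \<in> C" for y
          using a_zero[OF uV, of w "c w" y] w cw that y0 cls_subset by auto
        then show ?thesis using False by simp
      qed
    qed
    also have "\<dots> = (\<Sum>w\<in>V. if adj u w \<and> \<tau> w u (D w) = C then \<mu> u w else 0)"
      using uV finV \<mu>_irrefl by (simp add: sum.remove[of V u])
    finally show ?thesis .
  qed
  show "0 < (\<Sum>y\<in>C. f y)" if u: "u \<in> V" and C: "C \<in> cls u ` S u" for u C
  proof -
    obtain y where y: "y \<in> S u" "C = cls u y" using C by blast
    have "finite C" using y finS[OF u] cls_subset finite_subset by metis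
    then have "f y \<le> (\<Sum>y\<in>C. f y)" using y cls_self by (intro member_le_sum) auto
    then show ?thesis using f_pos[OF u y(1)] by simp
  qed
  show "\<exists>D. (\<exists>c. St u c \<and> D = (\<lambda>w. cls w (c w))) \<and> D w = C"
    if "u \<in> V" "w \<in> V" "u \<noteq> w" and C: "C \<in> cls w ` S w" for u w C
  proof -
    obtain x where x: "x \<in> S w" "C = cls w x" using C by blast
    from St_ex[OF that(1-3) x(1)] obtain c where "St u c" "c w = x" by blast
    then show ?thesis using x by blast
  qed
  show "\<exists>x\<in>cls u ` S u. \<exists>y\<in>cls u ` S u. x \<noteq> y" if "u \<in> V" for u
    using two[OF that] by blast
qed (use finV \<mu>_sym \<mu>_irrefl \<mu>_V conn conn_minus finS St_hole St_in in auto)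

end

section \<open>Inflated covers\<close>

lemma coverD:
  assumes "cover G X H"
  shows "multigraph H" "disjoint_family_on X (verts G)" "verts H = (\<Union>v\<in>verts G. X v)"
    "v \<in> verts G \<Longrightarrow> X v \<subseteq> verts H"
    "v \<in> verts G \<Longrightarrow> x \<in> X v \<Longrightarrow> y \<in> X v \<Longrightarrow> mult H x y = 0"
proof -
  show 1: "verts H = (\<Union>v\<in>verts G. X v)" using assms unfolding cover_def by (elim conjE) simp
  show "v \<in> verts G \<Longrightarrow> X v \<subseteq> verts H" unfolding 1 by blast
qed (use assms in \<open>simp_all add: cover_def\<close>)

text \<open>Each of the \<open>mult G u v\<close> matchings contains at most one edge at
  \<open>x\<close>; exchanging the sums over matchings and colours gives the row bound.\<close>

lemma cover_fibred:
  fixes X :: "'a \<Rightarrow> 'b set"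
  assumes G: "multigraph G" and C: "cover G X H"
  shows "fibred (verts G) (mult G) X (mult H)"
proof
  have H: "multigraph H" using coverD(1)[OF C] .
  show "finite (verts G)" "mult G u v = mult G v u" "mult G v v = 0" for u v
    using G unfolding multigraph_def by auto
  show "mult H x y = mult H y x" "mult H x x = 0" for x y using H unfolding multigraph_def by auto
  show fin: "finite (X v)" if "v \<in> verts G" for v
  proof -
    have "X v \<subseteq> verts H" using coverD(4)[OF C that] .
    then show ?thesis using H finite_subset unfolding multigraph_def by blast
  qed
  show "disjoint_family_on X (verts G)" using coverD(2)[OF C] .
  fix u v x assume uv: "u \<in> verts G" "v \<in> verts G" "u \<noteq> v" and x: "x \<in> X u"
  have "\<forall>u\<in>verts G. \<forall>v\<in>verts G. u \<noteq> v \<longrightarrow> (\<exists>M :: nat \<Rightarrow> ('b \<times> 'b) set.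
      (\<forall>i<mult G u v. bip_matching (X u) (X v) (M i)) \<and>
      (\<forall>x\<in>X u. \<forall>y\<in>X v. mult H x y = card {i. i < mult G u v \<and> (x, y) \<in> M i}))"
    using C unfolding cover_def by (elim conjE)
  from this[rule_format, OF uv] obtain M :: "nat \<Rightarrow> ('b \<times> 'b) set"
    where M': "(\<forall>i<mult G u v. bip_matching (X u) (X v) (M i)) \<and>
      (\<forall>x\<in>X u. \<forall>y\<in>X v. mult H x y = card {i. i < mult G u v \<and> (x, y) \<in> M i})" ..
  have M: "\<And>i. i < mult G u v \<Longrightarrow> bip_matching (X u) (X v) (M i)"
    "\<And>y. y \<in> X v \<Longrightarrow> mult H x y = card {i. i < mult G u v \<and> (x, y) \<in> M i}"
    using M' x by auto
  have "(\<Sum>y\<in>X v. mult H x y) = (\<Sum>y\<in>X v. \<Sum>i<mult G u v. if (x, y) \<in> M i then 1 else 0)"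
  proof (intro sum.cong refl)
    fix y assume y: "y \<in> X v"
    have "(\<Sum>i<mult G u v. if (x, y) \<in> M i then 1 else 0) = card ({..<mult G u v} \<inter> {i. (x, y) \<in> M i})"
      by (simp add: sum.If_cases)
    also have "{..<mult G u v} \<inter> {i. (x, y) \<in> M i} = {i. i < mult G u v \<and> (x, y) \<in> M i}" by auto
    finally show "mult H x y = (\<Sum>i<mult G u v. if (x, y) \<in> M i then 1 else 0)" using M(2)[OF y] by simp
  qed
  also have "\<dots> = (\<Sum>i<mult G u v. \<Sum>y\<in>X v. if (x, y) \<in> M i then 1 else 0)" by (rule sum.swap)
  also have "\<dots> \<le> (\<Sum>i<mult G u v. 1)"
  proof (intro sum_mono)
    fix i assume "i \<in> {..<mult G u v}"
    then have m: "inj_on fst (M i)" using M(1) unfolding bip_matching_def by auto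
    have "(\<Sum>y\<in>X v. if (x, y) \<in> M i then 1 else 0) = card (X v \<inter> {y. (x, y) \<in> M i})"
      using fin[OF uv(2)] by (simp add: sum.If_cases)
    also have "\<dots> \<le> 1"
      using fin[OF uv(2)] by (subst One_nat_def, subst card_le_Suc0_iff_eq) (use inj_onD[OF m] in force)+
    finally show "(\<Sum>y\<in>X v. if (x, y) \<in> M i then 1 else 0) \<le> (1 :: nat)" .
  qed
  finally show "(\<Sum>y\<in>X v. mult H x y) \<le> mult G u v" by simp
qed

lemma cover_disjoint:
  "cover G X H \<Longrightarrow> u \<in> verts G \<Longrightarrow> v \<in> verts G \<Longrightarrow> x \<in> X u \<Longrightarrow> x \<in> X v \<Longrightarrow> u = v"
  using coverD(2)[of G X H] unfolding disjoint_family_on_def by blast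

text \<open>A subgraph of \<open>H\<close> on part of the transversal has degrees at most those of
  the subgraph induced by its vertices; this is why the vertex sets \<open>W\<close> in
  \<open>good\<close> suffice.\<close>

lemma good_colorable:
  assumes C: "cover G X H" and g: "good X (mult H) f (verts G) c"
  shows "colorable G X H f"
  unfolding colorable_def
proof (intro exI conjI)
  let ?V = "verts G" and ?T = "c ` verts G"
  have cX: "c v \<in> X v" if "v \<in> ?V" for v using g that unfolding good_def by blast
  have inj: "inj_on c ?V" using cX cover_disjoint[OF C] by (intro inj_onI) metis
  show "transversal G X H ?T"
    unfolding transversal_def
  proof (intro conjI ballI)
    show "?T \<subseteq> verts H" using cX coverD(4)[OF C] by blast
    fix v assume v: "v \<in> ?V"
    have "w = v" if "w \<in> ?V" "c w \<in> X v" for w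
      using cover_disjoint[OF C that(1) v cX[OF that(1)] that(2)] .
    then have "?T \<inter> X v = {c v}" using cX[OF v] v by auto
    then show "card (?T \<inter> X v) = 1" by simp
  qed
  show "strictly_degenerate (induced H ?T) f"
    unfolding strictly_degenerate_def
  proof (intro allI impI, elim conjE)
    fix H' assume sub: "subgraph H' (induced H ?T)" and ne: "verts H' \<noteq> {}"
    define W where "W = {v \<in> ?V. c v \<in> verts H'}"
    have vs: "verts H' = c ` W" using sub unfolding subgraph_def induced_def W_def by auto
    have "W \<subseteq> ?V" "W \<noteq> {}" using vs ne unfolding W_def by auto
    then obtain v where v: "v \<in> W" "(\<Sum>w\<in>W. mult H (c v) (c w)) < f (c v)" using g unfolding good_def by meson
    have "deg H' (c v) = (\<Sum>w\<in>W. mult H' (c v) (c w))"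
      unfolding deg_def vs using inj \<open>W \<subseteq> ?V\<close> by (subst sum.reindex) (auto intro: inj_on_subset)
    also have "\<dots> \<le> (\<Sum>w\<in>W. mult H (c v) (c w))"
    proof (intro sum_mono)
      fix w
      have "mult H' (c v) (c w) \<le> mult (induced H ?T) (c v) (c w)" using sub unfolding subgraph_def by blast
      then show "mult H' (c v) (c w) \<le> mult H (c v) (c w)" by (auto simp: induced_def split: if_splits)
    qed
    finally have "deg H' (c v) < f (c v)" using v(2) by simp
    then show "\<exists>x\<in>verts H'. deg H' x < f x" using v(1) vs by blast
  qed
qed

lemma colorable_good:
  assumes G: "multigraph G" and C: "cover G X H" and col: "colorable G X H f"
  shows "\<exists>c. good X (mult H) f (verts G) c"
proof -
  obtain T where T: "transversal G X H T" "strictly_degenerate (induced H T) f" using col unfolding colorable_def by blast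
  have "\<exists>x. T \<inter> X v = {x}" if "v \<in> verts G" for v
    using T(1) that unfolding transversal_def by (metis card_1_singletonE)
  then obtain c where c: "\<And>v. v \<in> verts G \<Longrightarrow> T \<inter> X v = {c v}" by metis
  have cX: "c v \<in> X v" "c v \<in> T" if "v \<in> verts G" for v using c[OF that] by auto
  have inj: "inj_on c (verts G)" using cX cover_disjoint[OF C] by (intro inj_onI) metis
  have mH: "multigraph H" using coverD(1)[OF C] .
  have TH: "T \<subseteq> verts H" using T(1) unfolding transversal_def by blast
  have "good X (mult H) f (verts G) c"
    unfolding good_def
  proof (intro conjI ballI allI impI)
    fix W assume W: "W \<subseteq> verts G" "W \<noteq> {}"
    let ?H = "induced H (c ` W)"
    have cWT: "c ` W \<subseteq> T" using cX W by auto
    have vs: "verts ?H = c ` W" using cWT TH by (auto simp: induced_def)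
    have "multigraph ?H" using mH unfolding multigraph_def induced_def by auto
    then have "subgraph ?H (induced H T)"
      unfolding subgraph_def using cWT by (auto simp: induced_def)
    then obtain x where x: "x \<in> verts ?H" "deg ?H x < f x"
      using T(2) W vs unfolding strictly_degenerate_def by (metis image_is_empty)
    then obtain v where v: "v \<in> W" "x = c v" using vs by auto
    have "deg ?H (c v) = (\<Sum>w\<in>W. mult ?H (c v) (c w))"
      unfolding deg_def vs using inj W by (subst sum.reindex) (auto intro: inj_on_subset)
    also have "\<dots> = (\<Sum>w\<in>W. mult H (c v) (c w))"
      using v by (intro sum.cong) (auto simp: induced_def)
    finally show "\<exists>v\<in>W. (\<Sum>w\<in>W. mult H (c v) (c w)) < f (c v)" using x v by auto
  qed (use cX in auto)
  then show ?thesis by blast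
qed

text \<open>The inflated cover is built on representatives \<open>r i\<close> of the sets \<open>C i\<close> that replace its vertices.\<close>

lemma inflated_cover:
  fixes p :: "'i \<Rightarrow> 'a" and C :: "'i \<Rightarrow> 'b set"
  assumes G: "multigraph G" and cov: "cover G X H"
    and I: "finite I" "\<And>i. i \<in> I \<Longrightarrow> p i \<in> verts G"
    and m_sym: "\<And>i j. i \<in> I \<Longrightarrow> j \<in> I \<Longrightarrow> m i j = m j i"
    and m_fib: "\<And>i j. i \<in> I \<Longrightarrow> j \<in> I \<Longrightarrow> p i = p j \<Longrightarrow> m i j = 0"
    and m_val: "\<And>i j. i \<in> I \<Longrightarrow> j \<in> I \<Longrightarrow> m i j = 0 \<or> m i j = mult G (p i) (p j)"
    and m_match: "\<And>i j j'. i \<in> I \<Longrightarrow> j \<in> I \<Longrightarrow> j' \<in> I \<Longrightarrow> p j = p j' \<Longrightarrow> 0 < m i j \<Longrightarrow> 0 < m i j' \<Longrightarrow> j = j'"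
    and CX: "\<And>i. i \<in> I \<Longrightarrow> C i \<subseteq> X (p i)" and cC: "\<And>i. i \<in> I \<Longrightarrow> card (C i) = s" and s: "1 \<le> s"
    and dC: "disjoint_family_on C I"
    and mC: "\<And>i j x y. i \<in> I \<Longrightarrow> j \<in> I \<Longrightarrow> x \<in> C i \<Longrightarrow> y \<in> C j \<Longrightarrow> mult H x y * s = m i j"
  obtains r X0 H0 where "inj_on r I" "\<And>v. X0 v = r ` {i \<in> I. p i = v}"
    "\<And>i j. i \<in> I \<Longrightarrow> j \<in> I \<Longrightarrow> mult H0 (r i) (r j) = m i j"
    "cover G X0 H0" "is_inflation G X0 H0 (\<lambda>v. X v \<inter> (\<Union>i\<in>I. C i)) (induced H (\<Union>i\<in>I. C i))"
proof -
  define r where "r i = (SOME x. x \<in> C i)" for i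
  have r: "r i \<in> C i" if "i \<in> I" for i
  proof -
    have "C i \<noteq> {}" using cC[OF that] s by auto
    then show ?thesis unfolding r_def by (simp add: some_in_eq)
  qed
  have Cd: "i = j" if "i \<in> I" "j \<in> I" "x \<in> C i" "x \<in> C j" for i j x
    using dC that unfolding disjoint_family_on_def by blast
  have inj: "inj_on r I" using r Cd by (intro inj_onI) metis
  define inv where "inv x = the_inv_into I r x" for x
  have inv: "inv (r i) = i" if "i \<in> I" for i unfolding inv_def using the_inv_into_f_f[OF inj that] .
  define X0 where "X0 v = r ` {i \<in> I. p i = v}" for v
  define H0 where "H0 = \<lparr>verts = r ` I, mult = (\<lambda>x y. if x \<in> r ` I \<and> y \<in> r ` I then m (inv x) (inv y) else 0)\<rparr>"
  have vH0: "verts H0 = r ` I" by (simp add: H0_def)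
  have mH0: "mult H0 (r i) (r j) = m i j" if "i \<in> I" "j \<in> I" for i j
    using that inv by (simp add: H0_def)
  have mo: "multigraph H0"
    unfolding multigraph_def
  proof (intro conjI allI impI)
    show "finite (verts H0)" using I vH0 by simp
    show "mult H0 x y = mult H0 y x" for x y using m_sym inv by (auto simp: H0_def)
    show "mult H0 x x = 0" for x using m_fib inv by (auto simp: H0_def)
    show "x \<in> verts H0" "y \<in> verts H0" if "0 < mult H0 x y" for x y
      using that by (auto simp: H0_def split: if_splits)
  qed
  have cov0: "cover G X0 H0"
    unfolding cover_def
  proof (intro conjI ballI impI)
    show "multigraph H0" by fact
    show "disjoint_family_on X0 (verts G)"
      unfolding disjoint_family_on_def X0_def using inj by (auto dest: inj_onD)
    show "(\<Union>v\<in>verts G. X0 v) = verts H0" unfolding X0_def vH0 using I by auto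
    show "mult H0 x y = 0" if "x \<in> X0 v" "y \<in> X0 v" for v x y
      using that mH0 m_fib unfolding X0_def by auto
    fix u v assume uv: "u \<in> verts G" "v \<in> verts G" "u \<noteq> v"
    \<comment> \<open>All \<open>mult G u v\<close> matchings are taken equal, to the set of
      adjacent pairs: by \<open>m_val\<close> a pair has either no edge or one edge per matching,
      and by \<open>m_match\<close> the set is a matching.\<close>
    let ?M = "\<lambda>_ :: nat. {(x, y). x \<in> X0 u \<and> y \<in> X0 v \<and> 0 < mult H0 x y}"
    have "bip_matching (X0 u) (X0 v) (?M i)" for i :: nat
      unfolding bip_matching_def
    proof (intro conjI inj_onI)
      fix z z' assume z: "z \<in> ?M i" "z' \<in> ?M i"
      obtain i1 j1 where 1: "z = (r i1, r j1)" "i1 \<in> I" "j1 \<in> I" "p i1 = u" "p j1 = v" "0 < m i1 j1"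
        using z(1) mH0 unfolding X0_def by auto
      obtain i2 j2 where 2: "z' = (r i2, r j2)" "i2 \<in> I" "j2 \<in> I" "p i2 = u" "p j2 = v" "0 < m i2 j2"
        using z(2) mH0 unfolding X0_def by auto
      show "z = z'" if "fst z = fst z'"
      proof -
        have "i1 = i2" using that 1(1) 2(1) inj_onD[OF inj _ 1(2) 2(2)] by simp
        then have "j1 = j2" using m_match[OF 1(2,3) 2(3)] 1 2 by simp
        then show ?thesis using 1(1) 2(1) \<open>i1 = i2\<close> by simp
      qed
      show "z = z'" if "snd z = snd z'"
      proof -
        have "j1 = j2" using that 1(1) 2(1) inj_onD[OF inj _ 1(3) 2(3)] by simp
        then have "i1 = i2" using m_match[OF 1(3,2) 2(2)] 1 2 m_sym[OF 1(2,3)] m_sym[OF 2(2,3)] by simp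
        then show ?thesis using 1(1) 2(1) \<open>j1 = j2\<close> by simp
      qed
    qed auto
    moreover have "mult H0 x y = card {i. i < mult G u v \<and> (x, y) \<in> ?M i}" if x: "x \<in> X0 u" and y: "y \<in> X0 v" for x y
    proof (cases "0 < mult H0 x y")
      case True
      obtain i j where ij: "x = r i" "y = r j" "i \<in> I" "j \<in> I" "p i = u" "p j = v" using x y unfolding X0_def by auto
      then have "mult H0 x y = mult G u v" using True m_val[of i j] mH0[of i j] by auto
      moreover have "{i. i < mult G u v \<and> (x, y) \<in> ?M i} = {..<mult G u v}" using True x y by auto
      ultimately show ?thesis by simp
    qed auto
    ultimately show "\<exists>M :: nat \<Rightarrow> ('b \<times> 'b) set. (\<forall>i<mult G u v. bip_matching (X0 u) (X0 v) (M i)) \<and>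
      (\<forall>x\<in>X0 u. \<forall>y\<in>X0 v. mult H0 x y = card {i. i < mult G u v \<and> (x, y) \<in> M i})"
      by (intro exI[of _ ?M]) blast
  qed
  let ?U = "\<Union>i\<in>I. C i"
  have XU: "X v \<inter> ?U = (\<Union>i\<in>{i \<in> I. p i = v}. C i)" if v: "v \<in> verts G" for v
  proof
    show "X v \<inter> ?U \<subseteq> (\<Union>i\<in>{i \<in> I. p i = v}. C i)"
    proof
      fix x assume x: "x \<in> X v \<inter> ?U"
      then obtain i where i: "i \<in> I" "x \<in> C i" by blast
      then have "p i = v" using cover_disjoint[OF cov I(2) v, of i x] CX x by blast
      then show "x \<in> (\<Union>i\<in>{i \<in> I. p i = v}. C i)" using i by blast
    qed
    show "(\<Union>i\<in>{i \<in> I. p i = v}. C i) \<subseteq> X v \<inter> ?U" using CX by blast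
  qed
  have UH: "?U \<subseteq> verts H"
  proof -
    show ?thesis using CX I coverD(4)[OF cov] by blast
  qed
  have mdvd: "m i j = s * (m i j div s)" "mult H x y = m i j div s"
    if "i \<in> I" "j \<in> I" "x \<in> C i" "y \<in> C j" for i j x y
    using mC[OF that, symmetric] s by auto
  have "is_inflation_by s G X0 H0 (\<lambda>v. X v \<inter> ?U) (induced H ?U)"
    unfolding is_inflation_by_def
  proof (intro conjI ballI exI[of _ "\<lambda>x. C (inv x)"])
    show "1 \<le> s" by fact
    show "s dvd mult H0 x y" if xy: "x \<in> verts H0" "y \<in> verts H0" for x y
    proof -
      obtain i j where ij: "x = r i" "y = r j" "i \<in> I" "j \<in> I" using xy unfolding vH0 by auto
      show ?thesis using mdvd(1)[OF ij(3,4) r r] ij mH0 by (metis dvd_triv_left)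
    qed
    show "disjoint_family_on (\<lambda>x. C (inv x)) (verts H0)"
      unfolding disjoint_family_on_def vH0 using Cd inv by auto
    show "card (C (inv x)) = s" if "x \<in> verts H0" for x using that cC inv unfolding vH0 by auto
    show "verts (induced H ?U) = (\<Union>x\<in>verts H0. C (inv x))" unfolding vH0 using UH inv by (auto simp: induced_def)
    show "X v \<inter> ?U = (\<Union>x\<in>X0 v. C (inv x))" if "v \<in> verts G" for v
      unfolding XU[OF that] X0_def using inv by auto
    fix x y a b assume xy: "x \<in> verts H0" "y \<in> verts H0" and ab: "a \<in> C (inv x)" "b \<in> C (inv y)"
    obtain i j where ij: "x = r i" "y = r j" "i \<in> I" "j \<in> I" using xy unfolding vH0 by auto
    have ab': "a \<in> C i" "b \<in> C j" using ab ij inv by auto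
    have "mult (induced H ?U) a b = mult H a b" using ab' ij by (auto simp: induced_def)
    also have "\<dots> = (if x = y then 0 else mult H0 x y div s)"
    proof (cases "x = y")
      case True
      then have "i = j" using ij inj_onD[OF inj _ ij(3,4)] by simp
      then show ?thesis using mdvd(2)[OF ij(3,4) ab'] m_fib[OF ij(3,4)] True by simp
    next
      case False
      then show ?thesis using mdvd(2)[OF ij(3,4) ab'] mH0[OF ij(3,4)] ij(1,2) by simp
    qed
    finally show "mult (induced H ?U) a b = (if x = y then 0 else mult H0 x y div s)" .
  qed
  then have "is_inflation G X0 H0 (\<lambda>v. X v \<inter> ?U) (induced H ?U)" unfolding is_inflation_def by blast
  then show ?thesis using that[of r X0 H0] inj X0_def mH0 cov0 by blast
qed

text \<open>This is \<open>inflated_cover\<close> with the base vertices as indices and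
  \<open>mult G\<close> as multiplicities: one representative per fibre forms a
  \<open>G\<close>-cover.\<close>

lemma strand_inflates:
  assumes G: "multigraph G" and cov: "cover G X H"
    and CX: "\<And>v. v \<in> verts G \<Longrightarrow> \<sigma> v \<subseteq> X v" and cC: "\<And>v. v \<in> verts G \<Longrightarrow> card (\<sigma> v) = s" and s: "1 \<le> s"
    and mC: "\<And>u v x y. u \<in> verts G \<Longrightarrow> v \<in> verts G \<Longrightarrow> u \<noteq> v \<Longrightarrow> x \<in> \<sigma> u \<Longrightarrow> y \<in> \<sigma> v \<Longrightarrow> mult H x y * s = mult G u v"
  shows "restr_inflates_G_cover G X H (\<Union>v\<in>verts G. \<sigma> v)"
proof -
  let ?V = "verts G"
  have mG: "finite ?V" "\<And>u v. mult G u v = mult G v u" "\<And>v. mult G v v = 0" using G unfolding multigraph_def by auto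
  have fib: "mult H x y = 0" if "v \<in> ?V" "x \<in> X v" "y \<in> X v" for v x y using coverD(5)[OF cov that] .
  have d: "disjoint_family_on \<sigma> ?V"
    unfolding disjoint_family_on_def using cover_disjoint[OF cov] CX by blast
  have mm: "mult H x y * s = mult G u v" if "u \<in> ?V" "v \<in> ?V" "x \<in> \<sigma> u" "y \<in> \<sigma> v" for u v x y
  proof (cases "u = v")
    case True
    then show ?thesis using fib[of v x y] CX that mG by auto
  qed (use mC that in auto)
  obtain r X0 H0 where *: "\<And>v. X0 v = r ` {i \<in> ?V. i = v}"
    "\<And>i j. i \<in> ?V \<Longrightarrow> j \<in> ?V \<Longrightarrow> mult H0 (r i) (r j) = mult G i j"
    "cover G X0 H0" "is_inflation G X0 H0 (\<lambda>v. X v \<inter> (\<Union>i\<in>?V. \<sigma> i)) (induced H (\<Union>i\<in>?V. \<sigma> i))"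
  proof (rule inflated_cover[OF G cov, of ?V "\<lambda>v. v" "mult G" \<sigma> s])
    show "\<sigma> i \<subseteq> X i" "card (\<sigma> i) = s" if "i \<in> ?V" for i using CX[OF that] cC[OF that] .
    show "mult H x y * s = mult G i j" if "i \<in> ?V" "j \<in> ?V" "x \<in> \<sigma> i" "y \<in> \<sigma> j" for i j x y
      using mm[OF that] .
  qed (use mG s d in auto)
  have "is_G_cover G X0 H0"
    unfolding is_G_cover_def using * by (intro conjI exI[of _ r]) auto
  then show ?thesis unfolding restr_inflates_G_cover_def using *(4) by blast
qed

lemma strand_fibre:
  assumes "cover G X H" "\<And>v. v \<in> verts G \<Longrightarrow> \<sigma> v \<subseteq> X v" "v \<in> verts G"
  shows "X v \<inter> (\<Union>v\<in>verts G. \<sigma> v) = \<sigma> v"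
  using cover_disjoint[OF assms(1)] assms(2,3) by blast

section \<open>Blocks\<close>

context hole_cover
begin

text \<open>A flat section: one class per vertex, compatible with all transports. The union of such
  a choice serves as a set \<open>U\<close> whose restriction is an inflated
  \<open>G\<close>-cover.\<close>

definition strand :: "('a \<Rightarrow> 'b set) \<Rightarrow> bool" where
  "strand \<sigma> \<longleftrightarrow> (\<forall>v\<in>V. \<sigma> v \<in> cls v ` S v) \<and> (\<forall>u v. adj u v \<longrightarrow> \<tau> u v (\<sigma> u) = \<sigma> v)"

lemma has_nbr:
  assumes u: "u \<in> V"
  obtains w where "adj u w"
proof -
  have "V - {u} \<noteq> {}" using conn_minus[OF u] unfolding conn_def by blast
  then have "{u} \<noteq> V" by blast
  then show ?thesis using connD[OF conn, of "{u}"] u that by blast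
qed

text \<open>Tightness expresses the value of a colour by its multiplicities to the colours of a
  state, and these agree for twins.\<close>

lemma f_cls:
  assumes u: "u \<in> V" and y: "y \<in> S u" "y' \<in> cls u y"
  shows "f y' = f y"
proof -
  obtain w where w: "adj u w" using has_nbr[OF u] .
  obtain x where x: "x \<in> S w" using a_ex[OF w y(1)] by blast
  obtain c where c: "St u c" using St_ex[OF u adj_V(2)[OF w] adj_neq[OF w] x] by blast
  have "y' \<in> S u" using y cls_subset by blast
  have "(\<Sum>w\<in>V - {u}. a (c w) y') = (\<Sum>w\<in>V - {u}. a (c w) y)"
    using y(2) St_in[OF c] unfolding cls_def by (intro sum.cong) auto
  then show ?thesis using St_sum[OF c y(1)] St_sum[OF c \<open>y' \<in> S u\<close>] by simp
qed

lemma strand_cls: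
  assumes "strand \<sigma>" "v \<in> V" "x \<in> \<sigma> v"
  shows "\<sigma> v = cls v x" "x \<in> S v"
proof -
  obtain y where "\<sigma> v = cls v y" using assms unfolding strand_def by blast
  then show "\<sigma> v = cls v x" "x \<in> S v" using assms(3) cls_eqI[of x v y] cls_subset[of v y] by auto
qed

lemma strand_nonempty: "strand \<sigma> \<Longrightarrow> v \<in> V \<Longrightarrow> \<sigma> v \<noteq> {}"
  unfolding strand_def using cls_self by fastforce

lemma strand_subset: "strand \<sigma> \<Longrightarrow> v \<in> V \<Longrightarrow> \<sigma> v \<subseteq> S v"
  unfolding strand_def using cls_subset by fastforce

text \<open>By \<open>card_cls_eq\<close> the class sizes agree along edges, and connectivity
  spreads this to all vertices; the common size \<open>s\<close> is the inflation factor, and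
  \<open>a_card\<close> gives the multiplicities.\<close>

lemma strand_regular:
  assumes \<sigma>: "strand \<sigma>"
  obtains s where "1 \<le> s" "\<And>v. v \<in> V \<Longrightarrow> card (\<sigma> v) = s"
    "\<And>u v x y. u \<in> V \<Longrightarrow> v \<in> V \<Longrightarrow> u \<noteq> v \<Longrightarrow> x \<in> \<sigma> u \<Longrightarrow> y \<in> \<sigma> v \<Longrightarrow> a x y * s = \<mu> u v"
proof -
  have pos: "0 < a x y" if ad: "adj u v" and x: "x \<in> \<sigma> u" and y: "y \<in> \<sigma> v" for u v x y
  proof -
    have "\<sigma> u = cls u x" "x \<in> S u" using strand_cls[OF \<sigma> adj_V(1)[OF ad] x] by auto
    moreover have "\<tau> u v (\<sigma> u) = \<sigma> v" using \<sigma> ad unfolding strand_def by blast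
    ultimately show ?thesis using \<tau>_cls_nbrs[OF ad, of x] y by auto
  qed
  obtain v0 where v0: "v0 \<in> V" using conn unfolding conn_def by blast
  define s where "s = card (\<sigma> v0)"
  have "{v \<in> V. card (\<sigma> v) = s} = V"
  proof (rule conn_closed_subset[OF conn, of v0])
    show "v0 \<in> {v \<in> V. card (\<sigma> v) = s}" using v0 s_def by simp
    fix u v assume u: "u \<in> {v \<in> V. card (\<sigma> v) = s}" and v: "v \<in> V" and ad: "adj u v"
    obtain x y where xy: "x \<in> \<sigma> u" "y \<in> \<sigma> v" using strand_nonempty[OF \<sigma>] u v by blast
    have "card (cls v y) = card (cls u x)"
      using card_cls_eq[OF ad _ _ pos[OF ad xy]] strand_cls[OF \<sigma>] xy u v by blast
    then show "v \<in> {v \<in> V. card (\<sigma> v) = s}" using u v xy strand_cls(1)[OF \<sigma>] by auto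
  qed auto
  then have cs: "card (\<sigma> v) = s" if "v \<in> V" for v using that by blast
  have "a x y * s = \<mu> u v" if uv: "u \<in> V" "v \<in> V" "u \<noteq> v" and xy: "x \<in> \<sigma> u" "y \<in> \<sigma> v" for u v x y
  proof (cases "adj u v")
    case True
    then show ?thesis
      using a_card[OF True _ _ pos[OF True xy]] strand_cls[OF \<sigma> uv(1) xy(1)] strand_cls[OF \<sigma> uv(2) xy(2)] cs[OF uv(2)] by auto
  next
    case False
    then have "a x y = 0" using a_zero[OF uv(2,1) _ False] strand_cls(2)[OF \<sigma>] uv xy by auto
    then show ?thesis using False by simp
  qed
  moreover have "1 \<le> s"
  proof -
    have "finite (\<sigma> v0)" using strand_subset[OF \<sigma> v0] finS[OF v0] finite_subset by blast
    then show ?thesis unfolding s_def using strand_nonempty[OF \<sigma> v0] by (simp add: Suc_le_eq card_gt_0_iff)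
  qed
  ultimately show ?thesis using that cs by blast
qed

lemma strand_f:
  assumes \<sigma>: "strand \<sigma>" and v: "v \<in> V" and x: "x \<in> \<sigma> v"
  shows "f x * card (\<sigma> v) = (\<Sum>y\<in>\<sigma> v. f y)"
proof -
  note c = strand_cls[OF \<sigma> v x]
  have "(\<Sum>y\<in>\<sigma> v. f y) = (\<Sum>y\<in>\<sigma> v. f x)" using f_cls[OF v c(2)] c(1) by (intro sum.cong) auto
  then show ?thesis by simp
qed

end

lemma real_eq_divide:
  fixes k c d :: nat
  assumes "k * c = d" "0 < c"
  shows "real k = real d / real c"
  using assms by (auto simp: field_simps)

locale block_config = hole_cover "verts G" "mult G" "\<lambda>v. {x \<in> X v. 0 < f x}" "mult H" f St
  for G :: "'a mgraph" and X :: "'a \<Rightarrow> 'b set" and H :: "'b mgraph" and f :: "'b \<Rightarrow> nat"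
    and St :: "'a \<Rightarrow> ('a \<Rightarrow> 'b) \<Rightarrow> bool" +
  assumes G: "multigraph G" and cov: "cover G X H"
    and uni: "\<exists>r\<ge>1. \<forall>v\<in>verts G. card (X v) = r" and blk: "block G"
    and tot: "v \<in> verts G \<Longrightarrow> (\<Sum>x\<in>X v. f x) = (\<Sum>w\<in>verts G. mult G v w)"
begin

abbreviation "V \<equiv> verts G"
abbreviation "S v \<equiv> {x \<in> X v. 0 < f x}"

lemma uniform: "uniform_configuration G X H f"
  unfolding uniform_configuration_def configuration_def using G cov uni by blast

lemma finX: "v \<in> V \<Longrightarrow> finite (X v)"
  using coverD(1)[OF cov] coverD(4)[OF cov, of v] unfolding multigraph_def by (auto intro: finite_subset)

lemma sum_S: "v \<in> V \<Longrightarrow> (\<Sum>x\<in>S v. f x) = deg G v"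
  unfolding deg_def tot[symmetric] using finX by (intro sum.mono_neutral_left) auto

lemma S_nonempty: "v \<in> V \<Longrightarrow> S v \<noteq> {}"
proof
  assume v: "v \<in> V" and e: "S v = {}"
  obtain w where w: "adj v w" using has_nbr[OF v] .
  have "deg G v = 0" using sum_S[OF v] unfolding e by simp
  then show False using w adj_V[OF w] finV unfolding deg_def by simp
qed

lemma strand_X: "strand \<sigma> \<Longrightarrow> v \<in> V \<Longrightarrow> \<sigma> v \<subseteq> X v"
  using strand_subset[of \<sigma> v] by auto

lemma strand_cover: "strand \<sigma> \<Longrightarrow> restr_inflates_G_cover G X H (\<Union>v\<in>V. \<sigma> v)"
proof -
  assume \<sigma>: "strand \<sigma>"
  obtain s where s: "1 \<le> s" "\<And>v. v \<in> V \<Longrightarrow> card (\<sigma> v) = s"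
    "\<And>u v x y. u \<in> V \<Longrightarrow> v \<in> V \<Longrightarrow> u \<noteq> v \<Longrightarrow> x \<in> \<sigma> u \<Longrightarrow> y \<in> \<sigma> v \<Longrightarrow> mult H x y * s = mult G u v"
    by (rule strand_regular[OF \<sigma>]) blast
  show ?thesis by (rule strand_inflates[OF G cov strand_X[OF \<sigma>] s(2) s(1) s(3)])
qed

lemma strand_fib: "strand \<sigma> \<Longrightarrow> v \<in> V \<Longrightarrow> X v \<inter> (\<Union>v\<in>V. \<sigma> v) = \<sigma> v"
  by (rule strand_fibre[OF cov]) (rule strand_X)

lemma strand_sub: "strand \<sigma> \<Longrightarrow> (\<Union>v\<in>V. \<sigma> v) \<subseteq> verts H"
  using strand_X coverD(3)[OF cov] by blast

lemma strand_card_pos: "strand \<sigma> \<Longrightarrow> v \<in> V \<Longrightarrow> 0 < card (\<sigma> v)"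
  using strand_nonempty[of \<sigma> v] strand_X[of \<sigma> v] finX[of v] by (auto simp: card_gt_0_iff intro: finite_subset)

lemma strand_value:
  assumes \<sigma>: "strand \<sigma>" and v: "v \<in> V" and x: "x \<in> X v" "x \<in> (\<Union>v\<in>V. \<sigma> v)"
  shows "real (f x) = real (\<Sum>y\<in>\<sigma> v. f y) / real (card (X v \<inter> (\<Union>v\<in>V. \<sigma> v)))"
proof -
  have "x \<in> \<sigma> v" using strand_fib[OF \<sigma> v] x by blast
  then show ?thesis unfolding strand_fib[OF \<sigma> v]
    using strand_f[OF \<sigma> v] strand_card_pos[OF \<sigma> v] by (intro real_eq_divide)
qed

text \<open>A fibre with a single class forces the same on its neighbours, since every class there
  is the transport of that class. Hence all colours of positive value form one strand, which is the
  set \<open>U\<close> of an M-configuration, and its class sums are the degrees.\<close>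

lemma one_class:
  assumes u0: "u0 \<in> V" and one: "\<And>x y. x \<in> S u0 \<Longrightarrow> y \<in> S u0 \<Longrightarrow> cls u0 x = cls u0 y"
  shows "constructible G X H f"
proof -
  have "{u \<in> V. \<forall>x\<in>S u. cls u x = S u} = V"
  proof (rule conn_closed_subset[OF conn, of u0])
    have "cls u0 x = S u0" if "x \<in> S u0" for x
      using one[OF that] cls_self[of _ u0] cls_subset[of u0 x] by blast
    then show "u0 \<in> {u \<in> V. \<forall>x\<in>S u. cls u x = S u}" using u0 by blast
    fix u w assume u: "u \<in> {u \<in> V. \<forall>x\<in>S u. cls u x = S u}" and w: "w \<in> V" and ad: "adj u w"
    have "cls w y = \<tau> u w (S u)" if y: "y \<in> S w" for y
    proof -
      obtain x where x: "x \<in> S u" "0 < mult H y x" using a_ex[OF adj_sym[OF ad] y] .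
      then have "\<tau> u w (cls u x) = cls w y" using \<tau>_cls[OF ad x(1) y] a_sym by simp
      then show ?thesis using u x by simp
    qed
    then have "cls w y = S w" if "y \<in> S w" for y
      using that cls_self[of _ w] cls_subset[of w y] by blast
    then show "w \<in> {u \<in> V. \<forall>x\<in>S u. cls u x = S u}" using w by blast
  qed auto
  then have all: "cls u x = S u" if "u \<in> V" "x \<in> S u" for u x using that by blast
  have \<sigma>: "strand S"
    unfolding strand_def
  proof (intro conjI ballI allI impI)
    fix v assume v: "v \<in> V"
    then obtain x where x: "x \<in> S v" using S_nonempty by blast
    then show "S v \<in> cls v ` S v" using all[OF v x] by (intro image_eqI[of "S v" "cls v" x]) simp_all
  next
    fix u v assume ad: "adj u v"
    obtain x where x: "x \<in> S u" using S_nonempty adj_V[OF ad] by blast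
    from \<tau>_cls_ex[OF ad x] obtain y where "y \<in> S v" "\<tau> u v (cls u x) = cls v y" by blast
    then show "\<tau> u v (S u) = S v" using all[OF adj_V(1)[OF ad] x] all[OF adj_V(2)[OF ad]] by simp
  qed
  let ?U = "\<Union>v\<in>V. S v"
  have "M_configuration G X H f"
    unfolding M_configuration_def
  proof (intro conjI exI[of _ ?U] ballI impI)
    show "block G" by (rule blk)
    show "?U \<subseteq> verts H" by (rule strand_sub[OF \<sigma>])
    show "restr_inflates_G_cover G X H ?U" by (rule strand_cover[OF \<sigma>])
    fix v x assume v: "v \<in> V" and x: "x \<in> X v"
    show "real (f x) = real (deg G v) / real (card (X v \<inter> ?U))" if "x \<in> ?U"
      using strand_value[OF \<sigma> v x that] sum_S[OF v] by simp
    show "f x = 0" if "x \<notin> ?U" using that v x by auto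
  qed
  then show ?thesis using K1 uniform by blast
qed

text \<open>Flat triangles allow a class at \<open>v0\<close> to be transported consistently to all
  vertices, so every class at \<open>v0\<close> starts a strand, and the strands partition the
  colours of positive value. By \<open>complete_F\<close> the class sum is constant along a
  strand.\<close>

lemma complete_case:
  assumes two: "\<And>u. u \<in> V \<Longrightarrow> \<exists>x\<in>S u. \<exists>y\<in>S u. cls u x \<noteq> cls u y"
    and comp: "\<And>u v. u \<in> V \<Longrightarrow> v \<in> V \<Longrightarrow> u \<noteq> v \<Longrightarrow> adj u v"
  shows "constructible G X H f"
proof -
  interpret Q: hole_system V "mult G" "\<lambda>u. cls u ` S u" \<tau> "\<lambda>u C. \<Sum>y\<in>C. f y"
    "\<lambda>u C. \<exists>c. St u c \<and> C = (\<lambda>w. cls w (c w))"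
    by (rule quotient_hole_system) (rule two)
  obtain t where t0: "0 < t" and t: "\<And>u v. u \<in> V \<Longrightarrow> v \<in> V \<Longrightarrow> u \<noteq> v \<Longrightarrow> mult G u v = t"
    by (rule Q.complete_const) (use comp in auto)
  define n where "n = card V"
  obtain \<phi> where \<phi>: "bij_betw \<phi> {1..n} V" using ex_bij_betw_nat_finite_1[OF finV] n_def by blast
  obtain v0 where v0: "v0 \<in> V" using conn unfolding conn_def by blast
  have n1: "1 \<le> n" using v0 finV unfolding n_def by (simp add: Suc_le_eq card_gt_0_iff) blast
  let ?S' = "cls v0 ` S v0"
  define p where "p = card ?S'"
  have finS': "finite ?S'" using finS[OF v0] by simp
  obtain e where e: "bij_betw e {1..p} ?S'" using ex_bij_betw_nat_finite_1[OF finS'] p_def by blast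
  have p1: "1 \<le> p" using S_nonempty[OF v0] finS' unfolding p_def by (simp add: Suc_le_eq card_gt_0_iff)
  have eS: "e i \<in> ?S'" if "i \<in> {1..p}" for i using bij_betwE[OF e] that by blast
  have einj: "i = j" if "i \<in> {1..p}" "j \<in> {1..p}" "e i = e j" for i j
    using e that unfolding bij_betw_def inj_on_def by blast
  define \<sigma> where "\<sigma> i v = (if v = v0 then e i else \<tau> v0 v (e i))" for i v
  have \<sigma>: "strand (\<sigma> i)" if i: "i \<in> {1..p}" for i
    unfolding strand_def
  proof (intro conjI ballI allI impI)
    show "\<sigma> i v \<in> cls v ` S v" if v: "v \<in> V" for v
      using eS[OF i] Q.\<tau>_in[OF comp[OF v0 v] eS[OF i]] unfolding \<sigma>_def by (cases "v = v0") auto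
    fix u v assume ad: "adj u v"
    consider "u = v0" | "u \<noteq> v0" "v = v0" | "u \<noteq> v0" "v \<noteq> v0" by blast
    then show "\<tau> u v (\<sigma> i u) = \<sigma> i v"
    proof cases
      case 1
      then show ?thesis using adj_neq[OF ad] by (auto simp: \<sigma>_def)
    next
      case 2
      then show ?thesis using Q.\<tau>_inv[OF adj_sym[OF ad], of "e i"] eS[OF i] by (simp add: \<sigma>_def)
    next
      case 3
      have "\<tau> u v (\<tau> v0 u (e i)) = \<tau> v0 v (e i)"
        using Q.triangle_flat[of v u v0 "e i"] comp v0 adj_V[OF ad] 3 eS[OF i] adj_sym[OF ad] by simp
      then show ?thesis using 3 by (simp add: \<sigma>_def)
    qed
  qed
  have \<sigma>_inj: "i = j" if ij: "i \<in> {1..p}" "j \<in> {1..p}" and v: "v \<in> V" "\<sigma> i v = \<sigma> j v" for i j v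
  proof (cases "v = v0")
    case True
    then show ?thesis using v einj[OF ij] by (simp add: \<sigma>_def)
  next
    case False
    then have "e i = e j" using v Q.\<tau>_eq_iff[OF comp[OF v0 v(1)] eS[OF ij(1)] eS[OF ij(2)]] by (auto simp: \<sigma>_def)
    then show ?thesis using einj[OF ij] by simp
  qed
  have \<sigma>_onto: "\<exists>i\<in>{1..p}. x \<in> \<sigma> i v" if v: "v \<in> V" and x: "x \<in> S v" for v x
  proof -
    have ex: "\<exists>i\<in>{1..p}. e i = C" if "C \<in> ?S'" for C using e that unfolding bij_betw_def by (metis imageE)
    show ?thesis
    proof (cases "v = v0")
      case True
      then obtain i where "i \<in> {1..p}" "e i = cls v x" using ex[of "cls v0 x"] x by blast
      then show ?thesis using True cls_self[OF x] by (auto simp: \<sigma>_def)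
    next
      case False
      have ad: "adj v v0" using comp[OF v v0 False] .
      have "\<tau> v v0 (cls v x) \<in> ?S'" using Q.\<tau>_in[OF ad] x by blast
      then obtain i where i: "i \<in> {1..p}" "e i = \<tau> v v0 (cls v x)" using ex by blast
      have "cls v x \<in> cls v ` S v" using x by blast
      from Q.\<tau>_inv[OF ad this] have "\<sigma> i v = cls v x" using False i(2) by (simp add: \<sigma>_def)
      then show ?thesis using i(1) cls_self[OF x] by blast
    qed
  qed
  define U where "U i = (\<Union>v\<in>V. \<sigma> i v)" for i
  \<comment> \<open>The class sum in units of \<open>t\<close>. The division is exact, as a class
    sum is a sum of multiplicities that all equal \<open>t\<close>.\<close>
  define ns where "ns i = (\<Sum>y\<in>e i. f y) div t" for i
  have nst: "t * ns i = (\<Sum>y\<in>e i. f y)" if "i \<in> {1..p}" for i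
    using Q.complete_dvd_F[OF t v0 eS[OF that]] unfolding ns_def by simp
  have tn: "(\<Sum>y\<in>\<sigma> i v. f y) = t * ns i" if i: "i \<in> {1..p}" and v: "v \<in> V" for i v
  proof (cases "v = v0")
    case True
    then show ?thesis using nst[OF i] by (simp add: \<sigma>_def)
  next
    case False
    then show ?thesis using nst[OF i] Q.complete_F[OF t t0 v0 v _ eS[OF i]] by (simp add: \<sigma>_def)
  qed
  have ns1: "1 \<le> ns i" if i: "i \<in> {1..p}" for i
    using nst[OF i] Q.F_pos[OF v0 eS[OF i]] by (metis less_one linorder_not_le mult_0_right not_less_zero)
  have sum_ns: "(\<Sum>i=1..p. ns i) = n - 1"
  proof -
    have "t * (\<Sum>i=1..p. ns i) = (\<Sum>i=1..p. \<Sum>y\<in>e i. f y)"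
      unfolding sum_distrib_left by (intro sum.cong) (auto simp: nst)
    also have "\<dots> = (\<Sum>C\<in>?S'. \<Sum>y\<in>C. f y)" by (rule sum.reindex_bij_betw[OF e])
    also have "\<dots> = (\<Sum>w\<in>V. mult G v0 w)" by (rule Q.F_total[OF v0])
    also have "\<dots> = (\<Sum>w\<in>V - {v0}. mult G v0 w)" using finV v0 by (simp add: sum.remove[of V v0] \<mu>_irrefl)
    also have "\<dots> = (\<Sum>w\<in>V - {v0}. t)" using t[OF v0] by (intro sum.cong) auto
    also have "\<dots> = t * (n - 1)" using v0 finV by (simp add: n_def)
    finally show ?thesis using t0 by simp
  qed
  have Ufib: "X v \<inter> U i = \<sigma> i v" if "i \<in> {1..p}" "v \<in> V" for i v
    unfolding U_def using strand_fib[OF \<sigma>] that by blast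
  have "K_configuration G X H f"
    unfolding K_configuration_def
  proof (rule exI[of _ t], rule exI[of _ n], intro conjI)
    show "1 \<le> t" "1 \<le> n" using t0 n1 by auto
    show "\<exists>\<phi>. graph_iso \<phi> (times_graph t (complete_graph n)) G"
    proof (rule exI[of _ \<phi>])
      have "mult G (\<phi> i) (\<phi> j) = t * (if i \<noteq> j then 1 else 0)" if "i \<in> {1..n}" "j \<in> {1..n}" for i j
      proof (cases "i = j")
        case False
        then have "\<phi> i \<noteq> \<phi> j" using \<phi> that unfolding bij_betw_def inj_on_def by blast
        then show ?thesis using False t[of "\<phi> i" "\<phi> j"] bij_betwE[OF \<phi>] that by auto
      qed (simp add: \<mu>_irrefl)
      then show "graph_iso \<phi> (times_graph t (complete_graph n)) G"
        unfolding graph_iso_def times_graph_def complete_graph_def using \<phi> by auto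
    qed
    show "\<exists>(p :: nat) (ns :: nat \<Rightarrow> nat) (U :: nat \<Rightarrow> 'b set). p \<ge> 1 \<and> (\<forall>i\<in>{1..p}. ns i \<ge> 1) \<and> (\<Sum>i=1..p. ns i) = n - 1 \<and>
           (\<forall>i\<in>{1..p}. U i \<subseteq> verts H) \<and> disjoint_family_on U {1..p} \<and>
           (\<forall>i\<in>{1..p}. restr_inflates_G_cover G X H (U i)) \<and>
           (\<forall>v\<in>verts G. \<forall>x\<in>X v.
              (\<forall>i\<in>{1..p}. x \<in> U i \<longrightarrow>
                 real (f x) = real t * real (ns i) / real (card (X v \<inter> U i))) \<and>
              (x \<notin> (\<Union>i\<in>{1..p}. U i) \<longrightarrow> f x = 0))"
    proof (rule exI[of _ p], rule exI[of _ ns], rule exI[of _ U], intro conjI ballI impI)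
      show "1 \<le> p" by (rule p1)
      show "1 \<le> ns i" if "i \<in> {1..p}" for i using ns1[OF that] .
      show "(\<Sum>i=1..p. ns i) = n - 1" by (rule sum_ns)
      show "U i \<subseteq> verts H" if "i \<in> {1..p}" for i unfolding U_def by (rule strand_sub[OF \<sigma>[OF that]])
      show "restr_inflates_G_cover G X H (U i)" if "i \<in> {1..p}" for i unfolding U_def by (rule strand_cover[OF \<sigma>[OF that]])
      show "disjoint_family_on U {1..p}"
        unfolding disjoint_family_on_def
      proof (intro ballI impI)
        fix i j assume ij: "i \<in> {1..p}" "j \<in> {1..p}" "i \<noteq> j"
        have False if x: "x \<in> U i" "x \<in> U j" for x
        proof -
          obtain v where v: "v \<in> V" "x \<in> \<sigma> i v" using x(1) unfolding U_def by blast
          have "x \<in> X v" using v strand_X[OF \<sigma>[OF ij(1)]] by blast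
          then have "x \<in> \<sigma> j v" using Ufib[OF ij(2) v(1)] x(2) by blast
          then have "\<sigma> i v = \<sigma> j v" using strand_cls(1)[OF \<sigma>[OF ij(1)] v] strand_cls(1)[OF \<sigma>[OF ij(2)] v(1)] by simp
          then show False using \<sigma>_inj[OF ij(1,2) v(1)] ij(3) by blast
        qed
        then show "U i \<inter> U j = {}" by blast
      qed
      fix v x assume v: "v \<in> V" and x: "x \<in> X v"
      show "real (f x) = real t * real (ns i) / real (card (X v \<inter> U i))" if i: "i \<in> {1..p}" and xU: "x \<in> U i" for i
        using strand_value[OF \<sigma>[OF i] v x] xU tn[OF i v] unfolding U_def by simp
      show "f x = 0" if "x \<notin> (\<Union>i\<in>{1..p}. U i)"
      proof (rule ccontr)
        assume "f x \<noteq> 0"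
        then obtain i where "i \<in> {1..p}" "x \<in> \<sigma> i v" using \<sigma>_onto[OF v, of x] x by auto
        then show False using that v unfolding U_def by blast
      qed
    qed
  qed
  then show ?thesis using K2 uniform by blast
qed

end

section \<open>Cycles with two classes per fibre\<close>

lemma cong_Suc_iff_dvd: "[i = j + 1] (mod m) \<longleftrightarrow> int m dvd int i - int j - 1"
  unfolding cong_int_iff[symmetric] cong_iff_dvd_diff by (simp add: algebra_simps)

lemma periodic_mult:
  fixes x :: "nat \<Rightarrow> 'c"
  assumes "\<And>i. x (i + k) = x i"
  shows "x (i + k * n) = x i"
proof (induction n)
  case (Suc n)
  have "x (i + k * Suc n) = x (i + k * n + k)" by (simp add: algebra_simps)
  then show ?case using assms Suc by simp
qed simp

lemma int_dvd_diff_cases: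
  assumes "int k dvd int i - int j"
  obtains n where "i = j + k * n" | n where "j = i + k * n"
proof (cases "j \<le> i")
  case True
  then have "int k dvd int (i - j)" using assms by (simp add: of_nat_diff)
  then obtain n where "i - j = k * n" by (auto simp: int_dvd_int_iff elim: dvdE)
  then show ?thesis using that(1)[of n] True by simp
next
  case False
  then have "int k dvd int (j - i)" using assms by (simp add: of_nat_diff dvd_diff_commute)
  then obtain n where "j - i = k * n" by (auto simp: int_dvd_int_iff elim: dvdE)
  then show ?thesis using that(2)[of n] False by simp
qed

locale cyclic_config = block_config +
  fixes k :: nat and q :: "int \<Rightarrow> 'a"
  assumes two: "u \<in> V \<Longrightarrow> \<exists>x\<in>S u. \<exists>y\<in>S u. cls u x \<noteq> cls u y"
    and q: "hole_system.icyc V (mult G) k q"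
begin

sublocale Q: hole_system V "mult G" "\<lambda>u. cls u ` S u" \<tau> "\<lambda>u C. \<Sum>y\<in>C. f y"
  "\<lambda>u C. \<exists>c. St u c \<and> C = (\<lambda>w. cls w (c w))"
  by (rule quotient_hole_system) (rule two)

definition "t = mult G (q 0) (q 1)"

abbreviation "S' u \<equiv> cls u ` S u"

lemma k4: "4 \<le> k" and qV: "q i \<in> V"
  using q unfolding Q.icyc_def by auto

lemma t_pos: "0 < t"
  using Q.icyc_adj(1)[OF q, of 0] by (simp add: t_def)

lemma q_adj: "adj (q i) (q j) \<longleftrightarrow> int k dvd j - i - 1 \<or> int k dvd i - j - 1"
  using q unfolding Q.icyc_def by simp

lemma mult_q: "mult G (q i) (q j) = (if int k dvd j - i - 1 \<or> int k dvd i - j - 1 then t else 0)"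
proof (cases "adj (q i) (q j)")
  case True
  then have "mult G (q i) (q j) = t"
    using Q.icyc_nbr[OF q True] Q.icyc_\<mu>[OF q, of i] Q.icyc_\<mu>[OF q, of "i - 1"] \<mu>_sym[of "q i" "q (i - 1)"]
    unfolding t_def by auto
  then show ?thesis using True q_adj[of i j] by presburger
next
  case False
  then show ?thesis using q_adj[of i j] by simp
qed

lemma q_nat: "v \<in> V \<Longrightarrow> \<exists>i\<in>{1..k}. v = q (int i)"
proof -
  assume "v \<in> V"
  then obtain j where j: "v = q j" using Q.icyc_spanning[OF q] by auto
  \<comment> \<open>Shifting by one before and after the reduction yields a representative in
    \<open>{1..k}\<close>, the vertex set of \<open>cycle_graph\<close>.\<close>
  define i where "i = nat ((j - 1) mod int k + 1)"
  have k0: "0 < int k" using k4 by simp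
  have b: "0 \<le> (j - 1) mod int k" "(j - 1) mod int k < int k" using k0 by auto
  then have ii: "int i = (j - 1) mod int k + 1" and iI: "i \<in> {1..k}" unfolding i_def by auto
  have "int k dvd j - int i"
  proof -
    have "j - int i = (j - 1) - (j - 1) mod int k" using ii by simp
    then show ?thesis by (simp only: dvd_minus_mod)
  qed
  then show ?thesis using Q.icyc_eq[OF q, of j "int i"] j iI by auto
qed

lemma iso: "graph_iso (\<lambda>i. q (int i)) (times_graph t (cycle_graph k)) G"
proof -
  have "bij_betw (\<lambda>i. q (int i)) {1..k} V"
    unfolding bij_betw_def
  proof
    show "inj_on (\<lambda>i. q (int i)) {1..k}"
    proof (rule inj_onI, rule ccontr)
      fix i j assume ij: "i \<in> {1..k}" "j \<in> {1..k}" "q (int i) = q (int j)" "i \<noteq> j"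
      then have "\<bar>int i - int j\<bar> < int k" by (simp add: abs_if)
      then show False using Q.icyc_neq[OF q, of "int i" "int j"] ij by simp
    qed
    show "(\<lambda>i. q (int i)) ` {1..k} = V" using q_nat qV by blast
  qed
  moreover have "mult G (q (int i)) (q (int j)) = t * (if [i = j + 1] (mod k) \<or> [j = i + 1] (mod k) then 1 else 0)" for i j
    unfolding mult_q cong_Suc_iff_dvd by auto
  ultimately show ?thesis
    unfolding graph_iso_def times_graph_def cycle_graph_def by auto
qed

lemma class_f:
  assumes "C \<in> S' v" "v \<in> V" "x \<in> C"
  shows "f x * card C = (\<Sum>y\<in>C. f y)"
proof -
  obtain y where y: "y \<in> S v" "C = cls v y" using assms by blast
  have "f z = f x" if "z \<in> C" for z
    using f_cls[OF assms(2) y(1), of z] f_cls[OF assms(2) y(1), of x] y assms that by simp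
  then have "(\<Sum>z\<in>C. f z) = (\<Sum>z\<in>C. f x)" by (intro sum.cong) auto
  then show ?thesis by simp
qed

text \<open>Transport of a class from \<open>q 0\<close> along the unrolled cycle. After
  \<open>k\<close> steps it is again a class at \<open>q 0\<close>, so comparing
  \<open>xs C k\<close> with \<open>C\<close> reads off the holonomy.\<close>

primrec xs :: "'b set \<Rightarrow> nat \<Rightarrow> 'b set" where
  "xs C 0 = C"
| "xs C (Suc i) = \<tau> (q (int i)) (q (int i + 1)) (xs C i)"

lemma xs_in: "C \<in> S' (q 0) \<Longrightarrow> xs C i \<in> S' (q (int i))"
proof (induction i)
  case (Suc i)
  then show ?case using Q.\<tau>_in[OF Q.icyc_adj(1)[OF q, of "int i"]] by (simp add: add.commute)
qed simp

lemma xs_inj: "C \<in> S' (q 0) \<Longrightarrow> D \<in> S' (q 0) \<Longrightarrow> xs C i = xs D i \<Longrightarrow> C = D"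
proof (induction i)
  case (Suc i)
  then show ?case
    using Q.\<tau>_eq_iff[OF Q.icyc_adj(1)[OF q, of "int i"] xs_in[OF Suc.prems(1)] xs_in[OF Suc.prems(2)]] by simp
qed simp

lemma q_period: "q (int (i + k)) = q (int i)" "q (int (i + k) + 1) = q (int i + 1)"
  by (rule Q.icyc_eq[OF q], simp)+

lemma xs_Suc_eq_iff:
  assumes "C \<in> S' (q 0)"
  shows "xs C (Suc (i + k)) = xs C (Suc i) \<longleftrightarrow> xs C (i + k) = xs C i"
  using Q.\<tau>_eq_iff[OF Q.icyc_adj(1)[OF q, of "int i"] _ xs_in[OF assms], of "xs C (i + k)"]
    xs_in[OF assms, of "i + k"] unfolding xs.simps q_period by simp

text \<open>The holonomy is known at position \<open>1\<close>; injectivity of transport moves the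
  comparison to position \<open>0\<close> and then to every \<open>i\<close>.\<close>

lemma xs_k:
  assumes "C \<in> S' (q 0)"
  shows "xs C (i + k) = xs C i \<longleftrightarrow> odd k"
proof (induction i)
  case 0
  have "xs C (Suc k) = xs C 1 \<longleftrightarrow> odd k"
    using xs_in[OF assms] by (intro Q.icyc_holonomy[OF q]) auto
  then show ?case using xs_Suc_eq_iff[OF assms, of 0] by simp
next
  case (Suc i)
  then show ?case using xs_Suc_eq_iff[OF assms, of i] by simp
qed

text \<open>Trivial holonomy gives \<open>xs C\<close> the period \<open>k\<close>, so the arbitrary
  index chosen in \<open>\<sigma>\<close> does not matter, and each of the two classes at
  \<open>q 0\<close> generates a strand. All class sums are \<open>t\<close> by
  \<open>icyc_F\<close>.\<close>

lemma odd_case: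
  assumes odd: "odd k"
  shows "constructible G X H f"
proof -
  define \<sigma> where "\<sigma> C v = xs C (SOME i. q (int i) = v)" for C v
  have \<sigma>q: "\<sigma> C (q (int i)) = xs C i" if C: "C \<in> S' (q 0)" for C i
  proof -
    define j where "j = (SOME j. q (int j) = q (int i))"
    have "q (int j) = q (int i)" unfolding j_def by (rule someI[of _ i]) simp
    then have "int k dvd int j - int i" using q unfolding Q.icyc_def by auto
    then have "xs C j = xs C i"
    proof (rule int_dvd_diff_cases)
      have per: "xs C (a + k * n) = xs C a" for a n using periodic_mult[of "xs C" k] xs_k[OF C] odd by blast
      show "xs C j = xs C i" if "j = i + k * n" for n using per that by simp
      show "xs C j = xs C i" if "i = j + k * n" for n using per that by simp
    qed
    then show ?thesis unfolding \<sigma>_def j_def .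
  qed
  have \<sigma>: "strand (\<sigma> C)" if C: "C \<in> S' (q 0)" for C
    unfolding strand_def
  proof (intro conjI ballI allI impI)
    fix v assume "v \<in> V"
    then obtain i where "v = q (int i)" using q_nat by blast
    then show "\<sigma> C v \<in> S' v" using \<sigma>q[OF C] xs_in[OF C] by simp
  next
    fix u v assume ad: "adj u v"
    obtain i where i: "i \<in> {1..k}" "u = q (int i)" using q_nat adj_V[OF ad] by blast
    then obtain j where j: "i = Suc j" by (cases i) auto
    have "v = q (int i + 1) \<or> v = q (int i - 1)" using Q.icyc_nbr[OF q] ad i by blast
    then show "\<tau> u v (\<sigma> C u) = \<sigma> C v"
    proof
      assume v: "v = q (int i + 1)"
      then have vq: "v = q (int (Suc i))" by (simp add: add.commute)
      have "\<sigma> C v = xs C (Suc i)" unfolding vq by (rule \<sigma>q[OF C])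
      then show ?thesis using v i(2) \<sigma>q[OF C, of i] by simp
    next
      assume "v = q (int i - 1)"
      then have v: "v = q (int j)" using j by simp
      have "\<tau> (q (int j + 1)) (q (int j)) (xs C (Suc j)) = xs C j"
        using Q.\<tau>_inv[OF Q.icyc_adj(1)[OF q, of "int j"] xs_in[OF C, of j]] by simp
      moreover have "u = q (int j + 1)" using i j by (simp add: add.commute)
      moreover have "\<sigma> C u = xs C (Suc j)" unfolding i(2) j by (rule \<sigma>q[OF C])
      ultimately show ?thesis using v \<sigma>q[OF C, of j] by simp
    qed
  qed
  obtain A B where AB: "S' (q 0) = {A, B}" "A \<noteq> B"
    using Q.icyc_card[OF q, of 0, unfolded card_2_iff] by (elim exE conjE)
  have A: "A \<in> S' (q 0)" and B: "B \<in> S' (q 0)" using AB by auto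
  have ne: "\<sigma> A v \<noteq> \<sigma> B v" if v: "v \<in> V" for v
  proof -
    obtain i where "v = q (int i)" using q_nat[OF v] by blast
    then have "\<sigma> A v = xs A i" "\<sigma> B v = xs B i" using \<sigma>q[OF A, of i] \<sigma>q[OF B, of i] by simp_all
    then show ?thesis using xs_inj[OF A B, of i] AB(2) by metis
  qed
  have dis: "\<sigma> A v \<inter> \<sigma> B v = {}" if v: "v \<in> V" for v
    using strand_cls(1)[OF \<sigma>[OF A] v] strand_cls(1)[OF \<sigma>[OF B] v] ne[OF v] by blast
  have all: "x \<in> \<sigma> A v \<union> \<sigma> B v" if v: "v \<in> V" and x: "x \<in> S v" for v x
  proof -
    obtain i where i: "v = q (int i)" using q_nat[OF v] by blast
    have c2: "card (S' v) = 2" using Q.icyc_card[OF q] i by simp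
    have sub: "{\<sigma> A v, \<sigma> B v} \<subseteq> S' v" using \<sigma>[OF A] \<sigma>[OF B] v unfolding strand_def by blast
    have "card {\<sigma> A v, \<sigma> B v} = 2" using ne[OF v] by simp
    then have "{\<sigma> A v, \<sigma> B v} = S' v" using sub c2 finS[OF v] by (intro card_subset_eq) auto
    then have "cls v x \<in> {\<sigma> A v, \<sigma> B v}" using x by blast
    then show ?thesis using cls_self[OF x] by auto
  qed
  have F: "(\<Sum>y\<in>\<sigma> C v. f y) = t" if C: "C \<in> S' (q 0)" and v: "v \<in> V" for C v
  proof -
    obtain i where i: "v = q (int i)" using q_nat[OF v] by blast
    show ?thesis using Q.icyc_F[OF q, of "\<sigma> C v" "int i"] \<sigma>[OF C] v i unfolding strand_def t_def by auto
  qed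
  define U where "U C = (\<Union>v\<in>V. \<sigma> C v)" for C
  have fib: "X v \<inter> U C = \<sigma> C v" if "C \<in> S' (q 0)" "v \<in> V" for C v
    unfolding U_def using strand_fib[OF \<sigma>] that by blast
  have "odd_C_configuration G X H f"
    unfolding odd_C_configuration_def
  proof (rule exI[of _ t], rule exI[of _ k], intro conjI)
    show "1 \<le> t" "3 \<le> k" "odd k" using t_pos k4 odd by auto
    show "\<exists>\<phi>. graph_iso \<phi> (times_graph t (cycle_graph k)) G" using iso by blast
    show "\<exists>U1 U2. U1 \<subseteq> verts H \<and> U2 \<subseteq> verts H \<and> U1 \<inter> U2 = {} \<and>
           restr_inflates_G_cover G X H U1 \<and> restr_inflates_G_cover G X H U2 \<and>
           (\<forall>v\<in>verts G. \<forall>x\<in>X v.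
              (x \<in> U1 \<longrightarrow> real (f x) = real t / real (card (X v \<inter> U1))) \<and>
              (x \<in> U2 \<longrightarrow> real (f x) = real t / real (card (X v \<inter> U2))) \<and>
              (x \<notin> U1 \<union> U2 \<longrightarrow> f x = 0))"
    proof (rule exI[of _ "U A"], rule exI[of _ "U B"], intro conjI ballI impI)
      show "U A \<subseteq> verts H" "U B \<subseteq> verts H" unfolding U_def by (rule strand_sub[OF \<sigma>], fact)+
      show "restr_inflates_G_cover G X H (U A)" "restr_inflates_G_cover G X H (U B)"
        unfolding U_def by (rule strand_cover[OF \<sigma>], fact)+
      have False if x: "x \<in> U A" "x \<in> U B" for x
      proof -
        obtain v where v: "v \<in> V" "x \<in> \<sigma> A v" using x(1) unfolding U_def by blast
        have "x \<in> X v" using v strand_X[OF \<sigma>[OF A]] by blast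
        then have "x \<in> \<sigma> B v" using fib[OF B v(1)] x(2) by blast
        then show False using dis[OF v(1)] v(2) by blast
      qed
      then show "U A \<inter> U B = {}" by blast
      fix v x assume v: "v \<in> V" and x: "x \<in> X v"
      show "real (f x) = real t / real (card (X v \<inter> U A))" if "x \<in> U A"
        using strand_value[OF \<sigma>[OF A] v x] that F[OF A v] unfolding U_def by simp
      show "real (f x) = real t / real (card (X v \<inter> U B))" if "x \<in> U B"
        using strand_value[OF \<sigma>[OF B] v x] that F[OF B v] unfolding U_def by simp
      show "f x = 0" if "x \<notin> U A \<union> U B"
      proof (rule ccontr)
        assume "f x \<noteq> 0"
        then have "x \<in> \<sigma> A v \<union> \<sigma> B v" using all[OF v, of x] x by auto
        then show False using that v unfolding U_def by blast
      qed
    qed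
  qed
  then show ?thesis using K3 uniform by blast
qed

text \<open>Transport around the cycle interchanges the two classes of a fibre. So a single class
  \<open>A\<close> generates a sequence of period \<open>2 * k\<close> that runs through all
  classes, and this is the long cycle of a double cover.\<close>

lemma even_case:
  assumes ev: "even k"
  shows "constructible G X H f"
proof -
  obtain A where A: "A \<in> S' (q 0)" using Q.two[OF qV, of 0] by blast
  define C where "C = xs A"
  have CS: "C i \<in> S' (q (int i))" for i unfolding C_def by (rule xs_in[OF A])
  have alt: "C (i + k) \<noteq> C i" for i unfolding C_def using xs_k[OF A] ev by blast
  have pair: "S' (q (int i)) = {C i, C (i + k)}" for i
  proof -
    have "C (i + k) \<in> S' (q (int i))" using CS[of "i + k"] unfolding q_period .
    then have "{C i, C (i + k)} \<subseteq> S' (q (int i))" using CS[of i] by blast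
    moreover have "card {C i, C (i + k)} = 2" using alt[of i] by simp
    ultimately have "{C i, C (i + k)} = S' (q (int i))"
      using Q.icyc_card[OF q, of "int i"] finS[OF qV] by (intro card_subset_eq) auto
    then show ?thesis by simp
  qed
  have per: "C (i + 2 * k) = C i" for i
  proof -
    have "C (i + k + k) \<in> S' (q (int i))" using CS[of "i + k + k"] unfolding q_period .
    then have "C (i + k + k) \<in> {C i, C (i + k)}" using pair by blast
    moreover have "C (i + k + k) \<noteq> C (i + k)" by (rule alt)
    moreover have "i + k + k = i + 2 * k" by simp
    ultimately show ?thesis by (metis insertE singletonD)
  qed
  have eq1: "C (j + k * n) = C j \<longleftrightarrow> even n" for j n
  proof (cases "even n")
    case True
    then obtain m where "n = 2 * m" by blast
    then have e: "j + k * n = j + 2 * k * m" by simp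
    show ?thesis unfolding e using periodic_mult[of C "2 * k" j m] per True by simp
  next
    case False
    then obtain m where "n = 2 * m + 1" by (rule oddE)
    then have e: "j + k * n = (j + k) + 2 * k * m" by (simp add: algebra_simps)
    show ?thesis unfolding e using periodic_mult[of C "2 * k" "j + k" m] per alt[of j] False by simp
  qed
  have dvd2: "int (2 * k) dvd int k * int n \<longleftrightarrow> even n" for n
    using k4 by (simp add: mult.commute)
  have eqv: "C i = C j \<longleftrightarrow> int (2 * k) dvd int i - int j" if "int k dvd int i - int j" for i j
    using that
  proof (rule int_dvd_diff_cases)
    fix n assume n: "i = j + k * n"
    then have "int i - int j = int k * int n" by simp
    then show ?thesis using eq1[of j n] dvd2[of n] n by (simp del: of_nat_mult)
  next
    fix n assume n: "j = i + k * n"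
    then have "int j - int i = int k * int n" by simp
    then have "int (2 * k) dvd int i - int j \<longleftrightarrow> even n" using dvd2[of n] by (metis dvd_diff_commute)
    then show ?thesis using eq1[of i n] n by metis
  qed
  have step: "\<tau> (q (int i)) (q (int i + 1)) (C i) = C (Suc i)" for i unfolding C_def by simp
  have C_cls: "C i = cls (q (int i)) x" "x \<in> S (q (int i))" if "x \<in> C i" for i x
  proof -
    obtain y where "C i = cls (q (int i)) y" using CS[of i] by blast
    then show "C i = cls (q (int i)) x" "x \<in> S (q (int i))"
      using that cls_eqI[of x "q (int i)" y] cls_subset[of "q (int i)" y] by auto
  qed
  have C_ne: "C i \<noteq> {}" for i
    using CS[of i] cls_self[of _ "q (int i)"] by blast
  have C_fin: "finite (C i)" for i
  proof -
    have "C i \<subseteq> S (q (int i))" using C_cls(2) by blast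
    then show ?thesis using finS[OF qV] by (rule finite_subset)
  qed
  define s where "s = card (C 0)"
  have cs: "card (C i) = s" for i
  proof (induction i)
    case (Suc i)
    obtain x where x: "x \<in> C i" using C_ne by blast
    from \<tau>_cls_ex[OF Q.icyc_adj(1)[OF q, of "int i"] C_cls(2)[OF x]]
    obtain y where y: "y \<in> S (q (int i + 1))" "0 < mult H x y"
      "\<tau> (q (int i)) (q (int i + 1)) (cls (q (int i)) x) = cls (q (int i + 1)) y" .
    have "C (Suc i) = cls (q (int i + 1)) y" using y(3) step[of i] C_cls(1)[OF x] by simp
    then show ?case
      using card_cls_eq[OF Q.icyc_adj(1)[OF q, of "int i"] C_cls(2)[OF x] y(1,2)] C_cls(1)[OF x] Suc by simp
  qed (simp add: s_def)
  have s1: "1 \<le> s" unfolding s_def using C_ne[of 0] C_fin[of 0] by (simp add: Suc_le_eq card_gt_0_iff)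
  define m where "m i j = (if int (2 * k) dvd int i - int j - 1 \<or> int (2 * k) dvd int j - int i - 1 then t else 0)" for i j
  have kd: "int k dvd d" if "int (2 * k) dvd d" for d
    using that by (metis dvd_mult_right dvd_trans int_dvd_int_iff dvd_triv_right)
  \<comment> \<open>Since \<open>k\<close> is at least four, \<open>j\<close> cannot follow and
    precede \<open>i\<close> modulo \<open>k\<close> at the same time.\<close>
  have no2: "\<not> int k dvd 2" "\<not> int k dvd - 2" using k4 Q.dvd_small[of k 2] Q.dvd_small[of k "-2"] by auto
  \<comment> \<open>The fibre at \<open>q (int j)\<close> holds two classes,
    \<open>C (Suc i)\<close> and the one \<open>k\<close> steps later. Only the first is adjacent to
    \<open>C i\<close>, and the residue of \<open>j\<close> modulo \<open>2 * k\<close> tells which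
    of them \<open>C j\<close> is.\<close>
  have fwd: "mult H x y * s = m i j" if xy: "x \<in> C i" "y \<in> C j" and d: "int k dvd int j - int i - 1" for i j x y
  proof -
    have qj: "q (int j) = q (int i + 1)" using Q.icyc_eq[OF q, of "int j" "int i + 1"] d by (simp add: algebra_simps)
    have ad: "adj (q (int i)) (q (int j))" using Q.icyc_adj(1)[OF q, of "int i"] qj by simp
    have nb: "C (Suc i) = {z \<in> S (q (int j)). 0 < mult H x z}"
      using \<tau>_cls_nbrs[OF ad C_cls(2)[OF xy(1)]] step[of i] C_cls(1)[OF xy(1)] qj by simp
    have n1: "\<not> int (2 * k) dvd int i - int j - 1"
    proof
      assume "int (2 * k) dvd int i - int j - 1"
      then have "int k dvd (int i - int j - 1) + (int j - int i - 1)" using d kd by (intro dvd_add) auto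
      then show False using no2 by simp
    qed
    have e: "int j - int (Suc i) = int j - int i - 1" by simp
    have iff: "C j = C (Suc i) \<longleftrightarrow> int (2 * k) dvd int j - int i - 1" using eqv[of j "Suc i"] d unfolding e by blast
    show ?thesis
    proof (cases "C j = C (Suc i)")
      case True
      then have "0 < mult H x y" using nb xy(2) by blast
      then have "mult H x y * card (cls (q (int j)) y) = mult G (q (int i)) (q (int j))"
        using a_card[OF ad C_cls(2)[OF xy(1)] C_cls(2)[OF xy(2)]] by blast
      moreover have "mult G (q (int i)) (q (int j)) = t" using mult_q d by simp
      ultimately show ?thesis using True iff C_cls(1)[OF xy(2)] cs[of j] unfolding m_def by simp
    next
      case False
      have "y \<notin> C (Suc i)"
      proof
        assume "y \<in> C (Suc i)"
        moreover have "q (int (Suc i)) = q (int j)" using qj by (simp add: add.commute)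
        ultimately show False using False C_cls(1)[of y "Suc i"] C_cls(1)[OF xy(2)] by simp
      qed
      then have "mult H x y = 0" unfolding nb using C_cls(2)[OF xy(2)] by simp
      then show ?thesis using False iff n1 unfolding m_def by simp
    qed
  qed
  have mC: "mult H x y * s = m i j" if xy: "x \<in> C i" "y \<in> C j" for i j x y
  proof -
    consider "int k dvd int j - int i - 1" | "int k dvd int i - int j - 1"
      | "\<not> int k dvd int j - int i - 1" "\<not> int k dvd int i - int j - 1" by blast
    then show ?thesis
    proof cases
      case 1
      then show ?thesis using fwd xy by blast
    next
      case 2
      then show ?thesis using fwd[OF xy(2,1)] a_sym[of x y] unfolding m_def by (simp add: disj_commute)
    next
      case 3
      then have m0: "m i j = 0" using kd unfolding m_def by auto
      have nad: "\<not> adj (q (int i)) (q (int j))" using 3 mult_q by simp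
      have "mult H x y = 0"
      proof (cases "q (int i) = q (int j)")
        case True
        then show ?thesis using coverD(5)[OF cov qV, of x "int i" y] C_cls(2)[OF xy(1)] C_cls(2)[OF xy(2)] by simp
      next
        case False
        then show ?thesis using a_zero[OF qV qV _ nad C_cls(2)[OF xy(1)] C_cls(2)[OF xy(2)]] by simp
      qed
      then show ?thesis using m0 by simp
    qed
  qed
  let ?I = "{1..2 * k}"
  have pk: "int k dvd int j - int j'" if "q (int j) = q (int j')" for j j' using that q unfolding Q.icyc_def by auto
  have bnd: "i = j" if "int (2 * k) dvd int i - int j" "i \<in> ?I" "j \<in> ?I" for i j
  proof -
    have "\<bar>int i - int j\<bar> < int (2 * k)" using that by auto
    then show ?thesis using Q.dvd_small[OF that(1)] by simp
  qed
  have dC: "disjoint_family_on C ?I"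
    unfolding disjoint_family_on_def
  proof (intro ballI impI, rule ccontr)
    fix i j assume ij: "i \<in> ?I" "j \<in> ?I" "i \<noteq> j" and "C i \<inter> C j \<noteq> {}"
    then obtain x where x: "x \<in> C i" "x \<in> C j" by blast
    have "x \<in> X (q (int i))" "x \<in> X (q (int j))" using C_cls(2)[OF x(1)] C_cls(2)[OF x(2)] by auto
    then have qq: "q (int i) = q (int j)" using cover_disjoint[OF cov qV qV] by blast
    then have "C i = C j" using C_cls(1)[OF x(1)] C_cls(1)[OF x(2)] by simp
    then show False using eqv[OF pk[OF qq]] bnd[of i j] ij by blast
  qed
  obtain r X0 H0 where R: "inj_on r ?I" "\<And>v. X0 v = r ` {i \<in> ?I. q (int i) = v}"
    "\<And>i j. i \<in> ?I \<Longrightarrow> j \<in> ?I \<Longrightarrow> mult H0 (r i) (r j) = m i j"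
    "cover G X0 H0" "is_inflation G X0 H0 (\<lambda>v. X v \<inter> (\<Union>i\<in>?I. C i)) (induced H (\<Union>i\<in>?I. C i))"
  proof (rule inflated_cover[OF G cov, of ?I "\<lambda>i. q (int i)" m C s])
    show "finite ?I" by simp
    show "q (int i) \<in> V" for i by (rule qV)
    show "m i j = m j i" for i j unfolding m_def by (simp add: disj_commute)
    show "m i j = 0" if "q (int i) = q (int j)" for i j
    proof -
      have "\<not> int k dvd int i - int j - 1" "\<not> int k dvd int j - int i - 1"
        using mult_q[of "int i" "int j"] that \<mu>_irrefl[of "q (int i)"] t_pos by (auto split: if_splits)
      then show ?thesis using kd unfolding m_def by auto
    qed
    show "m i j = 0 \<or> m i j = mult G (q (int i)) (q (int j))" for i j
      using kd[of "int i - int j - 1"] kd[of "int j - int i - 1"] unfolding m_def mult_q by auto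
    show "j = j'" if I: "i \<in> ?I" "j \<in> ?I" "j' \<in> ?I" and qq: "q (int j) = q (int j')" and m: "0 < m i j" "0 < m i j'" for i j j'
    proof -
      have d: "int (2 * k) dvd int i - int j - 1 \<or> int (2 * k) dvd int j - int i - 1"
        "int (2 * k) dvd int i - int j' - 1 \<or> int (2 * k) dvd int j' - int i - 1"
        using m unfolding m_def by (auto split: if_splits)
      \<comment> \<open>A successor and a predecessor of \<open>i\<close> never lie in the same
        fibre, as otherwise \<open>k\<close> would divide \<open>2\<close>.\<close>
      have x1: False if "int (2 * k) dvd int i - int a - 1" "int (2 * k) dvd int b - int i - 1" "int k dvd int a - int b" for a b
      proof -
        have "int k dvd (int i - int a - 1) + (int b - int i - 1) + (int a - int b)"
          using that kd by (intro dvd_add) auto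
        then show False using no2 by simp
      qed
      have kj: "int k dvd int j - int j'" "int k dvd int j' - int j" using pk[OF qq] pk[OF qq[symmetric]] by auto
      have "int (2 * k) dvd int j - int j'"
      proof -
        consider "int (2 * k) dvd int i - int j - 1" "int (2 * k) dvd int i - int j' - 1"
          | "int (2 * k) dvd int j - int i - 1" "int (2 * k) dvd int j' - int i - 1"
          using d x1[of j j'] x1[of j' j] kj by blast
        then show ?thesis
        proof cases
          case 1
          then have "int (2 * k) dvd (int i - int j' - 1) - (int i - int j - 1)" using dvd_diff by blast
          then show ?thesis by simp
        next
          case 2
          then have "int (2 * k) dvd (int j - int i - 1) - (int j' - int i - 1)" using dvd_diff by blast
          then show ?thesis by simp
        qed
      qed
      then show ?thesis using bnd I by blast
    qed
    show "C i \<subseteq> X (q (int i))" for i using C_cls(2) by blast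
    show "card (C i) = s" for i by (rule cs)
    show "1 \<le> s" by (rule s1)
    show "disjoint_family_on C ?I" by (rule dC)
    show "mult H x y * s = m i j" if "x \<in> C i" "y \<in> C j" for i j x y using mC[OF that] .
  qed blast
  have fibI: "{j \<in> ?I. q (int j) = q (int i)} = {i, k + i}" if i: "i \<in> {1..k}" for i
  proof
    show "{i, k + i} \<subseteq> {j \<in> ?I. q (int j) = q (int i)}" using i q_period(1)[of i] by (auto simp: add.commute)
    show "{j \<in> ?I. q (int j) = q (int i)} \<subseteq> {i, k + i}"
    proof
      fix j assume "j \<in> {j \<in> ?I. q (int j) = q (int i)}"
      then have j: "j \<in> ?I" and d: "int k dvd int j - int i" using pk by auto
      have b: "1 \<le> j" "j \<le> 2 * k" "1 \<le> i" "i \<le> k" using i j by auto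
      from d show "j \<in> {i, k + i}"
      proof (rule int_dvd_diff_cases)
        fix n assume n: "j = i + k * n"
        have "n < 2"
        proof (rule ccontr)
          assume "\<not> n < 2"
          then have "k * 2 \<le> k * n" by (intro mult_le_mono2) simp
          then show False using n b by linarith
        qed
        then have "n = 0 \<or> n = 1" by auto
        then show ?thesis using n by auto
      next
        fix n assume n: "i = j + k * n"
        have "n < 1"
        proof (rule ccontr)
          assume "\<not> n < 1"
          then have "k * 1 \<le> k * n" by (intro mult_le_mono2) simp
          then show False using n b by linarith
        qed
        then show ?thesis using n by auto
      qed
    qed
  qed
  have dbl: "is_double_cover t k G X0 H0"
    unfolding is_double_cover_def
  proof (intro conjI exI[of _ "\<lambda>i. q (int i)"] exI[of _ r] ballI)
    show "cover G X0 H0" by fact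
    show "graph_iso (\<lambda>i. q (int i)) (times_graph t (cycle_graph k)) G" by (rule iso)
    show "inj_on r ?I" by fact
    show "X0 (q (int i)) = {r i, r (k + i)}" if "i \<in> {1..k}" for i unfolding R(2) fibI[OF that] by simp
    show "mult H0 (r i) (r j) = (if [i = j + 1] (mod (2 * k)) \<or> [j = i + 1] (mod (2 * k)) then t else 0)"
      if "i \<in> ?I" "j \<in> ?I" for i j
      unfolding R(3)[OF that] m_def cong_Suc_iff_dvd by simp
  qed
  let ?U = "\<Union>i\<in>?I. C i"
  have XU: "X (q (int i)) \<inter> ?U = C i \<union> C (k + i)" if i: "i \<in> {1..k}" for i
  proof
    show "X (q (int i)) \<inter> ?U \<subseteq> C i \<union> C (k + i)"
    proof
      fix x assume x: "x \<in> X (q (int i)) \<inter> ?U"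
      then obtain j where j: "j \<in> ?I" "x \<in> C j" by blast
      have "x \<in> X (q (int j))" using C_cls(2)[OF j(2)] by simp
      then have "q (int j) = q (int i)" using cover_disjoint[OF cov qV qV] x by blast
      then have "j \<in> {i, k + i}" using fibI[OF i] j by blast
      then show "x \<in> C i \<union> C (k + i)" using j by blast
    qed
    have "q (int (k + i)) = q (int i)" using q_period(1)[of i] by (simp add: add.commute)
    then have "C i \<subseteq> X (q (int i))" "C (k + i) \<subseteq> X (q (int i))" using C_cls(2)[of _ i] C_cls(2)[of _ "k + i"] by auto
    moreover have "i \<in> ?I" "k + i \<in> ?I" using i by auto
    ultimately show "C i \<union> C (k + i) \<subseteq> X (q (int i)) \<inter> ?U" by blast
  qed
  have cU: "card (X (q (int i)) \<inter> ?U) = 2 * s" if i: "i \<in> {1..k}" for i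
  proof -
    have "i \<in> ?I" "k + i \<in> ?I" "i \<noteq> k + i" using i k4 by auto
    then have "C i \<inter> C (k + i) = {}" using dC unfolding disjoint_family_on_def by blast
    then show ?thesis unfolding XU[OF i] using C_fin cs by (simp add: card_Un_disjoint)
  qed
  have "even_C_configuration G X H f"
    unfolding even_C_configuration_def
  proof (rule exI[of _ t], rule exI[of _ k], intro conjI exI[of _ ?U] ballI impI)
    show "1 \<le> t" "4 \<le> k" "even k" using t_pos k4 ev by auto
    show "\<exists>\<phi>. graph_iso \<phi> (times_graph t (cycle_graph k)) G" using iso by blast
    show "?U \<subseteq> verts H"
    proof
      fix x assume "x \<in> ?U"
      then obtain i where "x \<in> C i" by blast
      then have "x \<in> X (q (int i))" using C_cls(2) by blast
      then show "x \<in> verts H" using coverD(4)[OF cov qV] by blast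
    qed
    show "restr_inflates_double_cover t k G X H ?U"
      unfolding restr_inflates_double_cover_def using dbl R(5) by blast
    fix v x assume v: "v \<in> V" and x: "x \<in> X v"
    obtain i where i: "i \<in> {1..k}" "v = q (int i)" using q_nat[OF v] by blast
    show "real (f x) = 2 * real t / real (card (X v \<inter> ?U))" if xU: "x \<in> ?U"
    proof -
      obtain j where j: "j \<in> ?I" "x \<in> C j" using xU by blast
      \<comment> \<open>A single class has sum \<open>t\<close> and size \<open>s\<close>. The
        factors \<open>2\<close> in the target cancel: \<open>U\<close> meets each fibre in two
        classes.\<close>
      have "f x * s = t"
        using class_f[OF CS[of j] qV j(2)] Q.icyc_F[OF q CS[of j]] cs[of j] unfolding t_def by simp
      then have "real (f x) * real s = real t" by (metis of_nat_mult)
      then show ?thesis unfolding i(2) cU[OF i(1)] using s1 by (simp add: field_simps)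
    qed
    show "f x = 0" if "x \<notin> ?U"
    proof (rule ccontr)
      assume "f x \<noteq> 0"
      then have xS: "x \<in> S v" using x by simp
      then have "cls v x \<in> {C i, C (i + k)}" using pair[of i] i(2) by blast
      then have "x \<in> C i \<union> C (k + i)" using cls_self[OF xS] by (auto simp: add.commute)
      moreover have "i \<in> ?I" "k + i \<in> ?I" using i by auto
      ultimately show False using that by blast
    qed
  qed
  then show ?thesis using K4 uniform by blast
qed

end

lemma (in block_config) block_constructible: "constructible G X H f"
proof (cases "\<forall>u\<in>V. \<exists>x\<in>S u. \<exists>y\<in>S u. cls u x \<noteq> cls u y")
  case False
  then show ?thesis using one_class by blast
next
  case True
  then have two: "\<And>u. u \<in> V \<Longrightarrow> \<exists>x\<in>S u. \<exists>y\<in>S u. cls u x \<noteq> cls u y" by blast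
  interpret Q: hole_system V "mult G" "\<lambda>u. cls u ` S u" \<tau> "\<lambda>u C. \<Sum>y\<in>C. f y"
    "\<lambda>u C. \<exists>c. St u c \<and> C = (\<lambda>w. cls w (c w))"
    by (rule quotient_hole_system) (rule two)
  show ?thesis
  proof (cases "\<forall>u\<in>V. \<forall>v\<in>V. u \<noteq> v \<longrightarrow> adj u v")
    case True
    then show ?thesis using complete_case[OF two] by blast
  next
    case False
    then obtain k q where kq: "Q.icyc k q" using Q.complete_or_cycle by blast
    interpret cyclic_config G X H f St k q
      by unfold_locales (use two kq in auto)
    show ?thesis using odd_case even_case by blast
  qed
qed

section \<open>Cut vertices\<close>

lemma good_cong_mult:
  assumes "\<And>v w. v \<in> D \<Longrightarrow> w \<in> D \<Longrightarrow> c v \<in> X v \<Longrightarrow> c w \<in> X w \<Longrightarrow> a (c v) (c w) = a' (c v) (c w)"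
    and g: "good X a f D c"
  shows "good X a' f D c"
  unfolding good_def
proof (intro conjI allI impI)
  show cX: "\<forall>v\<in>D. c v \<in> X v" using g unfolding good_def by (elim conjE)
  fix W assume W: "W \<subseteq> D" "W \<noteq> {}"
  then obtain v where v: "v \<in> W" "(\<Sum>w\<in>W. a (c v) (c w)) < f (c v)" using g unfolding good_def by meson
  have "(\<Sum>w\<in>W. a (c v) (c w)) = (\<Sum>w\<in>W. a' (c v) (c w))"
    using v(1) W(1) cX by (intro sum.cong assms(1)) auto
  then show "\<exists>v\<in>W. (\<Sum>w\<in>W. a' (c v) (c w)) < f (c v)" using v by auto
qed

context uncolorable
begin

text \<open>The vertex \<open>w\<close> is coloured first, which is good because \<open>x\<close>
  has positive value. As \<open>w\<close> is not a cut vertex, the rest is connected and can be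
  coloured greedily towards \<open>u\<close>.\<close>

lemma hole_prescribed:
  assumes cm: "\<And>v. v \<in> V \<Longrightarrow> conn adj (V - {v})"
    and uw: "u \<in> V" "w \<in> V" "u \<noteq> w" and x: "x \<in> X w" "0 < f x"
  shows "\<exists>c. good X a f (V - {u}) c \<and> c w = x"
proof -
  have g: "good X a f {w} (\<lambda>_. x)"
    unfolding good_def
  proof (intro conjI allI impI ballI)
    show "x \<in> X v" if "v \<in> {w}" for v using that x by simp
    fix W assume "W \<subseteq> {w}" "W \<noteq> {}"
    then have "W = {w}" by blast
    then show "\<exists>v\<in>W. (\<Sum>w\<in>W. a x x) < f x" using x a_irrefl by simp
  qed
  have "\<exists>c'. good X a f (V - {u}) c' \<and> (\<forall>v\<in>{w}. c' v = x)"
    by (rule greedy_extend[OF _ cm[OF uw(2)] _ g]) (use uw feas in auto)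
  then show ?thesis by blast
qed

text \<open>A colour \<open>y\<close> of value zero sees no coloured edge by tightness, in
  particular none from \<open>x\<close>; so restricting the full row to colours of positive value
  loses nothing.\<close>

lemma hole_row:
  assumes cm: "\<And>v. v \<in> V \<Longrightarrow> conn adj (V - {v})"
    and uw: "u \<in> V" "w \<in> V" "u \<noteq> w" and x: "x \<in> X w" "0 < f x"
  shows "(\<Sum>y\<in>{y \<in> X u. 0 < f y}. a x y) = \<mu> w u"
proof -
  obtain c where c: "good X a f (V - {u}) c" "c w = x" using hole_prescribed[OF assms] by blast
  have w: "w \<in> V - {u}" using uw by simp
  have "a x y = 0" if y: "y \<in> X u" "f y = 0" for y
  proof -
    have "(\<Sum>w\<in>V - {u}. a (c w) y) = 0" using hole_tight(1)[OF uw(1) c(1) y(1)] y(2) by simp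
    then show ?thesis using finV w c(2) by auto
  qed
  then have "(\<Sum>y\<in>{y \<in> X u. 0 < f y}. a x y) = (\<Sum>y\<in>X u. a x y)"
    using finX[OF uw(1)] by (intro sum.mono_neutral_left) auto
  also have "\<dots> = \<mu> u w" using hole_tight(3)[OF uw(1) c(1) w] c(2) by simp
  finally show ?thesis by (simp add: \<mu>_sym)
qed

lemma uncolorable_hole_cover:
  assumes cm: "\<And>v. v \<in> V \<Longrightarrow> conn adj (V - {v})" and mV: "\<And>u v. adj u v \<Longrightarrow> u \<in> V"
  shows "hole_cover V \<mu> (\<lambda>v. {x \<in> X v. 0 < f x}) a f (\<lambda>u c. u \<in> V \<and> good X a f (V - {u}) c)"
proof
  show "disjoint_family_on (\<lambda>v. {x \<in> X v. 0 < f x}) V"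
    using disjX unfolding disjoint_family_on_def by blast
  show "(\<Sum>y\<in>{y \<in> X u. 0 < f y}. a x y) = \<mu> w u" if "u \<in> V" "w \<in> V" "u \<noteq> w" "x \<in> {x \<in> X w. 0 < f x}" for u w x
    using hole_row[OF cm that(1-3)] that(4) by blast
  show "c w \<in> {x \<in> X w. 0 < f x}" if st: "u \<in> V \<and> good X a f (V - {u}) c" and w: "w \<in> V" "w \<noteq> u" for u c w
  proof -
    have g: "good X a f (V - {u}) c" and wV: "w \<in> V - {u}" using st w by auto
    have "{w} \<subseteq> V - {u}" using wV by blast
    from good_mono[OF g this] have g1: "good X a f {w} c" .
    have "c w \<in> X w" using g1 unfolding good_def by simp
    moreover have "(\<exists>v\<in>{w}. (\<Sum>w\<in>{w}. a (c v) (c w)) < f (c v))"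
      using g1 unfolding good_def by (elim conjE allE[of _ "{w}"]) blast
    ultimately show ?thesis by (simp add: a_irrefl)
  qed
  show "f y = (\<Sum>w\<in>V - {u}. a (c w) y)" if "u \<in> V \<and> good X a f (V - {u}) c" "y \<in> {x \<in> X u. 0 < f x}" for u c y
    using hole_tight(1)[of u c y] that by blast
  show "w \<in> V \<and> good X a f (V - {w}) (c(u := y))"
    if "u \<in> V \<and> good X a f (V - {u}) c" "w \<in> V" "w \<noteq> u" "y \<in> {x \<in> X u. 0 < f x}" "0 < a (c w) y" for u c w y
    using hole_shift[of u c w y] that by blast
  show "\<exists>c. (u \<in> V \<and> good X a f (V - {u}) c) \<and> c w = x"
    if "u \<in> V" "w \<in> V" "u \<noteq> w" "x \<in> {x \<in> X w. 0 < f x}" for u w x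
    using hole_prescribed[OF cm that(1-3)] that by blast
qed (use finV \<mu>_sym \<mu>_irrefl mV conn cm finX a_sym in auto)

text \<open>The share of the cut vertex \<open>v\<close> in the part \<open>V'\<close>: the largest value at \<open>x\<close> that still does
  not allow to extend \<open>x\<close> to a colouring of \<open>V'\<close>.\<close>

lemma part_weight:
  assumes V': "V' \<subseteq> V" and v: "v \<in> V'" and conn': "conn adj V'"
    and sep: "\<And>w z. w \<in> V' \<Longrightarrow> w \<noteq> v \<Longrightarrow> z \<in> V - V' \<Longrightarrow> \<mu> w z = 0"
  shows "\<exists>g. (\<forall>x\<in>X v. \<exists>c. good X a (f(x := Suc (g x))) V' c \<and> c v = x) \<and>
    (\<forall>c. \<not> good X a (\<lambda>y. if y \<in> X v then g y else f y) V' c) \<and>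
    (\<Sum>x\<in>X v. g x) \<le> (\<Sum>w\<in>V'. \<mu> v w)"
proof -
  interpret P: fibred V' \<mu> X a by (rule fibred_subset[OF V'])
  have vV: "v \<in> V" using v V' by blast
  have dis: "x \<notin> X v" if "w \<in> V'" "w \<noteq> v" "x \<in> X w" for w x
    using disjX that V' v unfolding disjoint_family_on_def by blast
  have feas': "(\<Sum>z\<in>V'. \<mu> w z) \<le> (\<Sum>y\<in>X w. f y)" if w: "w \<in> V'" "w \<noteq> v" for w
  proof -
    have "(\<Sum>z\<in>V'. \<mu> w z) = (\<Sum>z\<in>V. \<mu> w z)"
      using finV V' sep[OF w] by (intro sum.mono_neutral_left) auto
    then show ?thesis using feas[of w] w V' by auto
  qed
  have "\<exists>c'. good X a f (V' - {v}) c' \<and> (\<forall>v\<in>{}. c' v = undefined v)"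
    by (rule P.greedy_extend) (use v conn' feas' good_empty in auto)
  then obtain c0 where c0: "good X a f (V' - {v}) c0" by blast
  \<comment> \<open>A large enough value always works: with the rest coloured by \<open>c0\<close>,
    the value \<open>Suc k\<close> exceeds the number \<open>k\<close> of coloured edges at
    \<open>x\<close>.\<close>
  have ex: "\<exists>k c. good X a (f(x := Suc k)) V' c \<and> c v = x" if x: "x \<in> X v" for x
  proof -
    define k where "k = (\<Sum>w\<in>V' - {v}. a x (c0 w))"
    have "c0 w \<in> X w" if "w \<in> V' - {v}" for w using c0 that unfolding good_def by (elim conjE) blast
    then have "c0 w \<noteq> x" if "w \<in> V' - {v}" for w using dis[of w "c0 w"] that x by auto
    then have "good X a (f(x := Suc k)) (V' - {v}) c0"
      using c0 good_cong[of "V' - {v}" c0 c0 f "f(x := Suc k)" X a] by simp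
    from good_extend[OF this _ _ x a_irrefl, of] P.finV
    have "good X a (f(x := Suc k)) (insert v (V' - {v})) (c0(v := x))" by (simp add: k_def)
    moreover have "insert v (V' - {v}) = V'" using v by blast
    ultimately show ?thesis by (metis fun_upd_same)
  qed
  define g where "g x = (LEAST k. \<exists>c. good X a (f(x := Suc k)) V' c \<and> c v = x)" for x
  have g1: "\<exists>c. good X a (f(x := Suc (g x))) V' c \<and> c v = x" if "x \<in> X v" for x
    unfolding g_def using LeastI_ex[OF ex[OF that]] .
  let ?g = "\<lambda>y. if y \<in> X v then g y else f y"
  \<comment> \<open>A colouring with \<open>c v = x\<close> requires \<open>0 < g x\<close>, by the
    set \<open>{v}\<close>. Then the predecessor of \<open>g x\<close> already satisfies the
    condition of which \<open>g x\<close> is the least solution.\<close>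
  have unc: "\<not> good X a ?g V' c" for c
  proof
    assume gd: "good X a ?g V' c"
    have cX: "c w \<in> X w" if "w \<in> V'" for w using gd that unfolding good_def by (elim conjE) blast
    define x where "x = c v"
    have x: "x \<in> X v" using cX[OF v] x_def by simp
    have "{v} \<subseteq> V'" using v by blast
    from good_mono[OF gd this] have "\<exists>v\<in>{v}. (\<Sum>w\<in>{v}. a (c v) (c w)) < ?g (c v)"
      unfolding good_def by (elim conjE allE[of _ "{v}"]) blast
    then have "0 < g x" using x unfolding x_def by (simp add: a_irrefl)
    then obtain k where k: "g x = Suc k" by (cases "g x") auto
    have "good X a (f(x := Suc k)) V' c"
    proof -
      have "?g (c w) = (f(x := Suc k)) (c w)" if w: "w \<in> V'" for w
      proof (cases "w = v")
        case True
        then show ?thesis using x k unfolding x_def by simp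
      next
        case False
        have "c w \<notin> X v" using dis[OF w False cX[OF w]] .
        then show ?thesis using x by auto
      qed
      then show ?thesis using gd good_cong[of V' c c ?g "f(x := Suc k)" X a] by blast
    qed
    then have "\<exists>c. good X a (f(x := Suc k)) V' c \<and> c v = x" using x_def by blast
    then have "g x \<le> k" unfolding g_def by (rule Least_le)
    then show False using k by simp
  qed
  \<comment> \<open>If the sum exceeded the degree, the part with the values \<open>g\<close> would
    be feasible and uncolorable, and \<open>hole_sum\<close> would force equality.\<close>
  have le: "(\<Sum>x\<in>X v. g x) \<le> (\<Sum>w\<in>V'. \<mu> v w)"
  proof (rule ccontr)
    assume gt: "\<not> ?thesis"
    have gv: "(\<Sum>y\<in>X v. ?g y) = (\<Sum>x\<in>X v. g x)" by (intro sum.cong) auto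
    have go: "(\<Sum>y\<in>X w. ?g y) = (\<Sum>x\<in>X w. f x)" if "w \<in> V'" "w \<noteq> v" for w
      using dis[OF that] by (intro sum.cong) auto
    interpret U: uncolorable V' \<mu> X a ?g
    proof
      show "conn adj V'" by (rule conn')
      show "(\<Sum>w\<in>V'. \<mu> u w) \<le> (\<Sum>y\<in>X u. ?g y)" if "u \<in> V'" for u
        using gv go[OF that] feas'[OF that] gt by (cases "u = v") auto
      show "\<not> good X a ?g V' c" for c by (rule unc)
    qed
    show False using U.hole_sum[OF v] gv gt by simp
  qed
  show ?thesis using g1 unc le by blast
qed

text \<open>If \<open>f x\<close> exceeded \<open>f1 x + f2 x\<close>, colourings of the parts with
  \<open>c v = x\<close> and values \<open>Suc (f1 x)\<close>, \<open>Suc (f2 x)\<close> could be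
  glued to one of \<open>V\<close>. So \<open>f \<le> f1 + f2\<close> on \<open>X v\<close>, while
  the sums of \<open>f1\<close> and \<open>f2\<close> are at most the degrees of \<open>v\<close> in
  the parts, which add up to at most the sum of \<open>f\<close>. Equality follows throughout, and
  the parts are feasible at \<open>v\<close>.\<close>

lemma cut_split:
  assumes v: "v \<in> V" and A: "A \<subseteq> V - {v}" "A \<noteq> {}" "A \<noteq> V - {v}"
    and sep: "\<And>x y. x \<in> A \<Longrightarrow> y \<in> V - {v} - A \<Longrightarrow> \<mu> x y = 0"
  shows "conn adj (insert v A)" "conn adj (V - A)"
    "\<exists>f1 f2. (\<forall>x\<in>X v. f x = f1 x + f2 x) \<and>
      uncolorable (insert v A) \<mu> X a (\<lambda>y. if y \<in> X v then f1 y else f y) \<and>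
      uncolorable (V - A) \<mu> X a (\<lambda>y. if y \<in> X v then f2 y else f y)"
proof -
  define V1 V2 where "V1 = insert v A" and "V2 = V - A"
  have sub: "V1 \<subseteq> V" "V2 \<subseteq> V" and v12: "v \<in> V1" "v \<in> V2" using v A unfolding V1_def V2_def by auto
  have sep': "\<mu> x y = 0" if "x \<in> V - {v} - A" "y \<in> A" for x y using sep[OF that(2,1)] \<mu>_sym by simp
  \<comment> \<open>An edge of \<open>V\<close> leaving a subset of \<open>P\<close> that avoids
    \<open>v\<close> ends in \<open>P\<close> by \<open>cl\<close>. A subset containing
    \<open>v\<close> is replaced by its complement in \<open>P\<close>, as adjacency is
    symmetric.\<close>
  have half: "conn adj P" if P: "P \<subseteq> V" "v \<in> P"
    and cl: "\<And>x y. x \<in> P \<Longrightarrow> x \<noteq> v \<Longrightarrow> y \<in> V \<Longrightarrow> adj x y \<Longrightarrow> y \<in> P" for P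
    unfolding conn_def
  proof (intro conjI allI impI)
    show "P \<noteq> {}" using P by blast
    fix B assume B: "B \<subseteq> P \<and> B \<noteq> {} \<and> B \<noteq> P"
    have key: "\<exists>x\<in>B'. \<exists>y\<in>P - B'. adj x y" if B': "B' \<subseteq> P" "B' \<noteq> {}" "v \<notin> B'" for B'
    proof -
      have "B' \<noteq> V" using B' v by blast
      then obtain x y where "x \<in> B'" "y \<in> V" "y \<notin> B'" "adj x y" using connD[OF conn, of B'] B' P by blast
      moreover have "y \<in> P" using cl[of x y] calculation B' by blast
      ultimately show ?thesis by blast
    qed
    show "\<exists>x\<in>B. \<exists>y\<in>P - B. adj x y"
    proof (cases "v \<in> B")
      case False
      then show ?thesis using key B by blast
    next
      case True
      then have "P - B \<subseteq> P" "P - B \<noteq> {}" "v \<notin> P - B" using B by auto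
      from key[OF this] obtain x y where xy: "x \<in> P - B" "y \<in> P - (P - B)" "adj x y" by blast
      then have "y \<in> B" "adj y x" using \<mu>_sym[of x y] by auto
      then show ?thesis using xy(1) by blast
    qed
  qed
  have conn1: "conn adj V1"
  proof (rule half[OF sub(1) v12(1)])
    fix x y assume "x \<in> V1" "x \<noteq> v" "y \<in> V" and ad: "adj x y"
    then have "x \<in> A" unfolding V1_def by blast
    show "y \<in> V1"
    proof (rule ccontr)
      assume "y \<notin> V1"
      then have "\<mu> x y = 0" using sep[OF \<open>x \<in> A\<close>, of y] \<open>y \<in> V\<close> unfolding V1_def by blast
      then show False using ad by simp
    qed
  qed
  have conn2: "conn adj V2"
  proof (rule half[OF sub(2) v12(2)])
    fix x y assume x: "x \<in> V2" "x \<noteq> v" "y \<in> V" and ad: "adj x y"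
    show "y \<in> V2"
    proof (rule ccontr)
      assume "y \<notin> V2"
      then have "\<mu> x y = 0" using sep'[of x y] x unfolding V2_def by blast
      then show False using ad by simp
    qed
  qed
  show "conn adj (insert v A)" "conn adj (V - A)" using conn1 conn2 unfolding V1_def V2_def by auto
  have s1: "\<mu> w z = 0" if "w \<in> V1" "w \<noteq> v" "z \<in> V - V1" for w z
    using sep[of w z] that unfolding V1_def by blast
  have s2: "\<mu> w z = 0" if "w \<in> V2" "w \<noteq> v" "z \<in> V - V2" for w z
    using sep'[of w z] that unfolding V2_def by blast
  obtain f1 where f1: "\<And>x. x \<in> X v \<Longrightarrow> \<exists>c. good X a (f(x := Suc (f1 x))) V1 c \<and> c v = x"
    "\<And>c. \<not> good X a (\<lambda>y. if y \<in> X v then f1 y else f y) V1 c" "(\<Sum>x\<in>X v. f1 x) \<le> (\<Sum>w\<in>V1. \<mu> v w)"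
    using part_weight[OF sub(1) v12(1) conn1 s1] by blast
  obtain f2 where f2: "\<And>x. x \<in> X v \<Longrightarrow> \<exists>c. good X a (f(x := Suc (f2 x))) V2 c \<and> c v = x"
    "\<And>c. \<not> good X a (\<lambda>y. if y \<in> X v then f2 y else f y) V2 c" "(\<Sum>x\<in>X v. f2 x) \<le> (\<Sum>w\<in>V2. \<mu> v w)"
    using part_weight[OF sub(2) v12(2) conn2 s2] by blast
  have cross: "a x y = 0" if "u \<in> V" "w \<in> V" "u \<noteq> w" "\<mu> u w = 0" "x \<in> X u" "y \<in> X w" for u w x y
    using row_le[OF that(1-3) that(5)] that finX by simp
  have le: "f x \<le> f1 x + f2 x" if x: "x \<in> X v" for x
  proof (rule ccontr)
    assume gt: "\<not> ?thesis"
    obtain c1 where c1: "good X a (f(x := Suc (f1 x))) V1 c1" "c1 v = x" using f1(1)[OF x] by blast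
    obtain c2 where c2: "good X a (f(x := Suc (f2 x))) V2 c2" "c2 v = x" using f2(1)[OF x] by blast
    define c where "c w = (if w \<in> V1 then c1 w else c2 w)" for w
    have cV1: "c w = c1 w" if "w \<in> V1" for w using that c_def by simp
    have cV2: "c w = c2 w" if "w \<in> V2" for w
    proof (cases "w = v")
      case True
      then show ?thesis using c1(2) c2(2) v12 c_def by simp
    next
      case False
      then show ?thesis using that unfolding c_def V1_def V2_def by simp
    qed
    have g1: "good X a (f(x := Suc (f1 x))) V1 c" using c1(1) cV1 good_cong[of V1 c c1 _ "f(x := Suc (f1 x))" X a] by blast
    have g2: "good X a (f(x := Suc (f2 x))) V2 c" using c2(1) cV2 good_cong[of V2 c c2 _ "f(x := Suc (f2 x))" X a] by blast
    have cx: "c v = x" using cV1[OF v12(1)] c1(2) by simp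
    have VV: "V = V1 \<union> V2" using sub v A unfolding V1_def V2_def by auto
    have cX: "c w \<in> X w" if w: "w \<in> V" for w using g1 g2 w VV unfolding good_def by (elim conjE) blast
    have cn: "c w \<noteq> x" if w: "w \<in> V" "w \<noteq> v" for w
      using cX[OF w(1)] x disjX w v unfolding disjoint_family_on_def by blast
    have "good X a f V c"
      unfolding good_def
    proof (intro conjI ballI allI impI)
      show "c w \<in> X w" if "w \<in> V" for w using cX[OF that] .
      fix W assume W: "W \<subseteq> V" "W \<noteq> {}"
      have loc: "\<exists>u\<in>W \<inter> P. (\<Sum>w\<in>W \<inter> P. a (c u) (c w)) < (f(x := m)) (c u)"
        if "good X a (f(x := m)) P c" "W \<inter> P \<noteq> {}" for P m
        using that unfolding good_def by (meson inf_le2)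
      have other: "(\<Sum>w\<in>W \<inter> P. a (c u) (c w)) = (\<Sum>w\<in>W. a (c u) (c w))"
        if u: "u \<in> W \<inter> P" "u \<noteq> v" and P: "P \<subseteq> V" "\<And>w z. w \<in> P \<Longrightarrow> w \<noteq> v \<Longrightarrow> z \<in> V - P \<Longrightarrow> \<mu> w z = 0" for P u
      proof (rule sum.mono_neutral_left)
        show "finite W" using W finV finite_subset by blast
        show "\<forall>w\<in>W - W \<inter> P. a (c u) (c w) = 0"
        proof
          fix w assume w: "w \<in> W - W \<inter> P"
          show "a (c u) (c w) = 0"
            by (rule cross[of u w]) (use u w W P cX in auto)
        qed
      qed auto
      have wit: "\<exists>u\<in>W. (\<Sum>w\<in>W. a (c u) (c w)) < f (c u)"
        if u: "u \<in> W \<inter> P" "u \<noteq> v" "(\<Sum>w\<in>W \<inter> P. a (c u) (c w)) < (f(x := m)) (c u)"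
          and P: "P \<subseteq> V" "\<And>w z. w \<in> P \<Longrightarrow> w \<noteq> v \<Longrightarrow> z \<in> V - P \<Longrightarrow> \<mu> w z = 0" for P u m
      proof -
        have "(f(x := m)) (c u) = f (c u)" using cn[of u] u W by auto
        then show ?thesis using other[OF u(1,2) P] u by auto
      qed
      show "\<exists>u\<in>W. (\<Sum>w\<in>W. a (c u) (c w)) < f (c u)"
      proof (cases "v \<in> W")
        case False
        show ?thesis
        proof (cases "W \<inter> V1 = {}")
          case True
          then have "W \<inter> V2 \<noteq> {}" using W VV by blast
          from loc[OF g2 this] obtain u where "u \<in> W \<inter> V2" "(\<Sum>w\<in>W \<inter> V2. a (c u) (c w)) < (f(x := Suc (f2 x))) (c u)" by blast
          then show ?thesis using wit[OF _ _ _ sub(2) s2] False by blast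
        next
          case False
          from loc[OF g1 this] obtain u where "u \<in> W \<inter> V1" "(\<Sum>w\<in>W \<inter> V1. a (c u) (c w)) < (f(x := Suc (f1 x))) (c u)" by blast
          then show ?thesis using wit[OF _ _ _ sub(1) s1] \<open>v \<notin> W\<close> by blast
        qed
      next
        case True
        have ne: "W \<inter> V1 \<noteq> {}" "W \<inter> V2 \<noteq> {}" using True v12 by auto
        from loc[OF g1 ne(1)] obtain u1 where u1: "u1 \<in> W \<inter> V1" "(\<Sum>w\<in>W \<inter> V1. a (c u1) (c w)) < (f(x := Suc (f1 x))) (c u1)" by blast
        from loc[OF g2 ne(2)] obtain u2 where u2: "u2 \<in> W \<inter> V2" "(\<Sum>w\<in>W \<inter> V2. a (c u2) (c w)) < (f(x := Suc (f2 x))) (c u2)" by blast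
        \<comment> \<open>A witness other than \<open>v\<close> has no edges to colours of the other
          part, so it serves for \<open>W\<close> as well. If both witnesses are \<open>v\<close>,
          its degrees in the parts are at most \<open>f1 x\<close> and \<open>f2 x\<close>, which
          together stay below \<open>f x\<close>.\<close>
        show ?thesis
        proof (cases "u1 = v \<and> u2 = v")
          case False
          then show ?thesis using wit[OF u1(1) _ u1(2) sub(1) s1] wit[OF u2(1) _ u2(2) sub(2) s2] by blast
        next
          case both: True
          have fW: "finite W" using W finV finite_subset by blast
          have "W = (W \<inter> V1) \<union> (W \<inter> (V2 - {v}))" using W VV True v12 by blast
          then have "(\<Sum>w\<in>W. a x (c w)) = (\<Sum>w\<in>(W \<inter> V1) \<union> (W \<inter> (V2 - {v})). a x (c w))" by simp
          also have "\<dots> = (\<Sum>w\<in>W \<inter> V1. a x (c w)) + (\<Sum>w\<in>W \<inter> (V2 - {v}). a x (c w))"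
            using fW by (intro sum.union_disjoint) (auto simp: V1_def V2_def)
          also have "(\<Sum>w\<in>W \<inter> (V2 - {v}). a x (c w)) \<le> (\<Sum>w\<in>W \<inter> V2. a x (c w))"
            using fW by (intro sum_mono2) auto
          finally have "(\<Sum>w\<in>W. a x (c w)) \<le> (\<Sum>w\<in>W \<inter> V1. a x (c w)) + (\<Sum>w\<in>W \<inter> V2. a x (c w))" by simp
          then have "(\<Sum>w\<in>W. a (c v) (c w)) < f (c v)" using u1(2) u2(2) both cx gt by simp
          then show ?thesis using True by blast
        qed
      qed
    qed
    then show False using uncol by blast
  qed
  have dsum: "(\<Sum>w\<in>V. \<mu> v w) = (\<Sum>w\<in>V1. \<mu> v w) + (\<Sum>w\<in>V2. \<mu> v w)"
  proof -
    have e: "V = V1 \<union> (V2 - {v})" "V1 \<inter> (V2 - {v}) = {}" using v A unfolding V1_def V2_def by auto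
    have fin: "finite V1" "finite V2" using sub finV finite_subset by auto
    have "(\<Sum>w\<in>V. \<mu> v w) = (\<Sum>w\<in>V1 \<union> (V2 - {v}). \<mu> v w)" using e(1) by simp
    also have "\<dots> = (\<Sum>w\<in>V1. \<mu> v w) + (\<Sum>w\<in>V2 - {v}. \<mu> v w)"
      using fin e(2) by (intro sum.union_disjoint) auto
    also have "(\<Sum>w\<in>V2 - {v}. \<mu> v w) = (\<Sum>w\<in>V2. \<mu> v w)"
      using fin v12 by (simp add: sum.remove[of V2 v] \<mu>_irrefl)
    finally show ?thesis .
  qed
  have s12: "(\<Sum>x\<in>X v. f x) \<le> (\<Sum>x\<in>X v. f1 x + f2 x)" using le by (intro sum_mono)
  then have tot: "(\<Sum>x\<in>X v. f x) = (\<Sum>x\<in>X v. f1 x + f2 x)"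
    "(\<Sum>x\<in>X v. f1 x) = (\<Sum>w\<in>V1. \<mu> v w)" "(\<Sum>x\<in>X v. f2 x) = (\<Sum>w\<in>V2. \<mu> v w)"
    using feas[OF v] dsum f1(3) f2(3) by (simp_all add: sum.distrib)
  have eq: "f x = f1 x + f2 x" if "x \<in> X v" for x
    using sum_mono_inv[OF tot(1) le that finX[OF v]] .
  have U: "uncolorable P \<mu> X a (\<lambda>y. if y \<in> X v then g y else f y)"
    if P: "P \<subseteq> V" "v \<in> P" "\<And>w z. w \<in> P \<Longrightarrow> w \<noteq> v \<Longrightarrow> z \<in> V - P \<Longrightarrow> \<mu> w z = 0" and cP: "conn adj P"
      and un: "\<And>c. \<not> good X a (\<lambda>y. if y \<in> X v then g y else f y) P c"
      and su: "(\<Sum>x\<in>X v. g x) = (\<Sum>w\<in>P. \<mu> v w)" for P g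
  proof -
    interpret P: fibred P \<mu> X a by (rule fibred_subset[OF P(1)])
    show ?thesis
    proof
      show "conn adj P" by (rule cP)
      show "\<not> good X a (\<lambda>y. if y \<in> X v then g y else f y) P c" for c by (rule un)
      fix u assume u: "u \<in> P"
      show "(\<Sum>w\<in>P. \<mu> u w) \<le> (\<Sum>y\<in>X u. if y \<in> X v then g y else f y)"
      proof (cases "u = v")
        case True
        have "(\<Sum>y\<in>X v. if y \<in> X v then g y else f y) = (\<Sum>x\<in>X v. g x)" by (intro sum.cong) auto
        then show ?thesis using True su by simp
      next
        case False
        have "X u \<inter> X v = {}" using disjX u P v False unfolding disjoint_family_on_def by blast
        then have "(\<Sum>y\<in>X u. if y \<in> X v then g y else f y) = (\<Sum>y\<in>X u. f y)" by (intro sum.cong) auto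
        moreover have "(\<Sum>w\<in>P. \<mu> u w) = (\<Sum>w\<in>V. \<mu> u w)"
          using finV P(1) P(3)[OF u False] by (intro sum.mono_neutral_left) auto
        ultimately show ?thesis using feas[of u] u P by auto
      qed
    qed
  qed
  have "uncolorable V1 \<mu> X a (\<lambda>y. if y \<in> X v then f1 y else f y)"
    by (rule U[OF sub(1) v12(1) s1 conn1 f1(2) tot(2)])
  moreover have "uncolorable V2 \<mu> X a (\<lambda>y. if y \<in> X v then f2 y else f y)"
    by (rule U[OF sub(2) v12(2) s2 conn2 f2(2) tot(3)])
  ultimately show "\<exists>f1 f2. (\<forall>x\<in>X v. f x = f1 x + f2 x) \<and>
      uncolorable (insert v A) \<mu> X a (\<lambda>y. if y \<in> X v then f1 y else f y) \<and>
      uncolorable (V - A) \<mu> X a (\<lambda>y. if y \<in> X v then f2 y else f y)"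
    using eq unfolding V1_def V2_def by blast
qed

end

lemma multigraph_induced: "multigraph G \<Longrightarrow> multigraph (induced G W)"
  unfolding multigraph_def induced_def by auto

lemma verts_induced: "W \<subseteq> verts G \<Longrightarrow> verts (induced G W) = W"
  by (auto simp: induced_def)

lemma mult_induced: "u \<in> W \<Longrightarrow> v \<in> W \<Longrightarrow> mult (induced G W) u v = mult G u v"
  by (simp add: induced_def)

lemma not_connE:
  assumes "\<not> conn E D" "D \<noteq> {}"
  obtains A where "A \<subseteq> D" "A \<noteq> {}" "A \<noteq> D" "\<And>x y. x \<in> A \<Longrightarrow> y \<in> D - A \<Longrightarrow> \<not> E x y"
proof -
  have "\<exists>A. (A \<subseteq> D \<and> A \<noteq> {} \<and> A \<noteq> D) \<and> \<not> (\<exists>x\<in>A. \<exists>y\<in>D - A. E x y)"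
    using assms unfolding conn_def by simp
  then obtain A where "A \<subseteq> D" "A \<noteq> {}" "A \<noteq> D" "\<not> (\<exists>x\<in>A. \<exists>y\<in>D - A. E x y)" by blast
  then show ?thesis using that[of A] by blast
qed

lemma cover_induced:
  fixes X :: "'a \<Rightarrow> 'b set"
  assumes C: "cover G X H" and W: "W \<subseteq> verts G"
  shows "cover (induced G W) X (induced H (\<Union>w\<in>W. X w))"
proof -
  let ?U = "\<Union>w\<in>W. X w"
  have UH: "?U \<subseteq> verts H" using coverD(3)[OF C] W by auto
  note v = verts_induced[OF W] verts_induced[OF UH]
  have ex: "\<forall>u\<in>verts G. \<forall>v\<in>verts G. u \<noteq> v \<longrightarrow> (\<exists>M :: nat \<Rightarrow> ('b \<times> 'b) set.
      (\<forall>i<mult G u v. bip_matching (X u) (X v) (M i)) \<and>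
      (\<forall>x\<in>X u. \<forall>y\<in>X v. mult H x y = card {i. i < mult G u v \<and> (x, y) \<in> M i}))"
    using C unfolding cover_def by (elim conjE)
  show ?thesis
    unfolding cover_def v
  proof (intro conjI ballI impI)
    show "multigraph (induced H ?U)" using coverD(1)[OF C] by (rule multigraph_induced)
    show "disjoint_family_on X W" using coverD(2)[OF C] W by (meson disjoint_family_on_mono)
    show "?U = ?U" by simp
    show "mult (induced H ?U) x y = 0" if "v \<in> W" "x \<in> X v" "y \<in> X v" for v x y
      using coverD(5)[OF C, of v x y] that W by (auto simp: induced_def)
    fix u v assume uv: "u \<in> W" "v \<in> W" "u \<noteq> v"
    then have uV: "u \<in> verts G" "v \<in> verts G" using W by auto
    from ex[rule_format, OF uV uv(3)] obtain M :: "nat \<Rightarrow> ('b \<times> 'b) set"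
      where M: "(\<forall>i<mult G u v. bip_matching (X u) (X v) (M i)) \<and>
      (\<forall>x\<in>X u. \<forall>y\<in>X v. mult H x y = card {i. i < mult G u v \<and> (x, y) \<in> M i})" ..
    have m: "mult (induced H ?U) x y = mult H x y" if "x \<in> X u" "y \<in> X v" for x y
      using that uv by (intro mult_induced) auto
    show "\<exists>M :: nat \<Rightarrow> ('b \<times> 'b) set.
      (\<forall>i<mult (induced G W) u v. bip_matching (X u) (X v) (M i)) \<and>
      (\<forall>x\<in>X u. \<forall>y\<in>X v. mult (induced H ?U) x y = card {i. i < mult (induced G W) u v \<and> (x, y) \<in> M i})"
      unfolding mult_induced[OF uv(1,2)] using M m by (intro exI[of _ M]) simp
  qed
qed

lemma config_uncolorable:
  assumes "multigraph G" "connected_graph G" "cover G X H" "\<not> colorable G X H f" "degree_feasible G X H f"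
  shows "uncolorable (verts G) (mult G) X (mult H) f"
proof -
  interpret fibred "verts G" "mult G" X "mult H" by (rule cover_fibred[OF assms(1,3)])
  show ?thesis
  proof
    show "conn (\<lambda>u v. 0 < mult G u v) (verts G)" by (rule connected_graph_conn[OF assms(2)])
    show "(\<Sum>w\<in>verts G. mult G v w) \<le> (\<Sum>y\<in>X v. f y)" if "v \<in> verts G" for v
      using assms(5) that unfolding degree_feasible_def deg_def by blast
    show "\<not> good X (mult H) f (verts G) c" for c using assms(4) good_colorable[OF assms(3)] by blast
  qed
qed

lemma uncolorable_config:
  assumes G: "multigraph G" and C: "cover G X H" and W: "W \<subseteq> verts G"
    and U: "uncolorable W (mult G) X (mult H) g"
  defines "G' \<equiv> induced G W" and "H' \<equiv> induced H (\<Union>w\<in>W. X w)"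
  shows "connected_graph G'" "\<not> colorable G' X H' g" "degree_feasible G' X H' g"
proof -
  interpret uncolorable W "mult G" X "mult H" g by (rule U)
  have vG: "verts G' = W" unfolding G'_def by (rule verts_induced[OF W])
  have C': "cover G' X H'" unfolding G'_def H'_def by (rule cover_induced[OF C W])
  have G': "multigraph G'" unfolding G'_def by (rule multigraph_induced[OF G])
  show "connected_graph G'" unfolding G'_def by (rule conn_induced[OF conn W])
  show "\<not> colorable G' X H' g"
  proof
    assume "colorable G' X H' g"
    then obtain c where c: "good X (mult H') g W c" using colorable_good[OF G' C'] vG by auto
    have "mult H' (c v) (c w) = mult H (c v) (c w)" if "v \<in> W" "w \<in> W" "c v \<in> X v" "c w \<in> X w" for v w
      unfolding H'_def using that by (intro mult_induced) auto
    then have "good X (mult H) g W c" using good_cong_mult[OF _ c] by blast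
    then show False using uncol by blast
  qed
  show "degree_feasible G' X H' g"
    unfolding degree_feasible_def vG
  proof
    fix v assume v: "v \<in> W"
    have "deg G' v = (\<Sum>w\<in>W. mult G v w)"
      unfolding deg_def vG using v by (intro sum.cong) (auto simp: G'_def mult_induced)
    then show "deg G' v \<le> (\<Sum>x\<in>X v. g x)" using feas[OF v] by simp
  qed
qed

text \<open>The two parts keep their names inside \<open>G\<close>, so both quotient maps are
  \<open>id\<close>. An edge inside the overlap would be counted once for each part;
  \<open>mid\<close> rules this out.\<close>

lemma identify_induced:
  assumes G: "multigraph G" and vs: "verts G = A \<union> B" and \<pi>: "\<And>x. x \<in> A \<inter> B \<Longrightarrow> \<pi> x = x"
    and cross: "\<And>x y. x \<in> A - B \<Longrightarrow> y \<in> B - A \<Longrightarrow> mult G x y = 0"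
    and mid: "\<And>x y. x \<in> A \<inter> B \<Longrightarrow> y \<in> A \<inter> B \<Longrightarrow> mult G x y = 0"
  shows "obtained_by_identifying (induced G A) (induced G B) (A \<inter> B) \<pi> id id G"
proof -
  have v: "verts (induced G A) = A" "verts (induced G B) = B"
    by (rule verts_induced, use vs in blast)+
  have sym: "mult G x y = mult G y x" for x y using G unfolding multigraph_def by blast
  have single: "(\<Sum>u | u \<in> P \<and> id u = x. \<Sum>w | w \<in> P \<and> id w = y. mult (induced G P) u w)
      = (if x \<in> P \<and> y \<in> P then mult G x y else 0)" for P x y
  proof -
    have e: "{u. u \<in> P \<and> id u = z} = (if z \<in> P then {z} else {})" for z by auto
    show ?thesis unfolding e by (auto simp: mult_induced)
  qed
  show ?thesis
    unfolding obtained_by_identifying_def v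
  proof (intro conjI ballI)
    show "\<pi> ` (A \<inter> B) \<subseteq> B" using \<pi> by auto
    show "inj_on \<pi> (A \<inter> B)" using \<pi> by (auto simp: inj_on_def)
    show "id x = id y \<longleftrightarrow> x \<in> A \<inter> B \<and> y = \<pi> x" if "x \<in> A" "y \<in> B" for x y using that \<pi> by auto
    show "verts G = id ` A \<union> id ` B" using vs by simp
    fix x y assume "x \<in> verts G" "y \<in> verts G"
    then have xy: "x \<in> A \<union> B" "y \<in> A \<union> B" using vs by auto
    show "mult G x y = (\<Sum>u | u \<in> A \<and> id u = x. \<Sum>w | w \<in> A \<and> id w = y. mult (induced G A) u w) +
      (\<Sum>u | u \<in> B \<and> id u = x. \<Sum>w | w \<in> B \<and> id w = y. mult (induced G B) u w)"
      unfolding single using xy cross[of x y] cross[of y x] mid[of x y] sym[of x y] by auto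
  qed auto
qed

lemma merged_induced:
  assumes G: "multigraph G" and C: "cover G X H"
    and vs: "verts G = V1 \<union> V2" "V1 \<inter> V2 = {v}"
    and sep: "\<And>x y. x \<in> V1 - {v} \<Longrightarrow> y \<in> V2 - {v} \<Longrightarrow> mult G x y = 0"
    and f: "\<And>x. x \<in> X v \<Longrightarrow> f x = f1 x + f2 x"
  shows "merged_configuration (induced G V1) X (induced H (\<Union>w\<in>V1. X w)) (\<lambda>y. if y \<in> X v then f1 y else f y)
    (induced G V2) X (induced H (\<Union>w\<in>V2. X w)) (\<lambda>y. if y \<in> X v then f2 y else f y) G X H f"
proof -
  interpret fibred "verts G" "mult G" X "mult H" by (rule cover_fibred[OF G C])
  let ?U1 = "\<Union>w\<in>V1. X w" and ?U2 = "\<Union>w\<in>V2. X w"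
  have v: "v \<in> V1" "v \<in> V2" using vs by auto
  have vG: "verts (induced G V1) = V1" "verts (induced G V2) = V2"
    by (rule verts_induced, use vs in blast)+
  have U: "verts H = ?U1 \<union> ?U2" using coverD(3)[OF C] vs by auto
  have vH: "verts (induced H ?U1) = ?U1" "verts (induced H ?U2) = ?U2"
    by (rule verts_induced, use U in blast)+
  have Ui: "?U1 \<inter> ?U2 = X v"
  proof
    show "X v \<subseteq> ?U1 \<inter> ?U2" using v by blast
    show "?U1 \<inter> ?U2 \<subseteq> X v"
    proof
      fix x assume "x \<in> ?U1 \<inter> ?U2"
      then obtain w1 w2 where w: "w1 \<in> V1" "w2 \<in> V2" "x \<in> X w1" "x \<in> X w2" by blast
      have "w1 \<in> verts G" "w2 \<in> verts G" using w vs(1) by auto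
      from cover_disjoint[OF C this w(3,4)] have "w1 \<in> V1 \<inter> V2" using w by simp
      then show "x \<in> X v" using w(3) unfolding vs(2) by simp
    qed
  qed
  have idG: "obtained_by_identifying (induced G V1) (induced G V2) {v} (\<lambda>_. v) id id G"
    unfolding vs(2)[symmetric]
  proof (rule identify_induced[OF G vs(1)])
    show "mult G x y = 0" if "x \<in> V1 - V2" "y \<in> V2 - V1" for x y using sep[of x y] that v by blast
    show "mult G x y = 0" if "x \<in> V1 \<inter> V2" "y \<in> V1 \<inter> V2" for x y using that vs(2) \<mu>_irrefl by auto
  qed (use vs(2) in auto)
  have idH: "obtained_by_identifying (induced H ?U1) (induced H ?U2) (X v) id id id H"
    unfolding Ui[symmetric]
  proof (rule identify_induced[OF coverD(1)[OF C] U])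
    show "mult H x y = 0" if xy: "x \<in> ?U1 - ?U2" "y \<in> ?U2 - ?U1" for x y
    proof -
      obtain w1 w2 where w: "w1 \<in> V1" "w2 \<in> V2" "x \<in> X w1" "y \<in> X w2" using xy by blast
      have ne: "w1 \<noteq> v" "w2 \<noteq> v" using w xy v by auto
      then have "mult G w1 w2 = 0" using sep w by blast
      moreover have "w1 \<noteq> w2" using w ne vs(2) by blast
      ultimately have "(\<Sum>y\<in>X w2. mult H x y) \<le> 0" using row_le[of w1 w2 x] w vs(1) by auto
      then show ?thesis using w finX[of w2] vs(1) by auto
    qed
    show "mult H x y = 0" if "x \<in> ?U1 \<inter> ?U2" "y \<in> ?U1 \<inter> ?U2" for x y
      using coverD(5)[OF C, of v x y] that v vs unfolding Ui by blast
  qed simp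
  show ?thesis
    unfolding merged_configuration_def vG vH
    by (rule bexI[OF _ v(1)], rule bexI[OF _ v(2)], rule exI[of _ id], rule exI[of _ id], rule exI[of _ id],
        rule exI[of _ id], rule exI[of _ id], intro conjI) (use idG idH f in \<open>auto simp: bij_betw_def\<close>)
qed

text \<open>Deleting the only vertex leaves the empty set, which is not \<open>conn\<close>, so
  \<open>block_config\<close> does not cover this case. Tightness makes \<open>f\<close> vanish, and
  any one-element \<open>U\<close> exhibits an M-configuration of degree zero.\<close>

lemma single_vertex_constructible:
  assumes G: "multigraph G" and C: "cover G X H" and uni: "\<exists>r\<ge>1. \<forall>v\<in>verts G. card (X v) = r"
    and conG: "connected_graph G" and U: "uncolorable (verts G) (mult G) X (mult H) f" and V: "verts G = {v}"
  shows "constructible G X H f"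
proof -
  interpret uncolorable "verts G" "mult G" X "mult H" f by (rule U)
  have "(\<Sum>y\<in>X v. f y) = 0" using hole_sum[of v] V \<mu>_irrefl by simp
  then have f0: "f x = 0" if "x \<in> X v" for x using that finX[of v] V by auto
  have d0: "deg G v = 0" unfolding deg_def V using \<mu>_irrefl by simp
  have "X v \<noteq> {}" using uni V by auto
  then obtain x where x: "x \<in> X v" by blast
  have "restr_inflates_G_cover G X H (\<Union>w\<in>verts G. {x})"
    by (rule strand_inflates[OF G C, where s = 1]) (use V x in auto)
  then have r: "restr_inflates_G_cover G X H {x}" using V by simp
  have "block G" by (rule blockI_conn[OF conG]) (use V in auto)
  moreover have "{x} \<subseteq> verts H" using x coverD(4)[OF C, of v] V by blast
  ultimately have "M_configuration G X H f"
    unfolding M_configuration_def using r f0 d0 V by (intro conjI exI[of _ "{x}"]) auto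
  moreover have "uniform_configuration G X H f"
    unfolding uniform_configuration_def configuration_def using G C uni by blast
  ultimately show ?thesis using K1 by blast
qed

theorem uncolorable_constructible:
  assumes "multigraph G" "connected_graph G" "cover G X H" "\<exists>r\<ge>1. \<forall>v\<in>verts G. card (X v) = r"
    "\<not> colorable G X H f" "degree_feasible G X H f"
  shows "constructible G X H f"
  using assms
proof (induction "card (verts G)" arbitrary: G H f rule: less_induct)
  case less
  note G = less.prems(1) and conG = less.prems(2) and C = less.prems(3) and uni = less.prems(4)
  have U: "uncolorable (verts G) (mult G) X (mult H) f"
    by (rule config_uncolorable[OF G conG C less.prems(5,6)])
  interpret uncolorable "verts G" "mult G" X "mult H" f by (rule U)
  have unif: "uniform_configuration G X H f"
    unfolding uniform_configuration_def configuration_def using G C uni by blast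
  show ?case
  proof (cases "\<exists>v. verts G = {v}")
    case True
    then show ?thesis using single_vertex_constructible[OF G C uni conG U] by blast
  next
    case False
    have ne: "verts G - {v} \<noteq> {}" if "v \<in> verts G" for v using False that by blast
    show ?thesis
    proof (cases "\<forall>v\<in>verts G. conn adj (verts G - {v})")
      case True
      have "block G" by (rule blockI_conn[OF conG]) (use True in auto)
      moreover have "hole_cover (verts G) (mult G) (\<lambda>v. {x \<in> X v. 0 < f x}) (mult H) f
          (\<lambda>u c. u \<in> verts G \<and> good X (mult H) f (verts G - {u}) c)"
        by (rule uncolorable_hole_cover) (use True G in \<open>auto simp: multigraph_def\<close>)
      ultimately have "block_config G X H f (\<lambda>u c. u \<in> verts G \<and> good X (mult H) f (verts G - {u}) c)"
        unfolding block_config_def block_config_axioms_def using G C uni hole_sum by blast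
      then show ?thesis by (rule block_config.block_constructible)
    next
      case False
      then obtain v where v: "v \<in> verts G" and nc: "\<not> conn adj (verts G - {v})" by blast
      from nc ne[OF v] obtain A where A: "A \<subseteq> verts G - {v}" "A \<noteq> {}" "A \<noteq> verts G - {v}"
        and no: "\<And>x y. x \<in> A \<Longrightarrow> y \<in> verts G - {v} - A \<Longrightarrow> \<not> adj x y"
        by (rule not_connE) blast
      have sep: "mult G x y = 0" if "x \<in> A" "y \<in> verts G - {v} - A" for x y using no[OF that] by simp
      obtain f1 f2 where f12: "\<forall>x\<in>X v. f x = f1 x + f2 x"
        and U1: "uncolorable (insert v A) (mult G) X (mult H) (\<lambda>y. if y \<in> X v then f1 y else f y)"
        and U2: "uncolorable (verts G - A) (mult G) X (mult H) (\<lambda>y. if y \<in> X v then f2 y else f y)"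
        using cut_split(3)[OF v A sep] by blast
      have s1: "insert v A \<subset> verts G" and s2: "verts G - A \<subset> verts G" using A v by auto
      have sub: "constructible (induced G W) X (induced H (\<Union>w\<in>W. X w)) g"
        if W: "W \<subset> verts G" and UW: "uncolorable W (mult G) X (mult H) g" for W g
      proof -
        have W': "W \<subseteq> verts G" using W by blast
        have vW: "verts (induced G W) = W" by (rule verts_induced[OF W'])
        have "card (verts (induced G W)) < card (verts G)" unfolding vW by (rule psubset_card_mono[OF finV W])
        then show ?thesis
        proof (rule less.hyps)
          show "multigraph (induced G W)" by (rule multigraph_induced[OF G])
          show "cover (induced G W) X (induced H (\<Union>w\<in>W. X w))" by (rule cover_induced[OF C W'])
          show "\<exists>r\<ge>1. \<forall>v\<in>verts (induced G W). card (X v) = r" unfolding vW using uni W' by blast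
        qed (rule uncolorable_config[OF G C W' UW])+
      qed
      have "merged_configuration (induced G (insert v A)) X (induced H (\<Union>w\<in>insert v A. X w)) (\<lambda>y. if y \<in> X v then f1 y else f y)
        (induced G (verts G - A)) X (induced H (\<Union>w\<in>verts G - A. X w)) (\<lambda>y. if y \<in> X v then f2 y else f y) G X H f"
        by (rule merged_induced[OF G C]) (use A v sep f12 in auto)
      then show ?thesis using K5[OF unif sub[OF s1 U1] sub[OF s2 U2]] by blast
    qed
  qed
qed

section \<open>Constructible configurations are uncolorable\<close>

lemma goodD:
  assumes "good X a f D c" "W \<subseteq> D" "W \<noteq> {}" "\<And>v. v \<in> W \<Longrightarrow> f (c v) \<le> (\<Sum>w\<in>W. a (c v) (c w))"
  shows False
proof -
  obtain v where "v \<in> W" "(\<Sum>w\<in>W. a (c v) (c w)) < f (c v)"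
    using assms(1-3) unfolding good_def by meson
  then show False using assms(4)[of v] by simp
qed

lemma good_in: "good X a f D c \<Longrightarrow> v \<in> D \<Longrightarrow> c v \<in> X v"
  unfolding good_def by (elim conjE) blast

lemma good_pos: "good X a f D c \<Longrightarrow> v \<in> D \<Longrightarrow> 0 < f (c v)"
  using goodD[of X a f D c "{v}"] by (cases "f (c v)") auto

lemma good_pair:
  assumes "good X a f D c" "u \<in> D" "w \<in> D" "u \<noteq> w" "\<And>x y. a x y = a y x"
    "f (c u) \<le> a (c u) (c w)" "f (c w) \<le> a (c u) (c w)"
  shows False
  by (rule goodD[OF assms(1), of "{u, w}"]) (use assms(2-) in \<open>auto simp: trans_le_add1 trans_le_add2\<close>)

lemma nat_mult_of_real_divide:
  fixes k c d :: nat
  assumes "real k = real d / real c" "0 < c"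
  shows "k * c = d"
proof -
  have "real k * real c = real d" using assms by simp
  then show ?thesis by (metis of_nat_eq_iff of_nat_mult)
qed

lemma sum_equal_share:
  fixes f :: "'b \<Rightarrow> nat"
  assumes "finite A" "A \<noteq> {}" "\<And>x. x \<in> A \<Longrightarrow> f x * card A = d"
  shows "(\<Sum>x\<in>A. f x) = d"
proof -
  have "(\<Sum>x\<in>A. f x) * card A = (\<Sum>x\<in>A. d)" unfolding sum_distrib_right using assms(3) by (intro sum.cong) auto
  then have "(\<Sum>x\<in>A. f x) * card A = d * card A" by (simp only: sum_constant mult.commute of_nat_id)
  moreover have "card A \<noteq> 0" using assms(1,2) by simp
  ultimately show ?thesis by simp
qed

section \<open>The basic families (K1) to (K4)\<close>

lemma inflates_G_coverE:
  assumes "restr_inflates_G_cover G X H U"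
  obtains s where "1 \<le> s" "\<And>v. v \<in> verts G \<Longrightarrow> card (X v \<inter> U) = s"
    "\<And>u v x y. u \<in> verts G \<Longrightarrow> v \<in> verts G \<Longrightarrow> u \<noteq> v \<Longrightarrow> x \<in> X u \<Longrightarrow> x \<in> U \<Longrightarrow> y \<in> X v \<Longrightarrow> y \<in> U
      \<Longrightarrow> mult H x y * s = mult G u v"
proof -
  obtain X0 H0 s where g: "is_G_cover G X0 H0"
    and i: "is_inflation_by s G X0 H0 (\<lambda>v. X v \<inter> U) (induced H U)"
    using assms unfolding restr_inflates_G_cover_def is_inflation_def by blast
  have c0: "cover G X0 H0" using g unfolding is_G_cover_def by blast
  obtain x where x: "\<And>v. v \<in> verts G \<Longrightarrow> X0 v = {x v}"
    "\<And>u v. u \<in> verts G \<Longrightarrow> v \<in> verts G \<Longrightarrow> u \<noteq> v \<Longrightarrow> mult H0 (x u) (x v) = mult G u v"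
    using g unfolding is_G_cover_def by blast
  have xH: "x v \<in> verts H0" if "v \<in> verts G" for v using coverD(4)[OF c0 that] x(1)[OF that] by simp
  obtain W where W: "\<forall>y\<in>verts H0. card (W y) = s" "\<forall>v\<in>verts G. X v \<inter> U = (\<Union>y\<in>X0 v. W y)"
    "\<forall>y\<in>verts H0. \<forall>z\<in>verts H0. \<forall>a\<in>W y. \<forall>b\<in>W z. mult (induced H U) a b = (if y = z then 0 else mult H0 y z div s)"
    using i unfolding is_inflation_by_def by (elim conjE exE) blast
  have s: "1 \<le> s" using i unfolding is_inflation_by_def by (elim conjE)
  have sd: "\<forall>x\<in>verts H0. \<forall>y\<in>verts H0. s dvd mult H0 x y"
    using i unfolding is_inflation_by_def by (elim conjE)
  have XU: "X v \<inter> U = W (x v)" if "v \<in> verts G" for v using W(2) x(1)[OF that] that by simp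
  show ?thesis
  proof (rule that[OF s])
    show "card (X v \<inter> U) = s" if "v \<in> verts G" for v using XU[OF that] W(1) xH[OF that] by simp
    fix u v a b assume uv: "u \<in> verts G" "v \<in> verts G" "u \<noteq> v" and a: "a \<in> X u" "a \<in> U" and b: "b \<in> X v" "b \<in> U"
    have aW: "a \<in> W (x u)" "b \<in> W (x v)" using XU uv a b by auto
    have ne: "x u \<noteq> x v" using cover_disjoint[OF c0 uv(1,2), of "x u"] x(1)[OF uv(1)] x(1)[OF uv(2)] uv(3) by auto
    have "mult H a b = mult G u v div s"
      using W(3)[rule_format, OF xH[OF uv(1)] xH[OF uv(2)] aW] ne x(2)[OF uv] a b by (simp add: induced_def)
    moreover have "s dvd mult G u v" using sd xH uv x(2)[OF uv] by metis
    ultimately show "mult H a b * s = mult G u v" by (metis dvd_div_mult_self)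
  qed
qed

lemma inflates_double_coverE:
  assumes "restr_inflates_double_cover t n G X H U" and n: "1 \<le> n"
  obtains v C s where "graph_iso v (times_graph t (cycle_graph n)) G" "1 \<le> s"
    "\<And>i. i \<in> {1..n} \<Longrightarrow> X (v i) \<inter> U = C i \<union> C (n + i)"
    "\<And>i. i \<in> {1..n} \<Longrightarrow> card (X (v i) \<inter> U) = 2 * s"
    "\<And>i j x y. i \<in> {1..2 * n} \<Longrightarrow> j \<in> {1..2 * n} \<Longrightarrow> i \<noteq> j \<Longrightarrow> x \<in> C i \<Longrightarrow> y \<in> C j \<Longrightarrow>
      [i = j + 1] (mod (2 * n)) \<or> [j = i + 1] (mod (2 * n)) \<Longrightarrow> mult H x y * s = t"
proof -
  obtain X0 H0 s where g: "is_double_cover t n G X0 H0"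
    and i: "is_inflation_by s G X0 H0 (\<lambda>v. X v \<inter> U) (induced H U)"
    using assms unfolding restr_inflates_double_cover_def is_inflation_def by blast
  have c0: "cover G X0 H0" using g unfolding is_double_cover_def by blast
  obtain v x where v: "graph_iso v (times_graph t (cycle_graph n)) G" and inj: "inj_on x {1..2 * n}"
    and X0: "\<forall>i\<in>{1..n}. X0 (v i) = {x i, x (n + i)}"
    and m0: "\<forall>i\<in>{1..2 * n}. \<forall>j\<in>{1..2 * n}. mult H0 (x i) (x j) =
           (if [i = j + 1] (mod (2 * n)) \<or> [j = i + 1] (mod (2 * n)) then t else 0)"
    using g unfolding is_double_cover_def by blast
  have vV: "v i \<in> verts G" if "i \<in> {1..n}" for i
    using v that unfolding graph_iso_def bij_betw_def by (auto simp: times_graph_def cycle_graph_def)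
  have xH: "x i \<in> verts H0" if i: "i \<in> {1..2 * n}" for i
  proof (cases "i \<le> n")
    case True
    then have "i \<in> {1..n}" using i by simp
    then show ?thesis using coverD(4)[OF c0 vV] X0 by blast
  next
    case False
    then have "i - n \<in> {1..n}" "n + (i - n) = i" using i by auto
    then show ?thesis using coverD(4)[OF c0 vV, of "i - n"] X0 by (metis insertI1 insert_commute subsetD)
  qed
  obtain W where W: "disjoint_family_on W (verts H0)" "\<forall>y\<in>verts H0. card (W y) = s" "\<forall>v\<in>verts G. X v \<inter> U = (\<Union>y\<in>X0 v. W y)"
    "\<forall>y\<in>verts H0. \<forall>z\<in>verts H0. \<forall>a\<in>W y. \<forall>b\<in>W z. mult (induced H U) a b = (if y = z then 0 else mult H0 y z div s)"
    "verts (induced H U) = (\<Union>y\<in>verts H0. W y)"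
    using i unfolding is_inflation_by_def by (elim conjE exE) blast
  have s: "1 \<le> s" using i unfolding is_inflation_by_def by (elim conjE)
  have sd: "\<forall>x\<in>verts H0. \<forall>y\<in>verts H0. s dvd mult H0 x y"
    using i unfolding is_inflation_by_def by (elim conjE)
  define C where "C i = W (x i)" for i
  have XU: "X (v i) \<inter> U = C i \<union> C (n + i)" if i: "i \<in> {1..n}" for i
    using W(3) vV[OF i] X0 i unfolding C_def by auto
  show ?thesis
  proof (rule that[OF v s XU])
    fix i assume i: "i \<in> {1..n}"
    then have i2: "i \<in> {1..2 * n}" "n + i \<in> {1..2 * n}" "i \<noteq> n + i" using n by auto
    then have "x i \<noteq> x (n + i)" using inj_onD[OF inj] by blast
    then have "C i \<inter> C (n + i) = {}" using W(1) xH[OF i2(1)] xH[OF i2(2)] unfolding C_def disjoint_family_on_def by blast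
    moreover have "card (C i) = s" "card (C (n + i)) = s" using W(2) xH i2 unfolding C_def by auto
    moreover have "finite (C i)" "finite (C (n + i))" using calculation(2,3) s by (auto intro: card_ge_0_finite)
    ultimately show "card (X (v i) \<inter> U) = 2 * s" unfolding XU[OF i] by (simp add: card_Un_disjoint)
  next
    fix i j a b assume ij: "i \<in> {1..2 * n}" "j \<in> {1..2 * n}" "i \<noteq> j" and a: "a \<in> C i" and b: "b \<in> C j"
      and cg: "[i = j + 1] (mod (2 * n)) \<or> [j = i + 1] (mod (2 * n))"
    have ne: "x i \<noteq> x j" using inj_onD[OF inj _ ij(1,2)] ij(3) by blast
    have m: "mult H0 (x i) (x j) = t" using m0[rule_format, OF ij(1,2)] cg by simp
    have "a \<in> verts (induced H U)" "b \<in> verts (induced H U)" using a b xH ij W(5) unfolding C_def by auto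
    then have "mult (induced H U) a b = mult H a b" by (simp add: induced_def)
    moreover have "mult (induced H U) a b = t div s"
      using W(4)[rule_format, OF xH[OF ij(1)] xH[OF ij(2)]] a b ne m unfolding C_def by simp
    moreover have "s dvd t" using sd xH[OF ij(1)] xH[OF ij(2)] m by metis
    ultimately show "mult H a b * s = t" by (metis dvd_div_mult_self)
  qed
qed

lemma M_uncolorable:
  assumes G: "multigraph G" and C: "cover G X H" and M: "M_configuration G X H f"
  shows "\<not> colorable G X H f" "degree_feasible G X H f"
proof -
  interpret fibred "verts G" "mult G" X "mult H" by (rule cover_fibred[OF G C])
  obtain U where U: "restr_inflates_G_cover G X H U" and
    val: "\<And>v x. v \<in> verts G \<Longrightarrow> x \<in> X v \<Longrightarrow> x \<in> U \<Longrightarrow> real (f x) = real (deg G v) / real (card (X v \<inter> U))"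
    and zero: "\<And>v x. v \<in> verts G \<Longrightarrow> x \<in> X v \<Longrightarrow> x \<notin> U \<Longrightarrow> f x = 0"
    using M unfolding M_configuration_def by blast
  have ne: "verts G \<noteq> {}" using M unfolding M_configuration_def block_def connected_graph_def by blast
  obtain s where s: "1 \<le> s" "\<And>v. v \<in> verts G \<Longrightarrow> card (X v \<inter> U) = s"
    "\<And>u v x y. u \<in> verts G \<Longrightarrow> v \<in> verts G \<Longrightarrow> u \<noteq> v \<Longrightarrow> x \<in> X u \<Longrightarrow> x \<in> U \<Longrightarrow> y \<in> X v \<Longrightarrow> y \<in> U
      \<Longrightarrow> mult H x y * s = mult G u v"
    by (rule inflates_G_coverE[OF U]) blast
  have fs: "f x * s = deg G v" if "v \<in> verts G" "x \<in> X v" "x \<in> U" for v x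
    using nat_mult_of_real_divide[OF val[OF that]] s(1) s(2)[OF that(1)] by simp
  show "degree_feasible G X H f"
    unfolding degree_feasible_def
  proof
    fix v assume v: "v \<in> verts G"
    have "finite (X v \<inter> U)" "X v \<inter> U \<noteq> {}" using finX[OF v] s(1) s(2)[OF v] by auto
    then have "(\<Sum>x\<in>X v \<inter> U. f x) = deg G v" using fs[OF v] s(2)[OF v] by (intro sum_equal_share) auto
    moreover have "(\<Sum>x\<in>X v \<inter> U. f x) \<le> (\<Sum>x\<in>X v. f x)" using finX[OF v] by (intro sum_mono2) auto
    ultimately show "deg G v \<le> (\<Sum>x\<in>X v. f x)" by simp
  qed
  show "\<not> colorable G X H f"
  proof
    assume "colorable G X H f"
    then obtain c where c: "good X (mult H) f (verts G) c" using colorable_good[OF G C] by blast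
    have cU: "c v \<in> U" if "v \<in> verts G" for v
      using zero[OF that good_in[OF c that]] good_pos[OF c that] by (cases "c v \<in> U") auto
    show False
    proof (rule goodD[OF c subset_refl ne])
      fix v assume v: "v \<in> verts G"
      have "(\<Sum>w\<in>verts G. mult H (c v) (c w)) * s = (\<Sum>w\<in>verts G. mult H (c v) (c w) * s)" by (rule sum_distrib_right)
      also have "\<dots> = deg G v"
        unfolding deg_def
      proof (intro sum.cong refl)
        fix w assume w: "w \<in> verts G"
        show "mult H (c v) (c w) * s = mult G v w"
          using s(3)[OF v w _ good_in[OF c v] cU[OF v] good_in[OF c w] cU[OF w]] \<mu>_irrefl a_irrefl by (cases "v = w") auto
      qed
      also have "\<dots> = f (c v) * s" using fs[OF v good_in[OF c v] cU[OF v]] by simp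
      finally show "f (c v) \<le> (\<Sum>w\<in>verts G. mult H (c v) (c w))" using s(1) by simp
    qed
  qed
qed

text \<open>Pigeonhole: the \<open>n\<close> colours of a transversal lie in the sets
  \<open>U i\<close>, whose numbers \<open>ns i\<close> add up to \<open>n - 1\<close>, so some
  \<open>U i\<close> holds more than \<open>ns i\<close> of them. There each colour has at least
  \<open>t * ns i / s i\<close> neighbours, which is its value.\<close>

lemma K_uncolorable:
  fixes X :: "'a \<Rightarrow> 'b set"
  assumes G: "multigraph G" and C: "cover G X H" and K: "K_configuration G X H f"
  shows "\<not> colorable G X H f" "degree_feasible G X H f"
proof -
  interpret fibred "verts G" "mult G" X "mult H" by (rule cover_fibred[OF G C])
  obtain t n \<phi> and p :: nat and ns :: "nat \<Rightarrow> nat" and U :: "nat \<Rightarrow> 'b set" where t: "1 \<le> t" and n: "1 \<le> n" and iso: "graph_iso \<phi> (times_graph t (complete_graph n)) G"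
    and sum_ns: "(\<Sum>i=1..p. ns i) = n - 1" and dU: "disjoint_family_on U {1..p}"
    and infl: "\<forall>i\<in>{1..p}. restr_inflates_G_cover G X H (U i)"
    and val: "\<forall>v\<in>verts G. \<forall>x\<in>X v. (\<forall>i\<in>{1..p}. x \<in> U i \<longrightarrow>
                 real (f x) = real t * real (ns i) / real (card (X v \<inter> U i))) \<and>
              (x \<notin> (\<Union>i\<in>{1..p}. U i) \<longrightarrow> f x = 0)"
    using K unfolding K_configuration_def by (elim exE conjE) (rule that; assumption)
  have bij: "bij_betw \<phi> {1..n} (verts G)" using iso unfolding graph_iso_def times_graph_def complete_graph_def by simp
  have cardV: "card (verts G) = n" using bij_betw_same_card[OF bij] by simp
  have mG: "mult G u v = t" if uv: "u \<in> verts G" "v \<in> verts G" "u \<noteq> v" for u v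
  proof -
    obtain i j where ij: "i \<in> {1..n}" "j \<in> {1..n}" "u = \<phi> i" "v = \<phi> j" using bij uv unfolding bij_betw_def by blast
    then have "i \<noteq> j" using uv by blast
    then show ?thesis using iso ij unfolding graph_iso_def times_graph_def complete_graph_def by simp
  qed
  have degG: "deg G v = t * (n - 1)" if v: "v \<in> verts G" for v
  proof -
    have "deg G v = (\<Sum>w\<in>verts G - {v}. mult G v w)" unfolding deg_def using finV v by (simp add: sum.remove[of _ v] \<mu>_irrefl)
    also have "\<dots> = (\<Sum>w\<in>verts G - {v}. t)" using mG[OF v] by (intro sum.cong) auto
    finally show ?thesis using v finV cardV by simp
  qed
  have "\<forall>i\<in>{1..p}. \<exists>s. 1 \<le> s \<and> (\<forall>v\<in>verts G. card (X v \<inter> U i) = s) \<and> (\<forall>u\<in>verts G. \<forall>v\<in>verts G. u \<noteq> v \<longrightarrow>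
    (\<forall>x\<in>X u \<inter> U i. \<forall>y\<in>X v \<inter> U i. mult H x y * s = mult G u v))"
  proof
    fix i assume "i \<in> {1..p}"
    then have r: "restr_inflates_G_cover G X H (U i)" using infl by blast
    show "\<exists>s. 1 \<le> s \<and> (\<forall>v\<in>verts G. card (X v \<inter> U i) = s) \<and> (\<forall>u\<in>verts G. \<forall>v\<in>verts G. u \<noteq> v \<longrightarrow>
    (\<forall>x\<in>X u \<inter> U i. \<forall>y\<in>X v \<inter> U i. mult H x y * s = mult G u v))"
      by (rule inflates_G_coverE[OF r]) (rule exI, intro conjI ballI impI; force)
  qed
  then obtain s where s: "\<forall>i\<in>{1..p}. 1 \<le> s i \<and> (\<forall>v\<in>verts G. card (X v \<inter> U i) = s i) \<and> (\<forall>u\<in>verts G. \<forall>v\<in>verts G. u \<noteq> v \<longrightarrow>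
    (\<forall>x\<in>X u \<inter> U i. \<forall>y\<in>X v \<inter> U i. mult H x y * s i = mult G u v))"
    by (rule bchoice[THEN exE])
  have s1: "1 \<le> s i" if "i \<in> {1..p}" for i using s that by blast
  have sc: "card (X v \<inter> U i) = s i" if "i \<in> {1..p}" "v \<in> verts G" for i v using s that by blast
  have sm: "mult H x y * s i = t" if "i \<in> {1..p}" "u \<in> verts G" "v \<in> verts G" "u \<noteq> v" "x \<in> X u" "x \<in> U i" "y \<in> X v" "y \<in> U i" for i u v x y
    using s that mG[OF that(2-4)] by simp
  have fs: "f x * s i = t * ns i" if i: "i \<in> {1..p}" and v: "v \<in> verts G" and x: "x \<in> X v" "x \<in> U i" for i v x
  proof (rule nat_mult_of_real_divide)
    show "real (f x) = real (t * ns i) / real (s i)" using val v x i sc[OF i v] by auto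
    show "0 < s i" using s1[OF i] by simp
  qed
  show "degree_feasible G X H f"
    unfolding degree_feasible_def
  proof
    fix v assume v: "v \<in> verts G"
    have su: "(\<Sum>x\<in>X v \<inter> U i. f x) = t * ns i" if i: "i \<in> {1..p}" for i
    proof -
      have "finite (X v \<inter> U i)" "X v \<inter> U i \<noteq> {}" using finX[OF v] s1[OF i] sc[OF i v] by auto
      then show ?thesis using fs[OF i v] sc[OF i v] by (intro sum_equal_share) auto
    qed
    have "deg G v = (\<Sum>i=1..p. \<Sum>x\<in>X v \<inter> U i. f x)"
      using degG[OF v] sum_ns su by (simp add: sum_distrib_left[symmetric])
    also have "\<dots> = (\<Sum>x\<in>(\<Union>i\<in>{1..p}. X v \<inter> U i). f x)"
      using finX[OF v] dU by (intro sum.UNION_disjoint[symmetric]) (auto simp: disjoint_family_on_def)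
    also have "\<dots> \<le> (\<Sum>x\<in>X v. f x)" using finX[OF v] by (intro sum_mono2) auto
    finally show "deg G v \<le> (\<Sum>x\<in>X v. f x)" .
  qed
  show "\<not> colorable G X H f"
  proof
    assume "colorable G X H f"
    then obtain c where c: "good X (mult H) f (verts G) c" using colorable_good[OF G C] by blast
    define W where "W i = {v \<in> verts G. c v \<in> U i}" for i
    have cU: "\<exists>i\<in>{1..p}. v \<in> W i" if v: "v \<in> verts G" for v
    proof (rule ccontr)
      assume "\<not> ?thesis"
      then have "c v \<notin> (\<Union>i\<in>{1..p}. U i)" using v unfolding W_def by blast
      then have "f (c v) = 0" using val v good_in[OF c v] by blast
      then show False using good_pos[OF c v] by simp
    qed
    have fW: "finite (W i)" for i unfolding W_def using finV by simp
    have "\<exists>i\<in>{1..p}. ns i < card (W i)"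
    proof (rule ccontr)
      assume "\<not> ?thesis"
      then have "(\<Sum>i=1..p. card (W i)) \<le> (\<Sum>i=1..p. ns i)" by (intro sum_mono) (simp add: not_less)
      moreover have "verts G \<subseteq> (\<Union>i\<in>{1..p}. W i)" using cU by blast
      then have "card (verts G) \<le> card (\<Union>i\<in>{1..p}. W i)" using fW by (intro card_mono) auto
      moreover have "card (\<Union>i\<in>{1..p}. W i) \<le> (\<Sum>i=1..p. card (W i))" by (rule card_UN_le) simp
      ultimately show False using sum_ns cardV n by simp
    qed
    then obtain i where i: "i \<in> {1..p}" "ns i < card (W i)" by blast
    show False
    proof (rule goodD[OF c, of "W i"])
      show "W i \<subseteq> verts G" unfolding W_def by blast
      show "W i \<noteq> {}" using i(2) by auto
      fix v assume v: "v \<in> W i"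
      then have vV: "v \<in> verts G" "c v \<in> U i" unfolding W_def by auto
      have "(\<Sum>w\<in>W i. mult H (c v) (c w)) * s i = (\<Sum>w\<in>W i. mult H (c v) (c w) * s i)" by (rule sum_distrib_right)
      also have "\<dots> = (\<Sum>w\<in>W i - {v}. mult H (c v) (c w) * s i)" using fW v by (simp add: sum.remove[of _ v] a_irrefl)
      also have "\<dots> = (\<Sum>w\<in>W i - {v}. t)"
      proof (intro sum.cong refl)
        fix w assume w: "w \<in> W i - {v}"
        then have wV: "w \<in> verts G" "c w \<in> U i" "v \<noteq> w" unfolding W_def by auto
        show "mult H (c v) (c w) * s i = t"
          by (rule sm[OF i(1) vV(1) wV(1) wV(3) good_in[OF c vV(1)] vV(2) good_in[OF c wV(1)] wV(2)])
      qed
      also have "\<dots> = t * (card (W i) - 1)" using v fW by simp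
      finally have e: "(\<Sum>w\<in>W i. mult H (c v) (c w)) * s i = t * (card (W i) - 1)" .
      have "f (c v) * s i = t * ns i" by (rule fs[OF i(1) vV(1) good_in[OF c vV(1)] vV(2)])
      also have "\<dots> \<le> t * (card (W i) - 1)" using i(2) by (intro mult_le_mono2) simp
      finally have "f (c v) * s i \<le> (\<Sum>w\<in>W i. mult H (c v) (c w)) * s i" using e by simp
      then show "f (c v) \<le> (\<Sum>w\<in>W i. mult H (c v) (c w))" using s1[OF i(1)] by simp
    qed
  qed
qed

text \<open>The degree bound comes from counting indices: each has at most one predecessor and at
  most one successor modulo \<open>n\<close>.\<close>

lemma cycle_iso:
  assumes iso: "graph_iso \<phi> (times_graph t (cycle_graph n)) G" and n: "3 \<le> n"
  shows "bij_betw \<phi> {1..n} (verts G)"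
    and "\<And>i. 1 \<le> i \<Longrightarrow> i < n \<Longrightarrow> mult G (\<phi> i) (\<phi> (Suc i)) = t" "mult G (\<phi> n) (\<phi> 1) = t"
    and "\<And>v. v \<in> verts G \<Longrightarrow> deg G v \<le> 2 * t"
proof -
  show bij: "bij_betw \<phi> {1..n} (verts G)" using iso unfolding graph_iso_def times_graph_def cycle_graph_def by simp
  have m: "mult G (\<phi> i) (\<phi> j) = (if [i = j + 1] (mod n) \<or> [j = i + 1] (mod n) then t else 0)"
    if "i \<in> {1..n}" "j \<in> {1..n}" for i j
    using iso that unfolding graph_iso_def times_graph_def cycle_graph_def by simp
  show "mult G (\<phi> i) (\<phi> (Suc i)) = t" if "1 \<le> i" "i < n" for i using m[of i "Suc i"] that by simp
  have "[1 = n + 1] (mod n)" unfolding cong_def by (rule mod_add_self1[symmetric])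
  then show "mult G (\<phi> n) (\<phi> 1) = t" using m[of n 1] n by simp
  fix v assume "v \<in> verts G"
  then obtain i where i: "i \<in> {1..n}" "v = \<phi> i" using bij unfolding bij_betw_def by blast
  have small: "j = j'" if "[j = j'] (mod n)" "j \<in> {1..n}" "j' \<in> {1..n}" for j j'
  proof -
    have "int n dvd int j - int j'" using that(1) by (simp add: cong_int_iff[symmetric] cong_iff_dvd_diff)
    moreover have "\<bar>int j - int j'\<bar> < int n" using that(2,3) by (simp add: abs_if)
    ultimately show ?thesis using dvd_imp_le_int[of "int j - int j'" "int n"] by auto
  qed
  define J1 J2 where "J1 = {j \<in> {1..n}. [i = j + 1] (mod n)}" and "J2 = {j \<in> {1..n}. [j = i + 1] (mod n)}"
  have c1: "card J1 \<le> 1"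
  proof -
    have "j = j'" if "j \<in> J1" "j' \<in> J1" for j j'
    proof -
      have "[j + 1 = j' + 1] (mod n)" using that cong_sym cong_trans unfolding J1_def by blast
      then have "[j = j'] (mod n)" by (rule cong_add_rcancel_nat[THEN iffD1])
      then show ?thesis using small that unfolding J1_def by blast
    qed
    then show ?thesis by (metis One_nat_def card.infinite card_le_Suc0_iff_eq le0)
  qed
  have c2: "card J2 \<le> 1"
  proof -
    have "j = j'" if "j \<in> J2" "j' \<in> J2" for j j'
    proof -
      have "[j = j'] (mod n)" using that cong_sym cong_trans unfolding J2_def by blast
      then show ?thesis using small that unfolding J2_def by blast
    qed
    then show ?thesis by (metis One_nat_def card.infinite card_le_Suc0_iff_eq le0)
  qed
  have "deg G v = (\<Sum>j\<in>{1..n}. mult G (\<phi> i) (\<phi> j))"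
    unfolding deg_def i(2) by (rule sum.reindex_bij_betw[OF bij, symmetric])
  also have "\<dots> = (\<Sum>j\<in>{1..n}. if j \<in> J1 \<union> J2 then t else 0)"
    using m[OF i(1)] by (intro sum.cong) (auto simp: J1_def J2_def)
  also have "\<dots> = (\<Sum>j\<in>{1..n} \<inter> {j. j \<in> J1 \<union> J2}. t)" by (simp add: sum.If_cases)
  also have "{1..n} \<inter> {j. j \<in> J1 \<union> J2} = J1 \<union> J2" unfolding J1_def J2_def by auto
  also have "(\<Sum>j\<in>J1 \<union> J2. t) = card (J1 \<union> J2) * t" by simp
  also have "\<dots> \<le> 2 * t"
    using card_Un_le[of J1 J2] c1 c2 by (intro mult_le_mono1) simp
  finally show "deg G v \<le> 2 * t" .
qed

lemma alternating:
  fixes b :: "nat \<Rightarrow> bool"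
  assumes "\<And>i. 1 \<le> i \<Longrightarrow> i < n \<Longrightarrow> b (Suc i) \<longleftrightarrow> \<not> b i" "1 \<le> i" "i \<le> n"
  shows "b i \<longleftrightarrow> (b 1 \<longleftrightarrow> odd i)"
  using assms(2,3)
proof (induction i rule: nat_induct_at_least)
  case (Suc i)
  then show ?case using assms(1)[of i] by auto
qed simp

text \<open>Two adjacent vertices with colours in the same one of \<open>U1\<close> and
  \<open>U2\<close> already form a witness by \<open>good_pair\<close>. So the colours would have to
  alternate between the two sets around a cycle of odd length.\<close>

lemma odd_C_uncolorable:
  assumes G: "multigraph G" and C: "cover G X H" and K: "odd_C_configuration G X H f"
  shows "\<not> colorable G X H f" "degree_feasible G X H f"
proof -
  interpret fibred "verts G" "mult G" X "mult H" by (rule cover_fibred[OF G C])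
  obtain t n \<phi> U1 U2 where t: "1 \<le> t" and n: "3 \<le> n" "odd n" and iso: "graph_iso \<phi> (times_graph t (cycle_graph n)) G"
    and dis: "U1 \<inter> U2 = {}" and r1: "restr_inflates_G_cover G X H U1" and r2: "restr_inflates_G_cover G X H U2"
    and val: "\<forall>v\<in>verts G. \<forall>x\<in>X v.
              (x \<in> U1 \<longrightarrow> real (f x) = real t / real (card (X v \<inter> U1))) \<and>
              (x \<in> U2 \<longrightarrow> real (f x) = real t / real (card (X v \<inter> U2))) \<and>
              (x \<notin> U1 \<union> U2 \<longrightarrow> f x = 0)"
    using K unfolding odd_C_configuration_def by (elim exE conjE) blast
  note cyc = cycle_iso[OF iso n(1)]
  have unit: "(\<forall>v\<in>verts G. (\<Sum>x\<in>X v \<inter> U. f x) = t) \<and> (\<forall>u v x y. u \<in> verts G \<and> v \<in> verts G \<and> mult G u v = t \<and>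
      x \<in> X u \<inter> U \<and> y \<in> X v \<inter> U \<longrightarrow> f x \<le> mult H x y \<and> f y \<le> mult H x y)"
    if r: "restr_inflates_G_cover G X H U"
      and vU: "\<And>v x. v \<in> verts G \<Longrightarrow> x \<in> X v \<Longrightarrow> x \<in> U \<Longrightarrow> real (f x) = real t / real (card (X v \<inter> U))" for U
  proof -
    obtain s where s: "1 \<le> s" "\<And>v. v \<in> verts G \<Longrightarrow> card (X v \<inter> U) = s"
      "\<And>u v x y. u \<in> verts G \<Longrightarrow> v \<in> verts G \<Longrightarrow> u \<noteq> v \<Longrightarrow> x \<in> X u \<Longrightarrow> x \<in> U \<Longrightarrow> y \<in> X v \<Longrightarrow> y \<in> U
        \<Longrightarrow> mult H x y * s = mult G u v"
      by (rule inflates_G_coverE[OF r]) blast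
    have fs: "f x * s = t" if "v \<in> verts G" "x \<in> X v" "x \<in> U" for v x
      using nat_mult_of_real_divide[OF vU[OF that]] s(1) s(2)[OF that(1)] by simp
    have "(\<Sum>x\<in>X v \<inter> U. f x) = t" if v: "v \<in> verts G" for v
    proof -
      have "finite (X v \<inter> U)" "X v \<inter> U \<noteq> {}" using finX[OF v] s(1) s(2)[OF v] by auto
      then show ?thesis using fs[OF v] s(2)[OF v] by (intro sum_equal_share) auto
    qed
    moreover have "f x \<le> mult H x y \<and> f y \<le> mult H x y"
      if uv: "u \<in> verts G" "v \<in> verts G" "mult G u v = t" and xy: "x \<in> X u \<inter> U" "y \<in> X v \<inter> U" for u v x y
    proof -
      have "u \<noteq> v" using uv(3) t \<mu>_irrefl[of u] by auto
      then have "mult H x y * s = t" using s(3)[OF uv(1,2)] uv(3) xy by blast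
      moreover have "f x * s = t" "f y * s = t" using fs uv xy by blast+
      ultimately have "f x * s \<le> mult H x y * s" "f y * s \<le> mult H x y * s" by simp_all
      then show ?thesis using s(1) by simp
    qed
    ultimately show ?thesis by blast
  qed
  have u1: "(\<forall>v\<in>verts G. (\<Sum>x\<in>X v \<inter> U1. f x) = t) \<and> (\<forall>u v x y. u \<in> verts G \<and> v \<in> verts G \<and> mult G u v = t \<and>
      x \<in> X u \<inter> U1 \<and> y \<in> X v \<inter> U1 \<longrightarrow> f x \<le> mult H x y \<and> f y \<le> mult H x y)"
    by (rule unit[OF r1]) (use val in blast)
  have u2: "(\<forall>v\<in>verts G. (\<Sum>x\<in>X v \<inter> U2. f x) = t) \<and> (\<forall>u v x y. u \<in> verts G \<and> v \<in> verts G \<and> mult G u v = t \<and>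
      x \<in> X u \<inter> U2 \<and> y \<in> X v \<inter> U2 \<longrightarrow> f x \<le> mult H x y \<and> f y \<le> mult H x y)"
    by (rule unit[OF r2]) (use val in blast)
  show "degree_feasible G X H f"
    unfolding degree_feasible_def
  proof
    fix v assume v: "v \<in> verts G"
    have "2 * t = (\<Sum>x\<in>X v \<inter> U1. f x) + (\<Sum>x\<in>X v \<inter> U2. f x)" using u1 u2 v by simp
    also have "\<dots> = (\<Sum>x\<in>(X v \<inter> U1) \<union> (X v \<inter> U2). f x)"
      using finX[OF v] dis by (intro sum.union_disjoint[symmetric]) auto
    also have "\<dots> \<le> (\<Sum>x\<in>X v. f x)" using finX[OF v] by (intro sum_mono2) auto
    finally show "deg G v \<le> (\<Sum>x\<in>X v. f x)" using cyc(4)[OF v] by simp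
  qed
  show "\<not> colorable G X H f"
  proof
    assume "colorable G X H f"
    then obtain c where c: "good X (mult H) f (verts G) c" using colorable_good[OF G C] by blast
    have cU: "c v \<in> U1 \<or> c v \<in> U2" if v: "v \<in> verts G" for v
      using val v good_in[OF c v] good_pos[OF c v] by (metis UnE less_numeral_extra(3))
    have differ: "(c u \<in> U1) \<longleftrightarrow> \<not> (c v \<in> U1)" if uv: "u \<in> verts G" "v \<in> verts G" "mult G u v = t" for u v
    proof (rule ccontr)
      assume "\<not> ?thesis"
      then have "(c u \<in> U1 \<and> c v \<in> U1) \<or> (c u \<in> U2 \<and> c v \<in> U2)" using cU uv by blast
      then have "f (c u) \<le> mult H (c u) (c v) \<and> f (c v) \<le> mult H (c u) (c v)"
        using u1 u2 uv good_in[OF c uv(1)] good_in[OF c uv(2)] by blast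
      moreover have "u \<noteq> v" using uv(3) t \<mu>_irrefl[of u] by auto
      ultimately show False using good_pair[OF c uv(1,2)] a_sym by blast
    qed
    define b where "b i \<longleftrightarrow> c (\<phi> i) \<in> U1" for i
    have \<phi>V: "\<phi> i \<in> verts G" if "1 \<le> i" "i \<le> n" for i using bij_betwE[OF cyc(1)] that by simp
    have "b (Suc i) \<longleftrightarrow> \<not> b i" if "1 \<le> i" "i < n" for i
      using differ[OF \<phi>V \<phi>V cyc(2)[OF that]] that unfolding b_def by simp
    then have "b n \<longleftrightarrow> (b 1 \<longleftrightarrow> odd n)" using alternating[of n b n] n by simp
    moreover have "b n \<longleftrightarrow> \<not> b 1" using differ[OF \<phi>V \<phi>V cyc(3)] n unfolding b_def by simp
    ultimately show False using n(2) by simp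
  qed
qed

text \<open>As in the odd case, consecutive colours must switch between the \<open>Q i\<close> and
  the \<open>Q (n + i)\<close>. The closing edge of the cycle joins \<open>Q n\<close> to
  \<open>Q (n + 1)\<close> and \<open>Q (n + n)\<close> to \<open>Q 1\<close>, so there a switch is
  forbidden, while even \<open>n\<close> requires one.\<close>

lemma even_C_uncolorable:
  assumes G: "multigraph G" and C: "cover G X H" and K: "even_C_configuration G X H f"
  shows "\<not> colorable G X H f" "degree_feasible G X H f"
proof -
  interpret fibred "verts G" "mult G" X "mult H" by (rule cover_fibred[OF G C])
  obtain t n U where t: "1 \<le> t" and n: "4 \<le> n" "even n" and r: "restr_inflates_double_cover t n G X H U"
    and val: "\<forall>v\<in>verts G. \<forall>x\<in>X v. (x \<in> U \<longrightarrow> real (f x) = 2 * real t / real (card (X v \<inter> U))) \<and> (x \<notin> U \<longrightarrow> f x = 0)"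
    using K unfolding even_C_configuration_def by (elim exE conjE) blast
  have n1: "1 \<le> n" "3 \<le> n" using n by auto
  obtain \<phi> Q s where iso: "graph_iso \<phi> (times_graph t (cycle_graph n)) G" and s: "1 \<le> s"
    and XU: "\<And>i. i \<in> {1..n} \<Longrightarrow> X (\<phi> i) \<inter> U = Q i \<union> Q (n + i)"
    and cd: "\<And>i. i \<in> {1..n} \<Longrightarrow> card (X (\<phi> i) \<inter> U) = 2 * s"
    and mQ: "\<And>i j x y. i \<in> {1..2 * n} \<Longrightarrow> j \<in> {1..2 * n} \<Longrightarrow> i \<noteq> j \<Longrightarrow> x \<in> Q i \<Longrightarrow> y \<in> Q j \<Longrightarrow>
      [i = j + 1] (mod (2 * n)) \<or> [j = i + 1] (mod (2 * n)) \<Longrightarrow> mult H x y * s = t"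
    by (rule inflates_double_coverE[OF r n1(1)]) blast
  note cyc = cycle_iso[OF iso n1(2)]
  have \<phi>V: "\<phi> i \<in> verts G" if "i \<in> {1..n}" for i using bij_betwE[OF cyc(1)] that by simp
  have onto: "\<exists>i\<in>{1..n}. v = \<phi> i" if "v \<in> verts G" for v using cyc(1) that unfolding bij_betw_def by blast
  have f2s: "f x * (2 * s) = 2 * t" if i: "i \<in> {1..n}" and x: "x \<in> X (\<phi> i)" "x \<in> U" for i x
  proof (rule nat_mult_of_real_divide)
    show "real (f x) = real (2 * t) / real (2 * s)" using val \<phi>V[OF i] x cd[OF i] by auto
  qed (use s in auto)
  have fs: "f x * s = t" if "i \<in> {1..n}" "x \<in> X (\<phi> i)" "x \<in> U" for i x using f2s[OF that] by simp
  show "degree_feasible G X H f"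
    unfolding degree_feasible_def
  proof
    fix v assume v: "v \<in> verts G"
    obtain i where i: "i \<in> {1..n}" "v = \<phi> i" using onto[OF v] by blast
    have "finite (X v \<inter> U)" "X v \<inter> U \<noteq> {}" using finX[OF v] s cd[OF i(1)] i(2) by auto
    then have "(\<Sum>x\<in>X v \<inter> U. f x) = 2 * t" using f2s[OF i(1)] cd[OF i(1)] i(2) by (intro sum_equal_share) auto
    moreover have "(\<Sum>x\<in>X v \<inter> U. f x) \<le> (\<Sum>x\<in>X v. f x)" using finX[OF v] by (intro sum_mono2) auto
    ultimately show "deg G v \<le> (\<Sum>x\<in>X v. f x)" using cyc(4)[OF v] by simp
  qed
  show "\<not> colorable G X H f"
  proof
    assume "colorable G X H f"
    then obtain c where c: "good X (mult H) f (verts G) c" using colorable_good[OF G C] by blast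
    have cU: "c (\<phi> i) \<in> U" if i: "i \<in> {1..n}" for i
    proof (rule ccontr)
      assume "c (\<phi> i) \<notin> U"
      then have "f (c (\<phi> i)) = 0" using val \<phi>V[OF i] good_in[OF c \<phi>V[OF i]] by blast
      then show False using good_pos[OF c \<phi>V[OF i]] by simp
    qed
    have cQ: "c (\<phi> i) \<in> Q i \<or> c (\<phi> i) \<in> Q (n + i)" if i: "i \<in> {1..n}" for i
      using XU[OF i] cU[OF i] good_in[OF c \<phi>V[OF i]] by blast
    have bad: False if ij: "i \<in> {1..n}" "j \<in> {1..n}" "i \<noteq> j" and ij': "i' \<in> {1..2 * n}" "j' \<in> {1..2 * n}" "i' \<noteq> j'"
      and cc: "c (\<phi> i) \<in> Q i'" "c (\<phi> j) \<in> Q j'" and cg: "[i' = j' + 1] (mod (2 * n)) \<or> [j' = i' + 1] (mod (2 * n))" for i j i' j'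
    proof -
      have "mult H (c (\<phi> i)) (c (\<phi> j)) * s = t" by (rule mQ[OF ij' cc cg])
      moreover have "f (c (\<phi> i)) * s = t" "f (c (\<phi> j)) * s = t"
        using fs ij cU good_in[OF c \<phi>V] by blast+
      ultimately have "f (c (\<phi> i)) * s \<le> mult H (c (\<phi> i)) (c (\<phi> j)) * s" "f (c (\<phi> j)) * s \<le> mult H (c (\<phi> i)) (c (\<phi> j)) * s"
        by simp_all
      then have le: "f (c (\<phi> i)) \<le> mult H (c (\<phi> i)) (c (\<phi> j))" "f (c (\<phi> j)) \<le> mult H (c (\<phi> i)) (c (\<phi> j))" using s by simp_all
      have "\<phi> i \<noteq> \<phi> j" using cyc(1) ij unfolding bij_betw_def inj_on_def by blast
      then show False using good_pair[OF c \<phi>V[OF ij(1)] \<phi>V[OF ij(2)] _ a_sym le] by blast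
    qed
    define b where "b i \<longleftrightarrow> c (\<phi> i) \<in> Q i" for i
    have "b (Suc i) \<longleftrightarrow> \<not> b i" if i: "1 \<le> i" "i < n" for i
    proof -
      have I: "i \<in> {1..n}" "Suc i \<in> {1..n}" "i \<noteq> Suc i" using i by auto
      have 1: "\<not> (b i \<and> b (Suc i))"
        using bad[OF I, of i "Suc i"] i unfolding b_def by auto
      have 2: "\<not> (c (\<phi> i) \<in> Q (n + i) \<and> c (\<phi> (Suc i)) \<in> Q (n + Suc i))"
        using bad[OF I, of "n + i" "n + Suc i"] i by auto
      show ?thesis using 1 2 cQ[OF I(1)] cQ[OF I(2)] unfolding b_def by blast
    qed
    then have "b n \<longleftrightarrow> (b 1 \<longleftrightarrow> odd n)" using alternating[of n b n] n1 by simp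
    then have bn: "b n \<longleftrightarrow> \<not> b 1" using n(2) by simp
    have I: "n \<in> {1..n}" "1 \<in> {1..n}" "n \<noteq> 1" using n by auto
    have e1: "\<not> (c (\<phi> n) \<in> Q n \<and> c (\<phi> 1) \<in> Q (n + 1))"
      using bad[OF I, of n "n + 1"] n by auto
    have "[1 = n + n + 1] (mod (2 * n))"
      unfolding cong_def mult_2[symmetric] by (rule mod_add_self1[symmetric])
    then have e2: "\<not> (c (\<phi> n) \<in> Q (n + n) \<and> c (\<phi> 1) \<in> Q 1)"
      using bad[OF I, of "n + n" 1] n by auto
    show False using bn e1 e2 cQ[OF I(1)] cQ[OF I(2)] unfolding b_def by blast
  qed
qed

section \<open>Gluing two constructible configurations\<close>

lemma identify_mult_ge:
  assumes I: "obtained_by_identifying G1 G2 A \<pi> \<phi>1 \<phi>2 G"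
  shows "x \<in> verts G1 \<Longrightarrow> y \<in> verts G1 \<Longrightarrow> mult G1 x y \<le> mult G (\<phi>1 x) (\<phi>1 y)"
    and "x \<in> verts G2 \<Longrightarrow> y \<in> verts G2 \<Longrightarrow> mult G2 x y \<le> mult G (\<phi>2 x) (\<phi>2 y)"
proof -
  have inj: "inj_on \<phi>1 (verts G1)" "inj_on \<phi>2 (verts G2)" and vs: "verts G = \<phi>1 ` verts G1 \<union> \<phi>2 ` verts G2"
    using I unfolding obtained_by_identifying_def by simp_all
  have m: "\<forall>x\<in>verts G. \<forall>y\<in>verts G. mult G x y =
        (\<Sum>u | u \<in> verts G1 \<and> \<phi>1 u = x. \<Sum>v | v \<in> verts G1 \<and> \<phi>1 v = y. mult G1 u v) +
        (\<Sum>u | u \<in> verts G2 \<and> \<phi>2 u = x. \<Sum>v | v \<in> verts G2 \<and> \<phi>2 v = y. mult G2 u v)"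
    using I unfolding obtained_by_identifying_def by (elim conjE)
  have e1: "{u. u \<in> verts G1 \<and> \<phi>1 u = \<phi>1 z} = {z}" if "z \<in> verts G1" for z using inj_onD[OF inj(1)] that by blast
  have e2: "{u. u \<in> verts G2 \<and> \<phi>2 u = \<phi>2 z} = {z}" if "z \<in> verts G2" for z using inj_onD[OF inj(2)] that by blast
  show "mult G1 x y \<le> mult G (\<phi>1 x) (\<phi>1 y)" if "x \<in> verts G1" "y \<in> verts G1"
    using m[rule_format, of "\<phi>1 x" "\<phi>1 y"] that vs e1 by simp
  show "mult G2 x y \<le> mult G (\<phi>2 x) (\<phi>2 y)" if "x \<in> verts G2" "y \<in> verts G2"
    using m[rule_format, of "\<phi>2 x" "\<phi>2 y"] that vs e2 by simp
qed

text \<open>Summing over all \<open>y\<close> undoes the grouping by images, so each preimage of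
  \<open>x\<close> contributes its full degree.\<close>

lemma identify_deg:
  assumes I: "obtained_by_identifying G1 G2 A \<pi> \<phi>1 \<phi>2 G" and fin: "finite (verts G1)" "finite (verts G2)"
    and x: "x \<in> verts G"
  shows "deg G x = (\<Sum>u | u \<in> verts G1 \<and> \<phi>1 u = x. deg G1 u) + (\<Sum>u | u \<in> verts G2 \<and> \<phi>2 u = x. deg G2 u)"
proof -
  have vs: "verts G = \<phi>1 ` verts G1 \<union> \<phi>2 ` verts G2"
    using I unfolding obtained_by_identifying_def by simp
  have m: "\<forall>x\<in>verts G. \<forall>y\<in>verts G. mult G x y =
        (\<Sum>u | u \<in> verts G1 \<and> \<phi>1 u = x. \<Sum>v | v \<in> verts G1 \<and> \<phi>1 v = y. mult G1 u v) +
        (\<Sum>u | u \<in> verts G2 \<and> \<phi>2 u = x. \<Sum>v | v \<in> verts G2 \<and> \<phi>2 v = y. mult G2 u v)"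
    using I unfolding obtained_by_identifying_def by (elim conjE)
  have finG: "finite (verts G)" using vs fin by simp
  have grp: "(\<Sum>y\<in>verts G. \<Sum>u\<in>P. \<Sum>v | v \<in> verts K \<and> \<phi> v = y. mult K u v) = (\<Sum>u\<in>P. deg K u)"
    if "finite (verts K)" "\<phi> ` verts K \<subseteq> verts G" for P K \<phi>
  proof -
    have "(\<Sum>y\<in>verts G. \<Sum>u\<in>P. \<Sum>v | v \<in> verts K \<and> \<phi> v = y. mult K u v)
      = (\<Sum>u\<in>P. \<Sum>y\<in>verts G. \<Sum>v | v \<in> verts K \<and> \<phi> v = y. mult K u v)" by (rule sum.swap)
    also have "\<dots> = (\<Sum>u\<in>P. deg K u)"
      unfolding deg_def by (intro sum.cong refl sum.group[OF that(1) finG that(2)])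
    finally show ?thesis .
  qed
  have "deg G x = (\<Sum>y\<in>verts G.
      (\<Sum>u | u \<in> verts G1 \<and> \<phi>1 u = x. \<Sum>v | v \<in> verts G1 \<and> \<phi>1 v = y. mult G1 u v) +
      (\<Sum>u | u \<in> verts G2 \<and> \<phi>2 u = x. \<Sum>v | v \<in> verts G2 \<and> \<phi>2 v = y. mult G2 u v))"
    unfolding deg_def using m x by (intro sum.cong) auto
  also have "\<dots> = (\<Sum>u | u \<in> verts G1 \<and> \<phi>1 u = x. deg G1 u) + (\<Sum>u | u \<in> verts G2 \<and> \<phi>2 u = x. deg G2 u)"
    unfolding sum.distrib using grp[OF fin(1), of \<phi>1] grp[OF fin(2), of \<phi>2] vs by simp
  finally show ?thesis .
qed

lemma not_good_witness:
  assumes "\<not> good X a f D c" "\<And>v. v \<in> D \<Longrightarrow> c v \<in> X v"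
  obtains W where "W \<subseteq> D" "W \<noteq> {}" "\<And>v. v \<in> W \<Longrightarrow> f (c v) \<le> (\<Sum>w\<in>W. a (c v) (c w))"
proof -
  have "\<exists>W. W \<subseteq> D \<and> W \<noteq> {} \<and> \<not> (\<exists>v\<in>W. (\<Sum>w\<in>W. a (c v) (c w)) < f (c v))"
    using assms unfolding good_def by auto
  then show ?thesis using that by (meson not_less)
qed

text \<open>A colouring restricts to both parts and yields witness sets \<open>W1\<close> and
  \<open>W2\<close>. If one of them misses the identified vertex, its image is a witness already, as
  values are unchanged and multiplicities do not drop there. Otherwise the union of the images
  works, because at the identified vertex both the values and the degrees add up.\<close>

lemma merged_uncolorable:
  assumes G: "multigraph G" and C: "cover G X H" and G1: "multigraph G1" and C1: "cover G1 X1 H1"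
    and G2: "multigraph G2" and C2: "cover G2 X2 H2"
    and M: "merged_configuration G1 X1 H1 f1 G2 X2 H2 f2 G X H f"
    and un: "\<not> colorable G1 X1 H1 f1" "\<not> colorable G2 X2 H2 f2"
    and df: "degree_feasible G1 X1 H1 f1" "degree_feasible G2 X2 H2 f2"
  shows "\<not> colorable G X H f" "degree_feasible G X H f"
proof -
  interpret B1: fibred "verts G1" "mult G1" X1 "mult H1" by (rule cover_fibred[OF G1 C1])
  interpret B2: fibred "verts G2" "mult G2" X2 "mult H2" by (rule cover_fibred[OF G2 C2])
  obtain v1 v2 \<pi> \<phi>1 \<phi>2 \<psi>1 \<psi>2 where v1: "v1 \<in> verts G1" and v2: "v2 \<in> verts G2"
    and \<pi>: "bij_betw \<pi> (X1 v1) (X2 v2)"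
    and IG: "obtained_by_identifying G1 G2 {v1} (\<lambda>_. v2) \<phi>1 \<phi>2 G"
    and IH: "obtained_by_identifying H1 H2 (X1 v1) \<pi> \<psi>1 \<psi>2 H"
    and XX1: "\<forall>v\<in>verts G1. X (\<phi>1 v) = \<psi>1 ` X1 v"
    and XX2: "\<forall>v\<in>verts G2. X (\<phi>2 v) = \<psi>2 ` X2 v"
    and ff1: "\<forall>y\<in>verts H1 - X1 v1. f (\<psi>1 y) = f1 y"
    and ff2: "\<forall>y\<in>verts H2 - X2 v2. f (\<psi>2 y) = f2 y"
    and ff: "\<forall>x\<in>X1 v1. f (\<psi>1 x) = f1 x + f2 (\<pi> x)"
    using M unfolding merged_configuration_def by (elim bexE exE conjE) (rule that; assumption)
  have vG: "verts G = \<phi>1 ` verts G1 \<union> \<phi>2 ` verts G2" and inj: "inj_on \<phi>1 (verts G1)" "inj_on \<phi>2 (verts G2)"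
    using IG unfolding obtained_by_identifying_def by simp_all
  have gl: "\<phi>1 x = \<phi>2 y \<longleftrightarrow> x = v1 \<and> y = v2" if "x \<in> verts G1" "y \<in> verts G2" for x y
    using IG that unfolding obtained_by_identifying_def by simp
  have injH: "inj_on \<psi>1 (verts H1)" "inj_on \<psi>2 (verts H2)"
    using IH unfolding obtained_by_identifying_def by simp_all
  have glH: "\<psi>1 x = \<psi>2 y \<longleftrightarrow> x \<in> X1 v1 \<and> y = \<pi> x" if "x \<in> verts H1" "y \<in> verts H2" for x y
    using IH that unfolding obtained_by_identifying_def by simp
  have X1H: "X1 v \<subseteq> verts H1" if "v \<in> verts G1" for v using coverD(4)[OF C1 that] .
  have X2H: "X2 v \<subseteq> verts H2" if "v \<in> verts G2" for v using coverD(4)[OF C2 that] .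
  have out1: "f (\<psi>1 y) = f1 y" if "v \<in> verts G1" "v \<noteq> v1" "y \<in> X1 v" for v y
    using ff1 that X1H cover_disjoint[OF C1 that(1) v1 that(3)] by blast
  have out2: "f (\<psi>2 y) = f2 y" if "v \<in> verts G2" "v \<noteq> v2" "y \<in> X2 v" for v y
    using ff2 that X2H cover_disjoint[OF C2 that(1) v2 that(3)] by blast
  have vstar: "\<phi>1 v1 = \<phi>2 v2" using gl[OF v1 v2] by simp
  have e1: "{u. u \<in> verts G1 \<and> \<phi>1 u = \<phi>1 z} = {z}" if "z \<in> verts G1" for z using inj_onD[OF inj(1)] that by blast
  have e2: "{u. u \<in> verts G2 \<and> \<phi>2 u = \<phi>2 z} = {z}" if "z \<in> verts G2" for z using inj_onD[OF inj(2)] that by blast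
  have e12: "{u. u \<in> verts G2 \<and> \<phi>2 u = \<phi>1 z} = {}" if "z \<in> verts G1" "z \<noteq> v1" for z
    using gl[OF that(1)] that(2) by force
  have e21: "{u. u \<in> verts G1 \<and> \<phi>1 u = \<phi>2 z} = {}" if "z \<in> verts G2" "z \<noteq> v2" for z
    using gl[OF _ that(1)] that(2) by force
  note dg = identify_deg[OF IG B1.finV B2.finV]
  have s1: "(\<Sum>x\<in>X (\<phi>1 v). g x) = (\<Sum>x\<in>X1 v. g (\<psi>1 x))" if v: "v \<in> verts G1" for v and g :: "_ \<Rightarrow> nat"
    unfolding XX1[rule_format, OF v] by (rule sum.reindex[unfolded o_def]) (rule inj_on_subset[OF injH(1) X1H[OF v]])
  have s2: "(\<Sum>x\<in>X (\<phi>2 v). g x) = (\<Sum>x\<in>X2 v. g (\<psi>2 x))" if v: "v \<in> verts G2" for v and g :: "_ \<Rightarrow> nat"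
    unfolding XX2[rule_format, OF v] by (rule sum.reindex[unfolded o_def]) (rule inj_on_subset[OF injH(2) X2H[OF v]])
  have d1: "deg G1 v \<le> (\<Sum>x\<in>X1 v. f1 x)" if "v \<in> verts G1" for v using df(1) that unfolding degree_feasible_def by blast
  have d2: "deg G2 v \<le> (\<Sum>x\<in>X2 v. f2 x)" if "v \<in> verts G2" for v using df(2) that unfolding degree_feasible_def by blast
  show "degree_feasible G X H f"
    unfolding degree_feasible_def
  proof
    fix x assume x: "x \<in> verts G"
    consider "x = \<phi>1 v1" | v where "x = \<phi>1 v" "v \<in> verts G1" "v \<noteq> v1" | v where "x = \<phi>2 v" "v \<in> verts G2" "v \<noteq> v2"
    proof -
      have "(\<exists>v\<in>verts G1. x = \<phi>1 v) \<or> (\<exists>v\<in>verts G2. x = \<phi>2 v)" using x unfolding vG by auto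
      then show ?thesis using that vstar by metis
    qed
    then show "deg G x \<le> (\<Sum>y\<in>X x. f y)"
    proof cases
      case 1
      have "deg G x = deg G1 v1 + deg G2 v2" using dg[OF x] e1[OF v1] e2[OF v2] unfolding 1 vstar by simp
      also have "\<dots> \<le> (\<Sum>x\<in>X1 v1. f1 x) + (\<Sum>x\<in>X2 v2. f2 x)" using d1[OF v1] d2[OF v2] by simp
      also have "(\<Sum>x\<in>X2 v2. f2 x) = (\<Sum>x\<in>X1 v1. f2 (\<pi> x))" by (rule sum.reindex_bij_betw[OF \<pi>, symmetric])
      also have "(\<Sum>x\<in>X1 v1. f1 x) + (\<Sum>x\<in>X1 v1. f2 (\<pi> x)) = (\<Sum>x\<in>X1 v1. f (\<psi>1 x))"
        unfolding sum.distrib[symmetric] using ff by (intro sum.cong) auto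
      also have "\<dots> = (\<Sum>y\<in>X x. f y)" unfolding 1 by (rule s1[OF v1, symmetric])
      finally show ?thesis .
    next
      case (2 v)
      have "deg G x = deg G1 v" using dg[OF x] e1[OF 2(2)] e12[OF 2(2,3)] unfolding 2(1) by simp
      also have "\<dots> \<le> (\<Sum>x\<in>X1 v. f1 x)" by (rule d1[OF 2(2)])
      also have "\<dots> = (\<Sum>x\<in>X1 v. f (\<psi>1 x))" using out1[OF 2(2,3)] by (intro sum.cong) auto
      also have "\<dots> = (\<Sum>y\<in>X x. f y)" unfolding 2(1) by (rule s1[OF 2(2), symmetric])
      finally show ?thesis .
    next
      case (3 v)
      have "deg G x = deg G2 v" using dg[OF x] e2[OF 3(2)] e21[OF 3(2,3)] unfolding 3(1) by simp
      also have "\<dots> \<le> (\<Sum>x\<in>X2 v. f2 x)" by (rule d2[OF 3(2)])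
      also have "\<dots> = (\<Sum>x\<in>X2 v. f (\<psi>2 x))" using out2[OF 3(2,3)] by (intro sum.cong) auto
      also have "\<dots> = (\<Sum>y\<in>X x. f y)" unfolding 3(1) by (rule s2[OF 3(2), symmetric])
      finally show ?thesis .
    qed
  qed
  show "\<not> colorable G X H f"
  proof
    assume "colorable G X H f"
    then obtain c where c: "good X (mult H) f (verts G) c" using colorable_good[OF G C] by blast
    have "\<forall>v\<in>verts G1. \<exists>x\<in>X1 v. c (\<phi>1 v) = \<psi>1 x"
    proof
      fix v assume v: "v \<in> verts G1"
      then have "c (\<phi>1 v) \<in> X (\<phi>1 v)" using good_in[OF c] vG by blast
      then show "\<exists>x\<in>X1 v. c (\<phi>1 v) = \<psi>1 x" using XX1 v by auto
    qed
    then obtain c1 where c1: "\<And>v. v \<in> verts G1 \<Longrightarrow> c1 v \<in> X1 v" "\<And>v. v \<in> verts G1 \<Longrightarrow> c (\<phi>1 v) = \<psi>1 (c1 v)" by metis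
    have "\<forall>v\<in>verts G2. \<exists>x\<in>X2 v. c (\<phi>2 v) = \<psi>2 x"
    proof
      fix v assume v: "v \<in> verts G2"
      then have "c (\<phi>2 v) \<in> X (\<phi>2 v)" using good_in[OF c] vG by blast
      then show "\<exists>x\<in>X2 v. c (\<phi>2 v) = \<psi>2 x" using XX2 v by auto
    qed
    then obtain c2 where c2: "\<And>v. v \<in> verts G2 \<Longrightarrow> c2 v \<in> X2 v" "\<And>v. v \<in> verts G2 \<Longrightarrow> c (\<phi>2 v) = \<psi>2 (c2 v)" by metis
    have "\<not> good X1 (mult H1) f1 (verts G1) c1" using un(1) good_colorable[OF C1] by blast
    then obtain W1 where W1: "W1 \<subseteq> verts G1" "W1 \<noteq> {}" "\<And>v. v \<in> W1 \<Longrightarrow> f1 (c1 v) \<le> (\<Sum>w\<in>W1. mult H1 (c1 v) (c1 w))"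
      using not_good_witness[of X1 "mult H1" f1 "verts G1" c1] c1(1) by blast
    have "\<not> good X2 (mult H2) f2 (verts G2) c2" using un(2) good_colorable[OF C2] by blast
    then obtain W2 where W2: "W2 \<subseteq> verts G2" "W2 \<noteq> {}" "\<And>v. v \<in> W2 \<Longrightarrow> f2 (c2 v) \<le> (\<Sum>w\<in>W2. mult H2 (c2 v) (c2 w))"
      using not_good_witness[of X2 "mult H2" f2 "verts G2" c2] c2(1) by blast
    have fin: "finite W1" "finite W2" using W1(1) W2(1) B1.finV B2.finV finite_subset by auto
    have c1H: "c1 v \<in> verts H1" if "v \<in> verts G1" for v using c1(1)[OF that] X1H[OF that] by blast
    have c2H: "c2 v \<in> verts H2" if "v \<in> verts G2" for v using c2(1)[OF that] X2H[OF that] by blast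
    have le1: "(\<Sum>w\<in>Y. mult H1 (c1 u) (c1 w)) \<le> (\<Sum>z\<in>\<phi>1 ` Y. mult H (c (\<phi>1 u)) (c z))"
      if u: "u \<in> verts G1" and Y: "Y \<subseteq> verts G1" for u Y
    proof -
      have "(\<Sum>z\<in>\<phi>1 ` Y. mult H (c (\<phi>1 u)) (c z)) = (\<Sum>w\<in>Y. mult H (c (\<phi>1 u)) (c (\<phi>1 w)))"
        by (rule sum.reindex[unfolded o_def]) (rule inj_on_subset[OF inj(1) Y])
      moreover have "(\<Sum>w\<in>Y. mult H1 (c1 u) (c1 w)) \<le> (\<Sum>w\<in>Y. mult H (c (\<phi>1 u)) (c (\<phi>1 w)))"
      proof (rule sum_mono)
        fix w assume "w \<in> Y"
        then have w: "w \<in> verts G1" using Y by blast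
        show "mult H1 (c1 u) (c1 w) \<le> mult H (c (\<phi>1 u)) (c (\<phi>1 w))"
          unfolding c1(2)[OF u] c1(2)[OF w] by (rule identify_mult_ge(1)[OF IH c1H[OF u] c1H[OF w]])
      qed
      ultimately show ?thesis by simp
    qed
    have le2: "(\<Sum>w\<in>Y. mult H2 (c2 u) (c2 w)) \<le> (\<Sum>z\<in>\<phi>2 ` Y. mult H (c (\<phi>2 u)) (c z))"
      if u: "u \<in> verts G2" and Y: "Y \<subseteq> verts G2" for u Y
    proof -
      have "(\<Sum>z\<in>\<phi>2 ` Y. mult H (c (\<phi>2 u)) (c z)) = (\<Sum>w\<in>Y. mult H (c (\<phi>2 u)) (c (\<phi>2 w)))"
        by (rule sum.reindex[unfolded o_def]) (rule inj_on_subset[OF inj(2) Y])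
      moreover have "(\<Sum>w\<in>Y. mult H2 (c2 u) (c2 w)) \<le> (\<Sum>w\<in>Y. mult H (c (\<phi>2 u)) (c (\<phi>2 w)))"
      proof (rule sum_mono)
        fix w assume "w \<in> Y"
        then have w: "w \<in> verts G2" using Y by blast
        show "mult H2 (c2 u) (c2 w) \<le> mult H (c (\<phi>2 u)) (c (\<phi>2 w))"
          unfolding c2(2)[OF u] c2(2)[OF w] by (rule identify_mult_ge(2)[OF IH c2H[OF u] c2H[OF w]])
      qed
      ultimately show ?thesis by simp
    qed
    have in1: "f (c (\<phi>1 u)) \<le> (\<Sum>z\<in>W. mult H (c (\<phi>1 u)) (c z))"
      if u: "u \<in> W1" "u \<noteq> v1" and W: "\<phi>1 ` W1 \<subseteq> W" "finite W" for u W
    proof -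
      have uV: "u \<in> verts G1" using u W1(1) by blast
      have "f (c (\<phi>1 u)) = f1 (c1 u)" unfolding c1(2)[OF uV] by (rule out1[OF uV u(2) c1(1)[OF uV]])
      also have "\<dots> \<le> (\<Sum>z\<in>\<phi>1 ` W1. mult H (c (\<phi>1 u)) (c z))" using W1(3)[OF u(1)] le1[OF uV W1(1)] by (rule order_trans)
      also have "\<dots> \<le> (\<Sum>z\<in>W. mult H (c (\<phi>1 u)) (c z))" using W by (intro sum_mono2) auto
      finally show ?thesis .
    qed
    have in2: "f (c (\<phi>2 u)) \<le> (\<Sum>z\<in>W. mult H (c (\<phi>2 u)) (c z))"
      if u: "u \<in> W2" "u \<noteq> v2" and W: "\<phi>2 ` W2 \<subseteq> W" "finite W" for u W
    proof -
      have uV: "u \<in> verts G2" using u W2(1) by blast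
      have "f (c (\<phi>2 u)) = f2 (c2 u)" unfolding c2(2)[OF uV] by (rule out2[OF uV u(2) c2(1)[OF uV]])
      also have "\<dots> \<le> (\<Sum>z\<in>\<phi>2 ` W2. mult H (c (\<phi>2 u)) (c z))" using W2(3)[OF u(1)] le2[OF uV W2(1)] by (rule order_trans)
      also have "\<dots> \<le> (\<Sum>z\<in>W. mult H (c (\<phi>2 u)) (c z))" using W by (intro sum_mono2) auto
      finally show ?thesis .
    qed
    have sub: "\<phi>1 ` W1 \<subseteq> verts G" "\<phi>2 ` W2 \<subseteq> verts G" using W1(1) W2(1) vG by blast+
    have m1: "v1 \<in> W1"
    proof (rule ccontr)
      assume no: "v1 \<notin> W1"
      show False
      proof (rule goodD[OF c sub(1)])
        show "\<phi>1 ` W1 \<noteq> {}" using W1(2) by blast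
        fix z assume "z \<in> \<phi>1 ` W1"
        then obtain u where u: "u \<in> W1" "z = \<phi>1 u" by blast
        then have "u \<noteq> v1" using no by blast
        then show "f (c z) \<le> (\<Sum>w\<in>\<phi>1 ` W1. mult H (c z) (c w))" unfolding u(2) by (rule in1[OF u(1)]) (use fin in auto)
      qed
    qed
    have m2: "v2 \<in> W2"
    proof (rule ccontr)
      assume no: "v2 \<notin> W2"
      show False
      proof (rule goodD[OF c sub(2)])
        show "\<phi>2 ` W2 \<noteq> {}" using W2(2) by blast
        fix z assume "z \<in> \<phi>2 ` W2"
        then obtain u where u: "u \<in> W2" "z = \<phi>2 u" by blast
        then have "u \<noteq> v2" using no by blast
        then show "f (c z) \<le> (\<Sum>w\<in>\<phi>2 ` W2. mult H (c z) (c w))" unfolding u(2) by (rule in2[OF u(1)]) (use fin in auto)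
      qed
    qed
    let ?W = "\<phi>1 ` W1 \<union> \<phi>2 ` W2"
    show False
    proof (rule goodD[OF c, of ?W])
      show "?W \<subseteq> verts G" using sub by blast
      show "?W \<noteq> {}" using W1(2) by blast
      fix z assume "z \<in> ?W"
      then consider "z = \<phi>1 v1" | u where "u \<in> W1" "u \<noteq> v1" "z = \<phi>1 u" | u where "u \<in> W2" "u \<noteq> v2" "z = \<phi>2 u"
      proof -
        have "(\<exists>u\<in>W1. z = \<phi>1 u) \<or> (\<exists>u\<in>W2. z = \<phi>2 u)" using \<open>z \<in> ?W\<close> by auto
        then show ?thesis using that vstar by metis
      qed
      then show "f (c z) \<le> (\<Sum>w\<in>?W. mult H (c z) (c w))"
      proof cases
        case (2 u)
        show ?thesis unfolding 2(3) by (rule in1[OF 2(1,2)]) (use fin in auto)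
      next
        case (3 u)
        show ?thesis unfolding 3(3) by (rule in2[OF 3(1,2)]) (use fin in auto)
      next
        case 1
        have cz: "c z = \<psi>1 (c1 v1)" "c z = \<psi>2 (c2 v2)" using c1(2)[OF v1] c2(2)[OF v2] vstar 1 by simp_all
        then have c2v: "c2 v2 = \<pi> (c1 v1)" using glH[OF c1H[OF v1] c2H[OF v2]] by simp
        have zz: "c z = c (\<phi>1 v1)" "c z = c (\<phi>2 v2)" using 1 vstar by simp_all
        have "f (c z) = f1 (c1 v1) + f2 (c2 v2)" unfolding cz(1) c2v using ff c1(1)[OF v1] by blast
        also have "f1 (c1 v1) \<le> (\<Sum>w\<in>\<phi>1 ` W1. mult H (c z) (c w))"
          unfolding zz(1) using W1(3)[OF m1] le1[OF v1 W1(1)] by (rule order_trans)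
        \<comment> \<open>The vertex \<open>v2\<close> is removed so that the identified vertex is
          not counted twice; it contributes nothing to the sum, as \<open>H2\<close> has no
          loops.\<close>
        also have "f2 (c2 v2) \<le> (\<Sum>w\<in>\<phi>2 ` (W2 - {v2}). mult H (c z) (c w))"
        proof -
          have "f2 (c2 v2) \<le> (\<Sum>w\<in>W2. mult H2 (c2 v2) (c2 w))" by (rule W2(3)[OF m2])
          also have "\<dots> = (\<Sum>w\<in>W2 - {v2}. mult H2 (c2 v2) (c2 w))"
            using fin(2) m2 by (simp add: sum.remove[of W2 v2] B2.a_irrefl)
          also have "\<dots> \<le> (\<Sum>w\<in>\<phi>2 ` (W2 - {v2}). mult H (c z) (c w))"
            unfolding zz(2) by (rule le2[OF v2]) (use W2(1) in blast)
          finally show ?thesis .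
        qed
        also have "(\<Sum>w\<in>\<phi>1 ` W1. mult H (c z) (c w)) + (\<Sum>w\<in>\<phi>2 ` (W2 - {v2}). mult H (c z) (c w))
          = (\<Sum>w\<in>\<phi>1 ` W1 \<union> \<phi>2 ` (W2 - {v2}). mult H (c z) (c w))"
        proof (rule sum.union_disjoint[symmetric])
          show "\<phi>1 ` W1 \<inter> \<phi>2 ` (W2 - {v2}) = {}"
          proof (rule ccontr)
            assume "\<not> ?thesis"
            then obtain x y where "x \<in> W1" "y \<in> W2" "y \<noteq> v2" "\<phi>1 x = \<phi>2 y" by blast
            then show False using gl[of x y] W1(1) W2(1) by blast
          qed
        qed (use fin in auto)
        also have "\<dots> \<le> (\<Sum>w\<in>?W. mult H (c z) (c w))" using fin by (intro sum_mono2) auto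
        finally show ?thesis by simp
      qed
    qed
  qed
qed

text \<open>\<open>uniform_configuration\<close> is carried through the induction because
  \<open>merged_uncolorable\<close> wants both parts to be multigraphs with covers, and (K5)
  provides this only through their constructibility.\<close>

lemma constructible_uncolorable:
  "constructible G X H f \<Longrightarrow> uniform_configuration G X H f \<and> \<not> colorable G X H f \<and> degree_feasible G X H f"
proof (induction rule: constructible.induct)
  case (K1 G X H f)
  then show ?case using M_uncolorable unfolding uniform_configuration_def configuration_def by blast
next
  case (K2 G X H f)
  then show ?case using K_uncolorable unfolding uniform_configuration_def configuration_def by blast
next
  case (K3 G X H f)
  then show ?case using odd_C_uncolorable unfolding uniform_configuration_def configuration_def by blast
next
  case (K4 G X H f)
  then show ?case using even_C_uncolorable unfolding uniform_configuration_def configuration_def by blast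
next
  case (K5 G X H f G1 X1 H1 f1 G2 X2 H2 f2)
  have m: "multigraph G" "cover G X H" "multigraph G1" "cover G1 X1 H1" "multigraph G2" "cover G2 X2 H2"
    using K5 unfolding uniform_configuration_def configuration_def by blast+
  show ?case using merged_uncolorable[OF m K5.hyps(4)] K5 by blast
qed

theorem theorem8:
  fixes G :: "'a mgraph" and X :: "'a \<Rightarrow> 'b set" and H :: "'b mgraph" and f :: "'b \<Rightarrow> nat"
  assumes "multigraph G" and "connected_graph G"
    and "cover G X H"
    and "\<exists>r\<ge>1. \<forall>v\<in>verts G. card (X v) = r"
  shows "(configuration G X H f \<and> \<not> colorable G X H f \<and> degree_feasible G X H f)
         \<longleftrightarrow> constructible G X H f"
proof
  assume "configuration G X H f \<and> \<not> colorable G X H f \<and> degree_feasible G X H f"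
  then show "constructible G X H f" using uncolorable_constructible[OF assms] by blast
next
  assume "constructible G X H f"
  then show "configuration G X H f \<and> \<not> colorable G X H f \<and> degree_feasible G X H f"
    using constructible_uncolorable assms unfolding configuration_def by blast
qed

end
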